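(* Let $\beta>0$. Assume the following. (1) For every $n\in\mathbb{N}$, $R_n\in C^1(\mathcal{M}_n)$ up to the boundary of $\mathcal{M}_n$; and there is $\kappa_2\in\mathbb{R}_+$ with $\|\phi(W_1)-\phi(W_2)\|_2\le\kappa_2\|W_1-W_2\|_2$ for all $W_1,W_2\in\mathcal{W}$. (2) There is $\kappa_\square\in\mathbb{R}_+$ such that for almost every $(x,y)\in[0,1]^2$, $|\phi(U)(x,y)-\phi(V)(x,y)|\le\kappa_\square\|U-V\|_\square$ for all $U,V\in\mathcal{W}$. Let $W_0\in\mathcal{W}$ and let $W_0^{(n)}\in\mathcal{W}_n$, $n\in\mathbb{N}$, satisfy $\lim_{n\to\infty}\|W_0^{(n)}-W_0\|_2=0$. For each $n$ let $X_n$ be the $\mathcal{M}_n$-valued solution, with $X_n(0)=M_n(W_0^{(n)})$, of $$dX_n(t)=-n^2\nabla R_n(X_n(t))\,dt+\beta\,dB_n(t)+dL_n^-(t)-dL_n^+(t),\qquad t\in\mathbb{R}_+,$$ where $B_n$ is an $n\times n$ symmetric matrix-valued process whose entries are independent standard Brownian motions up to matrix symmetry and $(X_n,L_n^+,L_n^-)$ solves the Skorokhod problem with respect to $\mathcal{M}_n$. Let $\Gamma:\mathbb{R}_+\to\mathcal{W}$, $\Gamma(0)=W_0$, be the deterministic kernel-valued curve determined by the coupled system $$dX_{1,2}(t)=-\phi(\Gamma(t))(U_1,U_2)\,dt+\beta\,dB_{1,2}(t)+dL^-_{1,2}(t)-dL^+_{1,2}(t),\quad X_{1,2}(0)=W_0(U_1,U_2),$$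 $$\Gamma(t)(u,v)=\mathbb{E}\big[X_{1,2}(t)\,\big|\,(U_1,U_2)=(u,v)\big],$$ where $U_1,U_2$ are independent $\mathrm{Uniform}[0,1]$ random variables, $B_{1,2}$ is a standard linear Brownian motion independent of $(U_1,U_2)$, and $(X_{1,2},L^+_{1,2},L^-_{1,2})$ solves the Skorokhod problem with respect to $[-1,1]$. Then the process of random kernels $(K(X_n(t)))_{t\in\mathbb{R}_+}$ converges, locally uniformly in time in the cut norm, in probability, to $\Gamma$; that is, for every $T>0$, $\sup_{s\in[0,T]}\|K(X_n(s))-\Gamma(s)\|_\square\to0$ in probability as $n\to\infty$.
   Context: Notation. $\mathbb{R}_+=[0,\infty)$. $\mathcal{W}$ is the set of kernels: measurable symmetric functions $[0,1]^2\to[-1,1]$. $L^\infty_{\mathrm{sym}}$ is the set of bounded measurable symmetric functions on $[0,1]^2$; $\|\cdot\|_2$ and $\langle\cdot,\cdot\rangle$ are the $L^2([0,1]^2)$ norm and inner product. The cut norm is $\|W\|_\square=\sup_{S,T\subseteq[0,1]}\big|\int_{S\times T}W(x,y)\,dx\,dy\big|$ over Borel sets $S,T$. For a measure-preserving map $\varphi$ of $[0,1]$, $W^\varphi(x,y)=W(\varphi(x),\varphi(y))$. $\mathcal{M}_n$ is the set of symmetric $n\times n$ matrices with entries in $[-1,1]$. With $Q_1,\dots,Q_n$ the partition of $[0,1]$ into $n$ consecutive intervals of equal length, $K(A)$ is the step function equal to $A_{ij}$ on $Q_i\times Q_j$; $\mathcal{W}_n=K(\mathcal{M}_n)$; $M_n$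 is the inverse of $K$ on step functions constant on the blocks $Q_i\times Q_j$. $R:\mathcal{W}\to\mathbb{R}$ is invariant ($R(W^\varphi)=R(W)$ for all measure-preserving $\varphi$) and has a Fr\'echet-like derivative $\phi:\mathcal{W}\to L^\infty_{\mathrm{sym}}$: for every $V\in\mathcal{W}$, $\big(R(W)-R(V)-\langle\phi(V),W-V\rangle\big)/\|W-V\|_2\to0$ as $\|W-V\|_2\to0$, $W\in\mathcal{W}$. $R_n=R\circ K$ on $\mathcal{M}_n$, and $\nabla R_n(A)$ is the symmetric matrix of Euclidean partial derivatives, normalized so that $R_n(B)-R_n(A)=\sum_{i,j}\nabla R_n(A)_{ij}(B-A)_{ij}+o(\|B-A\|_F)$; it satisfies $n^2\nabla R_n=M_n\circ\phi\circ K$. Skorokhod problem: $(X,L^+,L^-)$ solves the Skorokhod problem with respect to $[-1,1]$ if $X,L^\pm$ are adapted, $L^\pm(0)=0$, $X(t)\in[-1,1]$, $L^\pm$ are non-decreasing, $\int_0^\infty\mathbf{1}\{X(t)>-1\}\,dL^-(t)=0$ and $\int_0^\infty\mathbf{1}\{X(t)<1\}\,dL^+(t)=0$; with respect to $\mathcal{M}_n$ the same is required entrywise (all processes symmetric-matrix valued). The coupled system for $(X_{1,2},\Gamma)$ has a strong, pathwise unique solution. *)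

theory Defs
  imports "HOL-Probability.Probability"
begin

subsection \<open>Kernels\<close>

abbreviation unit_interval :: "real measure" where
  "unit_interval \<equiv> restrict_space lborel {0..1}"

abbreviation unit_square :: "(real \<times> real) measure" where
  "unit_square \<equiv> unit_interval \<Otimes>\<^sub>M unit_interval"

text \<open>
  A kernel is a function on the whole plane of which only the values on the unit square matter.
\<close>

definition Linfty_sym :: "(real \<times> real \<Rightarrow> real) set" where
  "Linfty_sym = {W. W \<in> borel_measurable unit_square \<and>
     (\<forall>x\<in>{0..1}. \<forall>y\<in>{0..1}. W (x, y) = W (y, x)) \<and>
     (\<exists>C. \<forall>p\<in>{0..1} \<times> {0..1}. \<bar>W p\<bar> \<le> C)}"

definition kernels :: "(real \<times> real \<Rightarrow> real) set" where
  "kernels = {W. W \<in> borel_measurable unit_square \<and>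
     (\<forall>x\<in>{0..1}. \<forall>y\<in>{0..1}. W (x, y) = W (y, x)) \<and>
     (\<forall>p\<in>{0..1} \<times> {0..1}. W p \<in> {-1..1})}"

definition L2_inner :: "(real \<times> real \<Rightarrow> real) \<Rightarrow> (real \<times> real \<Rightarrow> real) \<Rightarrow> real" where
  "L2_inner U V = (\<integral>p. U p * V p \<partial>unit_square)"

definition L2_norm :: "(real \<times> real \<Rightarrow> real) \<Rightarrow> real" where
  "L2_norm W = sqrt (\<integral>p. (W p)\<^sup>2 \<partial>unit_square)"

definition cut_norm :: "(real \<times> real \<Rightarrow> real) \<Rightarrow> real" where
  "cut_norm W =
     (SUP (S, T) \<in> sets unit_interval \<times> sets unit_interval. \<bar>LINT p:(S \<times> T)|unit_square. W p\<bar>)"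

definition measure_preserving_unit :: "(real \<Rightarrow> real) \<Rightarrow> bool" where
  "measure_preserving_unit f \<longleftrightarrow>
     f \<in> measurable unit_interval unit_interval \<and> distr unit_interval unit_interval f = unit_interval"

definition invariant_functional :: "((real \<times> real \<Rightarrow> real) \<Rightarrow> real) \<Rightarrow> bool" where
  "invariant_functional R \<longleftrightarrow>
     (\<forall>W\<in>kernels. \<forall>f. measure_preserving_unit f \<longrightarrow> R (\<lambda>(x, y). W (f x, f y)) = R W)"

text \<open>
  Clearing the denominator in the difference quotient also covers the case of \<open>W\<close> equal
  almost everywhere to \<open>V\<close>, where it says that \<open>R W = R V\<close>.
\<close>

definition frechet_like_derivative ::
  "((real \<times> real \<Rightarrow> real) \<Rightarrow> real) \<Rightarrow> ((real \<times> real \<Rightarrow> real) \<Rightarrow> real \<times> real \<Rightarrow> real) \<Rightarrow> bool" where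
  "frechet_like_derivative R \<phi> \<longleftrightarrow>
     (\<forall>V\<in>kernels. \<phi> V \<in> Linfty_sym \<and>
        (\<forall>\<epsilon>>0. \<exists>\<delta>>0. \<forall>W\<in>kernels. L2_norm (W - V) < \<delta> \<longrightarrow>
           \<bar>R W - R V - L2_inner (\<phi> V) (W - V)\<bar> \<le> \<epsilon> * L2_norm (W - V)))"

subsection \<open>Symmetric matrices and step kernels\<close>

text \<open>
  An \<open>n \<times> n\<close> matrix is a function of two indices below \<open>n\<close>, extended by \<open>0\<close>; the extension makes
  the representation unique. Rows and columns are numbered from \<open>0\<close>.
\<close>

definition sym_mats :: "nat \<Rightarrow> (nat \<Rightarrow> nat \<Rightarrow> real) set" where
  "sym_mats n = {A. (\<forall>i j. A i j = A j i) \<and> (\<forall>i j. \<not> (i < n \<and> j < n) \<longrightarrow> A i j = 0)}"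

definition cube_mats :: "nat \<Rightarrow> (nat \<Rightarrow> nat \<Rightarrow> real) set" where
  "cube_mats n = {A \<in> sym_mats n. \<forall>i<n. \<forall>j<n. A i j \<in> {-1..1}}"

definition Q :: "nat \<Rightarrow> nat \<Rightarrow> real set" where
  "Q n i = (if Suc i = n then {real i / real n..1}
            else {real i / real n..<real (Suc i) / real n})"

definition K :: "nat \<Rightarrow> (nat \<Rightarrow> nat \<Rightarrow> real) \<Rightarrow> real \<times> real \<Rightarrow> real" where
  "K n A = (\<lambda>(x, y). \<Sum>i<n. \<Sum>j<n. A i j * indicator (Q n i) x * indicator (Q n j) y)"

definition step_kernels :: "nat \<Rightarrow> (real \<times> real \<Rightarrow> real) set" where
  "step_kernels n = K n ` cube_mats n"

definition Mat :: "nat \<Rightarrow> (real \<times> real \<Rightarrow> real) \<Rightarrow> nat \<Rightarrow> nat \<Rightarrow> real" where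
  "Mat n = inv_into (sym_mats n) (K n)"

definition frobenius_norm :: "nat \<Rightarrow> (nat \<Rightarrow> nat \<Rightarrow> real) \<Rightarrow> real" where
  "frobenius_norm n A = sqrt (\<Sum>i<n. \<Sum>j<n. (A i j)\<^sup>2)"

definition has_gradient ::
  "nat \<Rightarrow> ((nat \<Rightarrow> nat \<Rightarrow> real) \<Rightarrow> real) \<Rightarrow> (nat \<Rightarrow> nat \<Rightarrow> real) \<Rightarrow> (nat \<Rightarrow> nat \<Rightarrow> real) \<Rightarrow> bool" where
  "has_gradient n f A G \<longleftrightarrow> G \<in> sym_mats n \<and>
     (\<forall>\<epsilon>>0. \<exists>\<delta>>0. \<forall>B\<in>cube_mats n. frobenius_norm n (B - A) < \<delta> \<longrightarrow>
        \<bar>f B - f A - (\<Sum>i<n. \<Sum>j<n. G i j * (B i j - A i j))\<bar> \<le> \<epsilon> * frobenius_norm n (B - A))"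

text \<open>
  For \<open>A \<in> cube_mats n\<close>, on the boundary too, there is at most one \<open>G\<close> as above, because the
  directions from \<open>A\<close> into \<open>cube_mats n\<close> span the symmetric matrices.
\<close>

definition gradient ::
  "nat \<Rightarrow> ((nat \<Rightarrow> nat \<Rightarrow> real) \<Rightarrow> real) \<Rightarrow> (nat \<Rightarrow> nat \<Rightarrow> real) \<Rightarrow> nat \<Rightarrow> nat \<Rightarrow> real" where
  "gradient n f A = (THE G. has_gradient n f A G)"

text \<open>
  Continuity refers to the product topology on functions of two indices, which on
  \<open>sym_mats n\<close> is the Euclidean one.
\<close>

definition C1_up_to_boundary :: "nat \<Rightarrow> ((nat \<Rightarrow> nat \<Rightarrow> real) \<Rightarrow> real) \<Rightarrow> bool" where
  "C1_up_to_boundary n f \<longleftrightarrow>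
     (\<forall>A\<in>cube_mats n. \<exists>G. has_gradient n f A G) \<and> continuous_on (cube_mats n) (gradient n f)"

subsection \<open>Brownian motion and reflected equations\<close>

text \<open>Processes and filtrations are indexed by the reals; only times \<open>t \<ge> 0\<close> matter.\<close>

definition filtered_prob_space :: "'a measure \<Rightarrow> (real \<Rightarrow> 'a measure) \<Rightarrow> bool" where
  "filtered_prob_space M F \<longleftrightarrow>
     prob_space M \<and> filtration (space M) F \<and> (\<forall>t. sets (F t) \<subseteq> sets M)"

text \<open>
  A family of independent standard Brownian motions relative to the filtration \<open>F\<close>. The index
  \<open>None\<close> stands for the past: the increments over \<open>[s, t]\<close> are independent of each other and,
  jointly, of \<open>F s\<close>. By adaptedness this makes the processes \<open>B i\<close> independent of each other
  and of \<open>F 0\<close>.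
\<close>

definition brownian_family ::
  "'a measure \<Rightarrow> (real \<Rightarrow> 'a measure) \<Rightarrow> 'i set \<Rightarrow> ('i \<Rightarrow> real \<Rightarrow> 'a \<Rightarrow> real) \<Rightarrow> bool" where
  "brownian_family M F I B \<longleftrightarrow>
     (\<forall>i\<in>I. \<forall>t\<ge>0. B i t \<in> borel_measurable (F t)) \<and>
     (\<forall>i\<in>I. AE \<omega> in M. B i 0 \<omega> = 0 \<and> continuous_on {0..} (\<lambda>t. B i t \<omega>)) \<and>
     (\<forall>s t. 0 \<le> s \<longrightarrow> s < t \<longrightarrow>
        (\<forall>i\<in>I. distributed M lborel (\<lambda>\<omega>. B i t \<omega> - B i s \<omega>) (normal_density 0 (sqrt (t - s)))) \<and>
        prob_space.indep_sets M
          (\<lambda>k. case k of None \<Rightarrow> sets (F s)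
             | Some i \<Rightarrow> sets (vimage_algebra (space M) (\<lambda>\<omega>. B i t \<omega> - B i s \<omega>) borel))
          (insert None (Some ` I)))"

definition brownian_motion ::
  "'a measure \<Rightarrow> (real \<Rightarrow> 'a measure) \<Rightarrow> (real \<Rightarrow> 'a \<Rightarrow> real) \<Rightarrow> bool" where
  "brownian_motion M F B \<longleftrightarrow> brownian_family M F {()} (\<lambda>_. B)"

text \<open>The measure \<open>dL\<close> of a right-continuous non-decreasing \<open>L\<close> on \<open>{0..}\<close> with \<open>L 0 = 0\<close>.\<close>

definition stieltjes_measure :: "(real \<Rightarrow> real) \<Rightarrow> real measure" where
  "stieltjes_measure L = interval_measure (\<lambda>t. L (max 0 t))"

text \<open>
  Skorokhod problem with respect to \<open>[-1, 1]\<close>, for paths \<open>X\<close>, \<open>L\<^sup>+\<close>, \<open>L\<^sup>-\<close>. Right-continuity is the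
  convention under which \<open>dL\<^sup>\<plusminus>\<close> is defined.
\<close>

definition skorokhod_paths :: "(real \<Rightarrow> real) \<Rightarrow> (real \<Rightarrow> real) \<Rightarrow> (real \<Rightarrow> real) \<Rightarrow> bool" where
  "skorokhod_paths x lp lm \<longleftrightarrow>
     lp 0 = 0 \<and> lm 0 = 0 \<and>
     (\<forall>t\<ge>0. x t \<in> {-1..1}) \<and>
     (\<forall>t\<ge>0. continuous (at_right t) x \<and> continuous (at_right t) lp \<and> continuous (at_right t) lm) \<and>
     mono_on {0..} lp \<and> mono_on {0..} lm \<and>
     (\<integral>\<^sup>+t\<in>{0..}. indicator {t. x t > -1} t \<partial>stieltjes_measure lm) = 0 \<and>
     (\<integral>\<^sup>+t\<in>{0..}. indicator {t. x t < 1} t \<partial>stieltjes_measure lp) = 0"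

definition skorokhod_problem ::
  "'a measure \<Rightarrow> (real \<Rightarrow> 'a measure) \<Rightarrow> (real \<Rightarrow> 'a \<Rightarrow> real) \<Rightarrow> (real \<Rightarrow> 'a \<Rightarrow> real) \<Rightarrow>
   (real \<Rightarrow> 'a \<Rightarrow> real) \<Rightarrow> bool" where
  "skorokhod_problem M F X Lp Lm \<longleftrightarrow>
     (\<forall>t\<ge>0. X t \<in> borel_measurable (F t) \<and> Lp t \<in> borel_measurable (F t) \<and>
        Lm t \<in> borel_measurable (F t)) \<and>
     (AE \<omega> in M. skorokhod_paths (\<lambda>t. X t \<omega>) (\<lambda>t. Lp t \<omega>) (\<lambda>t. Lm t \<omega>))"

text \<open>\<open>dX = b dt + \<beta> dB + dL\<^sup>- - dL\<^sup>+\<close> with \<open>X(0) = x0\<close>, for a drift process \<open>b\<close>.\<close>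

definition reflected_sde ::
  "'a measure \<Rightarrow> (real \<Rightarrow> 'a measure) \<Rightarrow> (real \<Rightarrow> 'a \<Rightarrow> real) \<Rightarrow> real \<Rightarrow> ('a \<Rightarrow> real) \<Rightarrow>
   (real \<Rightarrow> 'a \<Rightarrow> real) \<Rightarrow> (real \<Rightarrow> 'a \<Rightarrow> real) \<Rightarrow> (real \<Rightarrow> 'a \<Rightarrow> real) \<Rightarrow> (real \<Rightarrow> 'a \<Rightarrow> real) \<Rightarrow> bool" where
  "reflected_sde M F b \<beta> x0 B X Lp Lm \<longleftrightarrow>
     skorokhod_problem M F X Lp Lm \<and>
     (AE \<omega> in M. X 0 \<omega> = x0 \<omega> \<and>
        (\<forall>t\<ge>0. set_integrable lborel {0..t} (\<lambda>s. b s \<omega>) \<and>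
           X t \<omega> = X 0 \<omega> + (LINT s:{0..t}|lborel. b s \<omega>) + \<beta> * B t \<omega> + Lm t \<omega> - Lp t \<omega>))"

text \<open>\<open>dX = - n\<^sup>2 \<nabla>f(X) dt + \<beta> dB + dL\<^sup>- - dL\<^sup>+\<close> with \<open>X(0) = A\<close>, reflected in \<open>cube_mats n\<close>.\<close>

definition matrix_sde ::
  "nat \<Rightarrow> 'a measure \<Rightarrow> (real \<Rightarrow> 'a measure) \<Rightarrow> ((nat \<Rightarrow> nat \<Rightarrow> real) \<Rightarrow> real) \<Rightarrow> real \<Rightarrow>
   (nat \<Rightarrow> nat \<Rightarrow> real) \<Rightarrow> (real \<Rightarrow> 'a \<Rightarrow> nat \<Rightarrow> nat \<Rightarrow> real) \<Rightarrow> (real \<Rightarrow> 'a \<Rightarrow> nat \<Rightarrow> nat \<Rightarrow> real) \<Rightarrow>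
   (real \<Rightarrow> 'a \<Rightarrow> nat \<Rightarrow> nat \<Rightarrow> real) \<Rightarrow> (real \<Rightarrow> 'a \<Rightarrow> nat \<Rightarrow> nat \<Rightarrow> real) \<Rightarrow> bool" where
  "matrix_sde n M F f \<beta> A B X Lp Lm \<longleftrightarrow>
     filtered_prob_space M F \<and>
     brownian_family M F {(i, j). i \<le> j \<and> j < n} (\<lambda>(i, j) t \<omega>. B t \<omega> i j) \<and>
     (AE \<omega> in M. \<forall>t\<ge>0. B t \<omega> \<in> sym_mats n \<and> X t \<omega> \<in> cube_mats n \<and>
        Lp t \<omega> \<in> sym_mats n \<and> Lm t \<omega> \<in> sym_mats n) \<and>
     (\<forall>i<n. \<forall>j<n. reflected_sde M F (\<lambda>s \<omega>. - ((real n)\<^sup>2 * gradient n f (X s \<omega>) i j)) \<beta> (\<lambda>_. A i j)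
        (\<lambda>t \<omega>. B t \<omega> i j) (\<lambda>t \<omega>. X t \<omega> i j) (\<lambda>t \<omega>. Lp t \<omega> i j) (\<lambda>t \<omega>. Lm t \<omega> i j))"

text \<open>
  The coupled system for \<open>(X, \<Gamma>)\<close>. The pair \<open>(U1, U2)\<close> is known at time \<open>0\<close>, so \<open>B\<close>, being a
  Brownian motion relative to \<open>F\<close>, is independent of it. The conditional expectation determines
  \<open>\<Gamma> t\<close> almost everywhere.
\<close>

definition coupled_system ::
  "'a measure \<Rightarrow> (real \<Rightarrow> 'a measure) \<Rightarrow> ((real \<times> real \<Rightarrow> real) \<Rightarrow> real \<times> real \<Rightarrow> real) \<Rightarrow> real \<Rightarrow>
   (real \<times> real \<Rightarrow> real) \<Rightarrow> ('a \<Rightarrow> real) \<Rightarrow> ('a \<Rightarrow> real) \<Rightarrow> (real \<Rightarrow> 'a \<Rightarrow> real) \<Rightarrow>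
   (real \<Rightarrow> 'a \<Rightarrow> real) \<Rightarrow> (real \<Rightarrow> 'a \<Rightarrow> real) \<Rightarrow> (real \<Rightarrow> 'a \<Rightarrow> real) \<Rightarrow>
   (real \<Rightarrow> real \<times> real \<Rightarrow> real) \<Rightarrow> bool" where
  "coupled_system M F \<phi> \<beta> W0 U1 U2 B X Lp Lm \<Gamma> \<longleftrightarrow>
     filtered_prob_space M F \<and>
     U1 \<in> measurable (F 0) unit_interval \<and> U2 \<in> measurable (F 0) unit_interval \<and>
     distr M unit_interval U1 = unit_interval \<and> distr M unit_interval U2 = unit_interval \<and>
     prob_space.indep_var M unit_interval U1 unit_interval U2 \<and>
     brownian_motion M F B \<and>
     reflected_sde M F (\<lambda>s \<omega>. - \<phi> (\<Gamma> s) (U1 \<omega>, U2 \<omega>)) \<beta> (\<lambda>\<omega>. W0 (U1 \<omega>, U2 \<omega>)) B X Lp Lm \<and>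
     (\<forall>t\<ge>0. \<Gamma> t \<in> kernels) \<and>
     (AE p in unit_square. \<Gamma> 0 p = W0 p) \<and>
     (\<forall>t\<ge>0. AE \<omega> in M. \<Gamma> t (U1 \<omega>, U2 \<omega>) =
        real_cond_exp M (vimage_algebra (space M) (\<lambda>\<omega>. (U1 \<omega>, U2 \<omega>)) unit_square) (X t) \<omega>)"

text \<open>
  Convergence in probability to \<open>0\<close>, the \<open>n\<close>-th variable living on its own space. Path properties
  are only required almost surely, so the events below need not be measurable;
  the outer measure is the probability whenever they are.
\<close>

definition tendsto_0_in_probability :: "(nat \<Rightarrow> 'a measure) \<Rightarrow> (nat \<Rightarrow> 'a \<Rightarrow> real) \<Rightarrow> bool" where
  "tendsto_0_in_probability M Y \<longleftrightarrow>
     (\<forall>\<epsilon>>0. (\<lambda>n. outer_measure_of (M n) {\<omega> \<in> space (M n). \<bar>Y n \<omega>\<bar> > \<epsilon>}) \<longlonglongrightarrow> 0)"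

end

theory Submission
  imports Defs
begin

text \<open>
  Reflected equations driven by the same Brownian motion differ only through their drifts, because
  reflection pushes two solutions towards each other. Hence the entries of \<open>X\<^sub>n\<close> stay within the
  time integral of \<open>\<kappa> * \<parallel>K(X\<^sub>n) - \<Gamma>\<parallel>\<close> (cut norm) of the independent entries that solve the same
  equation with the limiting drift \<open>\<phi>(\<Gamma>)\<close> averaged over blocks, and Gronwall's inequality reduces the
  theorem to those. A random symmetric matrix with independent centred bounded entries is small in
  cut norm by a fourth moment bound, and the means of the entries are close to \<open>\<Gamma>\<close> because block
  averages converge in \<open>L\<^sup>1\<close>.

  To avoid solving the two-sided Skorokhod problem, a reflected path is compared directly with the
  time-discrete scheme \<open>y \<mapsto> clamp (y + increment)\<close> on a grid: the distance is controlled by the difference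
  of the drifts and the oscillation of the driving path over one step. The law of the scheme involves
  only finitely many independent Gaussian increments.
\<close>

section \<open>Reflected paths and projected schemes\<close>

definition clamp :: "real \<Rightarrow> real" where
  "clamp x = max (-1) (min 1 x)"

primrec scheme :: "real \<Rightarrow> (nat \<Rightarrow> real) \<Rightarrow> nat \<Rightarrow> real" where
  "scheme x d 0 = x"
| "scheme x d (Suc k) = clamp (scheme x d k + d k)"

lemma clamp_bounds: "\<bar>clamp x\<bar> \<le> 1"
  unfolding clamp_def by linarith

lemma clamp_id: "\<bar>x\<bar> \<le> 1 \<Longrightarrow> clamp x = x"
  unfolding clamp_def by linarith

lemma clamp_minus: "clamp (- x) = - clamp x"
  by (simp add: clamp_def max_def min_def)

lemma clamp_lipschitz: "\<bar>clamp x - clamp y\<bar> \<le> \<bar>x - y\<bar>"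
  by (simp add: clamp_def max_def min_def)

lemma continuous_on_clamp [continuous_intros]:
  "continuous_on S f \<Longrightarrow> continuous_on S (\<lambda>x. clamp (f x))"
  unfolding clamp_def by (intro continuous_intros)

lemma borel_measurable_clamp [measurable]: "clamp \<in> borel_measurable borel"
  by (intro borel_measurable_continuous_onI continuous_intros)

lemma scheme_bounds: "\<bar>x\<bar> \<le> 1 \<Longrightarrow> \<bar>scheme x d k\<bar> \<le> 1"
  by (cases k) (auto simp: clamp_bounds)

lemma scheme_minus: "scheme (- x) (\<lambda>i. - d i) k = - scheme x d k"
  by (induction k) (auto simp: clamp_minus[symmetric])

lemma scheme_lipschitz:
  "\<bar>scheme x d k - scheme x' d' k\<bar> \<le> \<bar>x - x'\<bar> + (\<Sum>l<k. \<bar>d l - d' l\<bar>)"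
proof (induction k)
  case (Suc k)
  have "\<bar>scheme x d (Suc k) - scheme x' d' (Suc k)\<bar> \<le> \<bar>(scheme x d k + d k) - (scheme x' d' k + d' k)\<bar>"
    unfolding scheme.simps by (rule clamp_lipschitz)
  with Suc show ?case by (simp; linarith)
qed simp

lemma scheme_cong: "(\<And>i. i < k \<Longrightarrow> d i = d' i) \<Longrightarrow> scheme x d k = scheme x d' k"
  by (induction k) auto

lemma borel_measurable_scheme [measurable]:
  assumes "x \<in> borel_measurable M" "\<And>i. i < k \<Longrightarrow> (\<lambda>\<omega>. d \<omega> i) \<in> borel_measurable M"
  shows "(\<lambda>\<omega>. scheme (x \<omega>) (d \<omega>) k) \<in> borel_measurable M"
  using assms(2)
proof (induction k)
  case 0
  then show ?case using assms(1) by simp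
next
  case (Suc k)
  then have [measurable]: "(\<lambda>\<omega>. scheme (x \<omega>) (d \<omega>) k) \<in> borel_measurable M"
    "(\<lambda>\<omega>. d \<omega> k) \<in> borel_measurable M" by auto
  show ?case by simp
qed

lemma skorokhod_paths_bound:
  assumes "skorokhod_paths x lp lm" "t \<ge> 0" shows "\<bar>x t\<bar> \<le> 1"
proof -
  have "x t \<in> {-1..1}" using assms unfolding skorokhod_paths_def by blast
  then show ?thesis by auto
qed

lemma stieltjes_measure_Ioc:
  assumes "mono_on {0..} L" "\<forall>t\<ge>0. continuous (at_right t) L" "0 \<le> s" "s \<le> t"
  shows "emeasure (stieltjes_measure L) {s<..t} = ennreal (L t - L s)"
proof -
  have "emeasure (stieltjes_measure L) {s<..t} = ennreal (L (max 0 t) - L (max 0 s))"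
    unfolding stieltjes_measure_def
  proof (rule emeasure_interval_measure_Ioc)
    show "L (max 0 x) \<le> L (max 0 y)" if "x \<le> y" for x y
      using that by (intro mono_onD[OF assms(1)]) auto
    show "continuous (at_right a) (\<lambda>t. L (max 0 t))" for a
    proof (cases "a \<ge> 0")
      case True
      have "((\<lambda>t. L (max 0 t)) \<longlongrightarrow> L (max 0 a)) (at_right a) \<longleftrightarrow> (L \<longlongrightarrow> L (max 0 a)) (at_right a)"
        by (rule filterlim_cong)
          (use True in \<open>auto simp: eventually_at_filter intro!: always_eventually\<close>)
      with True assms(2) show ?thesis by (auto simp: continuous_within)
    next
      case False
      have "eventually (\<lambda>t. t < 0) (at_right a)"
        using False by (intro eventually_at_rightI[of a 0]) auto
      then have "((\<lambda>t. L (max 0 t)) \<longlongrightarrow> L (max 0 a)) (at_right a) \<longleftrightarrow> ((\<lambda>t. L 0) \<longlongrightarrow> L 0) (at_right a)"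
        by (intro filterlim_cong) (use False in \<open>auto simp: max_def elim!: eventually_mono\<close>)
      then show ?thesis by (auto simp: continuous_within)
    qed
  qed (use assms in auto)
  with assms show ?thesis by simp
qed

text \<open>The supremum of the zeros need not be attained, as the path is only right-continuous; hence the slack \<open>\<eta>\<close>.\<close>

lemma stieltjes_growth_point:
  assumes L: "mono_on {0..} L" "\<forall>t\<ge>0. continuous (at_right t) L"
    and null: "(\<integral>\<^sup>+t\<in>{0..}. indicator {t. P t} t \<partial>stieltjes_measure L) = 0"
    and st: "0 \<le> s" "s \<le> t" and "L t \<noteq> L s" and "\<eta> > 0"
  obtains r where "s < r" "r \<le> t" "\<not> P r" "L t - L r < \<eta>"
proof -
  let ?\<mu> = "stieltjes_measure L"
  have sets: "sets ?\<mu> = sets borel" by (simp add: stieltjes_measure_def)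
  have null': "emeasure ?\<mu> S = 0" if "S \<in> sets borel" "S \<subseteq> {0..}" "\<forall>r\<in>S. P r" for S
  proof -
    have "emeasure ?\<mu> S = (\<integral>\<^sup>+t. indicator S t \<partial>?\<mu>)" using that sets by simp
    also have "\<dots> \<le> (\<integral>\<^sup>+t\<in>{0..}. indicator {t. P t} t \<partial>?\<mu>)"
      using that by (intro nn_integral_mono) (auto simp: indicator_def)
    finally show ?thesis using null by simp
  qed
  define A where "A = {r\<in>{s<..t}. \<not> P r}"
  have "A \<noteq> {}"
  proof
    assume "A = {}"
    then have "emeasure ?\<mu> {s<..t} = 0" using st by (intro null') (auto simp: A_def)
    with stieltjes_measure_Ioc[OF L st] have "L t \<le> L s" by (simp add: ennreal_eq_0_iff)
    moreover have "L s \<le> L t" using st by (intro mono_onD[OF L(1)]) auto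
    ultimately show False using \<open>L t \<noteq> L s\<close> by simp
  qed
  have bdd: "bdd_above A" by (auto simp: A_def bdd_above_def)
  define \<tau> where "\<tau> = Sup A"
  have A_le: "r \<le> \<tau>" if "r \<in> A" for r unfolding \<tau>_def by (rule cSup_upper[OF that bdd])
  have "\<tau> \<le> t" unfolding \<tau>_def using \<open>A \<noteq> {}\<close> by (intro cSup_least) (auto simp: A_def)
  have "s < \<tau>" using \<open>A \<noteq> {}\<close> A_le by (fastforce simp: A_def)
  show ?thesis
  proof (cases "\<tau> \<in> A")
    case True
    have "emeasure ?\<mu> {\<tau><..t} = 0" using st \<open>s < \<tau>\<close>
    proof (intro null' ballI)
      fix r assume r: "r \<in> {\<tau><..t}"
      show "P r"
      proof (rule ccontr)
        assume "\<not> P r"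
        then have "r \<in> A" using r \<open>s < \<tau>\<close> by (auto simp: A_def)
        then show False using A_le[of r] r by auto
      qed
    qed auto
    with stieltjes_measure_Ioc[OF L, of \<tau> t] st \<open>s < \<tau>\<close> \<open>\<tau> \<le> t\<close> have "L t \<le> L \<tau>" by (simp add: ennreal_eq_0_iff)
    with True \<open>\<eta> > 0\<close> show ?thesis by (intro that[of \<tau>]) (auto simp: A_def)
  next
    case False
    define f where "f = (\<lambda>n::nat. {max s (\<tau> - 1 / Suc n) <..t})"
    have f_inter: "(\<Inter>n. f n) = {\<tau>..t}"
    proof -
      have "\<tau> \<le> r" if "\<And>n::nat. \<tau> - 1 / Suc n < r" for r
      proof (rule ccontr)
        assume "\<not> \<tau> \<le> r"
        then have "0 < \<tau> - r" by simp
        then obtain n where "inverse (real (Suc n)) < \<tau> - r" using reals_Archimedean by blast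
        with that[of n] show False by (simp add: inverse_eq_divide)
      qed
      moreover have "\<tau> - 1 / real (Suc n) < r" if "\<tau> \<le> r" for r n using that
        by (smt (verit) divide_pos_pos of_nat_0_less_iff zero_less_Suc)
      ultimately show ?thesis using \<open>s < \<tau>\<close> by (fastforce simp: f_def)
    qed
    have "emeasure ?\<mu> {\<tau>..t} = 0" using st \<open>s < \<tau>\<close>
    proof (intro null' ballI)
      fix r assume r: "r \<in> {\<tau>..t}"
      show "P r"
      proof (rule ccontr)
        assume "\<not> P r"
        then have "r \<in> A" using r \<open>s < \<tau>\<close> by (auto simp: A_def)
        then show False using A_le[of r] r False by auto
      qed
    qed auto
    moreover have "(\<lambda>n. emeasure ?\<mu> (f n)) \<longlonglongrightarrow> emeasure ?\<mu> (\<Inter>n. f n)"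
    proof (rule Lim_emeasure_decseq)
      show "range f \<subseteq> sets ?\<mu>" by (auto simp: f_def sets)
      show "decseq f"
        unfolding decseq_def
      proof (intro allI impI subsetI)
        fix i j :: nat and r assume "i \<le> j" and r: "r \<in> f j"
        have "1 / real (Suc j) \<le> 1 / real (Suc i)" using \<open>i \<le> j\<close> by (intro divide_left_mono) auto
        with r show "r \<in> f i" unfolding f_def by auto
      qed
      show "emeasure ?\<mu> (f i) \<noteq> \<infinity>" for i
      proof -
        have "\<tau> - 1 / real (Suc i) \<le> \<tau>" by simp
        with st \<open>s < \<tau>\<close> \<open>\<tau> \<le> t\<close> have "0 \<le> max s (\<tau> - 1 / real (Suc i))" "max s (\<tau> - 1 / real (Suc i)) \<le> t"
          by linarith+
        then show ?thesis unfolding f_def by (subst stieltjes_measure_Ioc[OF L]) auto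
      qed
    qed
    ultimately have "(\<lambda>n. emeasure ?\<mu> (f n)) \<longlonglongrightarrow> 0" by (simp add: f_inter)
    then have "eventually (\<lambda>n. emeasure ?\<mu> (f n) < ennreal \<eta>) sequentially"
      using \<open>\<eta> > 0\<close> by (intro order_tendstoD(2)) auto
    then obtain n where n: "emeasure ?\<mu> (f n) < ennreal \<eta>" by (auto simp: eventually_sequentially)
    have "max s (\<tau> - 1 / Suc n) < \<tau>" using \<open>s < \<tau>\<close> by (simp add: field_simps)
    then obtain r where r: "r \<in> A" "max s (\<tau> - 1 / Suc n) < r"
      unfolding \<tau>_def using less_cSup_iff[OF \<open>A \<noteq> {}\<close> bdd] by blast
    have "ennreal (L t - L r) = emeasure ?\<mu> {r<..t}"
      using r st by (intro stieltjes_measure_Ioc[OF L, symmetric]) (auto simp: A_def)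
    also have "\<dots> \<le> emeasure ?\<mu> (f n)"
      using r by (intro emeasure_mono) (auto simp: f_def sets)
    finally have "L t - L r < \<eta>" using n
      by (meson ennreal_leI leD not_less order_le_less_trans)
    with r show ?thesis by (intro that[of r]) (auto simp: A_def)
  qed
qed

lemma reflected_path_le_scheme:
  fixes x lp lm \<psi> :: "real \<Rightarrow> real" and \<tau> :: "nat \<Rightarrow> real"
  assumes sk: "skorokhod_paths x lp lm"
    and x: "\<And>t. t \<ge> 0 \<Longrightarrow> x t = c + \<psi> t + lm t - lp t"
    and \<tau>: "mono \<tau>" "\<tau> 0 \<ge> 0" and z: "\<bar>z\<bar> \<le> 1"
    and E: "\<And>a b. a \<le> b \<Longrightarrow> b \<le> k \<Longrightarrow> \<bar>\<psi> (\<tau> b) - \<psi> (\<tau> a) - (\<Sum>i\<in>{a..<b}. d i)\<bar> \<le> E"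
    and o: "\<And>i r. i < k \<Longrightarrow> \<tau> i \<le> r \<Longrightarrow> r \<le> \<tau> (Suc i) \<Longrightarrow> \<bar>\<psi> (\<tau> (Suc i)) - \<psi> r\<bar> \<le> e"
    and "e \<ge> 0"
  shows "x (\<tau> k) - scheme z d k \<le> \<bar>x (\<tau> 0) - z\<bar> + E + e"
proof (cases "x (\<tau> k) \<le> scheme z d k")
  case True
  have "0 \<le> E" using E[of 0 0] by simp
  with True \<open>e \<ge> 0\<close> show ?thesis by (smt (verit))
next
  case False
  let ?y = "scheme z d"
  have E0: "0 \<le> E" using E[of 0 0] by simp
  have \<tau>0: "\<tau> i \<ge> 0" for i using \<tau> by (metis le0 monoD order_trans)
  have lm: "mono_on {0..} lm" "\<forall>t\<ge>0. continuous (at_right t) lm"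
    "(\<integral>\<^sup>+t\<in>{0..}. indicator {t. x t > -1} t \<partial>stieltjes_measure lm) = 0"
    and lp: "mono_on {0..} lp" and x1: "\<And>t. t \<ge> 0 \<Longrightarrow> x t \<in> {-1..1}"
    using sk by (auto simp: skorokhod_paths_def)
  obtain j where j: "j \<le> k" "j = 0 \<or> x (\<tau> j) \<le> ?y j" "\<And>i. j < i \<Longrightarrow> i \<le> k \<Longrightarrow> x (\<tau> i) > ?y i"
  proof (cases "\<exists>j\<le>k. x (\<tau> j) \<le> ?y j")
    case True
    define j where "j = Max {j. j \<le> k \<and> x (\<tau> j) \<le> ?y j}"
    have fin: "finite {j. j \<le> k \<and> x (\<tau> j) \<le> ?y j}" by auto
    have "j \<in> {j. j \<le> k \<and> x (\<tau> j) \<le> ?y j}" unfolding j_def using True by (intro Max_in fin) auto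
    moreover have "x (\<tau> i) > ?y i" if "j < i" "i \<le> k" for i
      using Max_ge[OF fin, of i] that unfolding j_def[symmetric] by force
    ultimately show ?thesis using that by auto
  next
    case False
    then show ?thesis by (intro that[of 0]) auto
  qed
  have ygrow: "?y k \<ge> ?y a + (\<Sum>i\<in>{a..<b}. d i)" if "j \<le> a" "a \<le> b" "b = k" for a b
  proof -
    have "b \<le> k \<longrightarrow> ?y b \<ge> ?y a + (\<Sum>i\<in>{a..<b}. d i)" using \<open>a \<le> b\<close>
    proof (induction b rule: dec_induct)
      case (step b)
      show ?case
      proof
        assume "Suc b \<le> k"
        with j(3)[of "Suc b"] step \<open>j \<le> a\<close> have "?y (Suc b) < x (\<tau> (Suc b))" by auto
        also have "\<dots> \<le> 1" using x1[OF \<tau>0] by auto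
        finally have "?y b + d b \<le> ?y (Suc b)" by (auto simp: clamp_def max_def min_def split: if_splits)
        with step \<open>Suc b \<le> k\<close> show "?y (Suc b) \<ge> ?y a + (\<Sum>i\<in>{a..<Suc b}. d i)" by simp
      qed
    qed auto
    with that show ?thesis by simp
  qed
  have jk: "\<tau> j \<le> \<tau> k" using j \<tau>(1) by (simp add: monoD)
  show ?thesis
  proof (cases "lm (\<tau> k) = lm (\<tau> j)")
    case True
    have "lp (\<tau> j) \<le> lp (\<tau> k)" using \<tau>0 jk by (intro mono_onD[OF lp]) auto
    then have "x (\<tau> k) \<le> x (\<tau> j) + (\<psi> (\<tau> k) - \<psi> (\<tau> j))"
      using x[OF \<tau>0, of j] x[OF \<tau>0, of k] True by simp
    also have "\<dots> \<le> x (\<tau> j) + (\<Sum>i\<in>{j..<k}. d i) + E" using E[of j k] j by (simp add: abs_le_iff)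
    also have "\<dots> \<le> x (\<tau> j) - ?y j + ?y k + E" using ygrow[of j k] j by simp
    finally have "x (\<tau> k) - ?y k \<le> x (\<tau> j) - ?y j + E" by simp
    moreover have "x (\<tau> j) - ?y j \<le> \<bar>x (\<tau> 0) - z\<bar>" using j(2) by auto
    ultimately show ?thesis using \<open>e \<ge> 0\<close> by linarith
  next
    case False
    have "x (\<tau> k) - ?y k \<le> E + e"
    proof (rule field_le_epsilon)
      fix \<eta> :: real assume "\<eta> > 0"
      obtain r where r: "\<tau> j < r" "r \<le> \<tau> k" "\<not> x r > -1" "lm (\<tau> k) - lm r < \<eta>"
        using stieltjes_growth_point[OF lm \<tau>0 jk False \<open>\<eta> > 0\<close>] .
      have r0: "r \<ge> 0" using r \<tau>0[of j] by linarith
      have "j < k" using r j by (cases "j = k") auto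
      define i where "i = (LEAST i. r \<le> \<tau> i)"
      have ri: "r \<le> \<tau> i" unfolding i_def by (rule LeastI[of _ k]) (use r in auto)
      have "i \<le> k" unfolding i_def by (rule Least_le) (use r in auto)
      have "j < i" using ri r(1) \<tau>(1) by (metis le_less_linear less_le_trans monoD not_less)
      then obtain i' where i': "i = Suc i'" by (cases i) auto
      have "\<tau> i' \<le> r" using not_less_Least[of i' "\<lambda>i. r \<le> \<tau> i"] i' unfolding i_def by force
      have "lp r \<le> lp (\<tau> k)" using r0 r \<tau>0 by (intro mono_onD[OF lp]) auto
      then have "x (\<tau> k) \<le> x r + (\<psi> (\<tau> k) - \<psi> r) + \<eta>"
        using x[OF r0] x[OF \<tau>0, of k] r by simp
      also have "x r = -1" using x1[OF r0] r by simp
      also have "-1 \<le> ?y i" using scheme_bounds[OF z, of d i] by simp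
      finally have "x (\<tau> k) \<le> ?y i + (\<psi> (\<tau> k) - \<psi> r) + \<eta>" by simp
      moreover have "\<psi> (\<tau> k) - \<psi> (\<tau> i) \<le> (\<Sum>i\<in>{i..<k}. d i) + E" using E[of i k] \<open>i \<le> k\<close> by (simp add: abs_le_iff)
      moreover have "\<psi> (\<tau> i) - \<psi> r \<le> e" using o[of i' r] i' \<open>i \<le> k\<close> \<open>\<tau> i' \<le> r\<close> ri by (simp add: abs_le_iff)
      moreover have "?y k \<ge> ?y i + (\<Sum>i\<in>{i..<k}. d i)" using ygrow[of i k] \<open>j < i\<close> \<open>i \<le> k\<close> by simp
      ultimately show "x (\<tau> k) - ?y k \<le> E + e + \<eta>" by linarith
    qed
    then show ?thesis by linarith
  qed
qed

lemma reflected_path_scheme: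
  fixes x lp lm \<psi> :: "real \<Rightarrow> real" and \<tau> :: "nat \<Rightarrow> real"
  assumes sk: "skorokhod_paths x lp lm"
    and x: "\<And>t. t \<ge> 0 \<Longrightarrow> x t = c + \<psi> t + lm t - lp t"
    and \<tau>: "mono \<tau>" "\<tau> 0 \<ge> 0" and z: "\<bar>z\<bar> \<le> 1"
    and E: "\<And>a b. a \<le> b \<Longrightarrow> b \<le> k \<Longrightarrow> \<bar>\<psi> (\<tau> b) - \<psi> (\<tau> a) - (\<Sum>i\<in>{a..<b}. d i)\<bar> \<le> E"
    and o: "\<And>i r. i < k \<Longrightarrow> \<tau> i \<le> r \<Longrightarrow> r \<le> \<tau> (Suc i) \<Longrightarrow> \<bar>\<psi> (\<tau> (Suc i)) - \<psi> r\<bar> \<le> e"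
    and "e \<ge> 0"
  shows "\<bar>x (\<tau> k) - scheme z d k\<bar> \<le> \<bar>x (\<tau> 0) - z\<bar> + E + e"
proof -
  have sk': "skorokhod_paths (\<lambda>t. - x t) lm lp"
    using sk unfolding skorokhod_paths_def
    by (auto intro!: continuous_minus simp: minus_less_iff)
  have "- x (\<tau> k) - scheme (- z) (\<lambda>i. - d i) k \<le> \<bar>- x (\<tau> 0) - (- z)\<bar> + E + e"
  proof (rule reflected_path_le_scheme[OF sk', where \<psi> = "\<lambda>t. - \<psi> t" and c = "- c"])
    show "\<bar>- \<psi> (\<tau> b) - - \<psi> (\<tau> a) - (\<Sum>i\<in>{a..<b}. - d i)\<bar> \<le> E" if "a \<le> b" "b \<le> k" for a b
      using E[OF that] by (simp add: sum_negf)
    show "\<bar>- \<psi> (\<tau> (Suc i)) - - \<psi> r\<bar> \<le> e" if "i < k" "\<tau> i \<le> r" "r \<le> \<tau> (Suc i)" for i r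
      using o[OF that] by simp
  qed (use x \<tau> z \<open>e \<ge> 0\<close> in auto)
  moreover have "x (\<tau> k) - scheme z d k \<le> \<bar>x (\<tau> 0) - z\<bar> + E + e"
    by (rule reflected_path_le_scheme[OF assms])
  ultimately show ?thesis by (auto simp: scheme_minus)
qed

section \<open>Kernels, the cut norm and block averages\<close>

lemma space_unit_interval [simp]: "space unit_interval = {0..1}"
  by (simp add: space_restrict_space)

lemma sets_unit_interval_iff: "A \<in> sets unit_interval \<longleftrightarrow> A \<subseteq> {0..1} \<and> A \<in> sets borel"
  by (subst sets_restrict_space_iff) auto

lemma measure_unit_interval: "A \<subseteq> {0..1} \<Longrightarrow> measure unit_interval A = measure lborel A"
  by (rule measure_restrict_space) auto

interpretation unit_interval: prob_space unit_interval
  by (rule prob_space_restrict_space) auto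

interpretation unit_square: pair_prob_space unit_interval unit_interval ..

lemma space_unit_square [simp]: "space unit_square = {0..1} \<times> {0..1}"
  by (simp add: space_pair_measure)

lemma kernels_measurable [measurable_dest]: "W \<in> kernels \<Longrightarrow> W \<in> borel_measurable unit_square"
  by (simp add: kernels_def)

lemma kernels_bound: "W \<in> kernels \<Longrightarrow> p \<in> {0..1} \<times> {0..1} \<Longrightarrow> \<bar>W p\<bar> \<le> 1"
  by (force simp: kernels_def abs_le_iff)

lemma kernels_integrable [simp]: "W \<in> kernels \<Longrightarrow> integrable unit_square W"
  by (intro unit_square.P.integrable_const_bound[of _ 1] AE_I2) (auto simp: kernels_measurable intro!: kernels_bound)

lemma kernels_diff_integrable [simp]:
  "V \<in> kernels \<Longrightarrow> W \<in> kernels \<Longrightarrow> integrable unit_square (V - W)"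
  unfolding fun_diff_def by (intro Bochner_Integration.integrable_diff kernels_integrable)

lemma abs_set_integral_le:
  fixes f :: "'a \<Rightarrow> real"
  assumes "integrable M f" "A \<in> sets M"
  shows "\<bar>LINT p:A|M. f p\<bar> \<le> (\<integral>p. \<bar>f p\<bar> \<partial>M)"
proof -
  have "\<bar>LINT p:A|M. f p\<bar> \<le> (\<integral>p. \<bar>indicator A p *\<^sub>R f p\<bar> \<partial>M)"
    unfolding set_lebesgue_integral_def by (rule integral_abs_bound)
  also have "\<dots> \<le> (\<integral>p. \<bar>f p\<bar> \<partial>M)"
    using assms by (intro integral_mono integrable_abs integrable_mult_indicator) (auto simp: indicator_def)
  finally show ?thesis .
qed

lemma bdd_above_cut_norm:
  fixes W :: "real \<times> real \<Rightarrow> real"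
  assumes "integrable unit_square W"
  shows "bdd_above ((\<lambda>(S, T). \<bar>LINT p:(S \<times> T)|unit_square. W p\<bar>) ` (sets unit_interval \<times> sets unit_interval))"
proof (rule bdd_aboveI2[where M = "\<integral>p. \<bar>W p\<bar> \<partial>unit_square"])
  fix ST assume "ST \<in> sets unit_interval \<times> sets unit_interval"
  then have "fst ST \<times> snd ST \<in> sets unit_square" by auto
  from abs_set_integral_le[OF assms this]
  show "(case ST of (S, T) \<Rightarrow> \<bar>LINT p:(S \<times> T)|unit_square. W p\<bar>) \<le> (\<integral>p. \<bar>W p\<bar> \<partial>unit_square)"
    by (simp add: case_prod_unfold)
qed

lemma cut_norm_upper:
  assumes "integrable unit_square W" "S \<in> sets unit_interval" "T \<in> sets unit_interval"
  shows "\<bar>LINT p:(S \<times> T)|unit_square. W p\<bar> \<le> cut_norm W"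
  unfolding cut_norm_def
  by (rule cSUP_upper2[OF bdd_above_cut_norm[OF assms(1)], of "(S, T)"]) (use assms in auto)

lemma cut_norm_least:
  assumes "\<And>S T. S \<in> sets unit_interval \<Longrightarrow> T \<in> sets unit_interval \<Longrightarrow> \<bar>LINT p:(S \<times> T)|unit_square. W p\<bar> \<le> c"
  shows "cut_norm W \<le> c"
  unfolding cut_norm_def by (rule cSUP_least) (use assms in auto)

lemma cut_norm_nonneg: "integrable unit_square W \<Longrightarrow> 0 \<le> cut_norm W"
  using cut_norm_upper[of W "{}" "{}"] by simp

lemma cut_norm_le_L1: "integrable unit_square W \<Longrightarrow> cut_norm W \<le> (\<integral>p. \<bar>W p\<bar> \<partial>unit_square)"
  by (intro cut_norm_least abs_set_integral_le) auto

lemma cut_norm_triangle: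
  assumes "integrable unit_square U" "integrable unit_square V" "integrable unit_square W"
  shows "cut_norm (U - W) \<le> cut_norm (U - V) + cut_norm (V - W)"
proof (rule cut_norm_least)
  fix S T assume ST: "S \<in> sets unit_interval" "T \<in> sets unit_interval"
  then have "S \<times> T \<in> sets unit_square" by auto
  then have *: "set_integrable unit_square (S \<times> T) f" if "integrable unit_square f" for f :: "real \<times> real \<Rightarrow> real"
    using that unfolding set_integrable_def by (intro integrable_mult_indicator)
  have int: "integrable unit_square (U - V)" "integrable unit_square (V - W)"
    using assms by (simp_all add: fun_diff_def)
  have "(LINT p:(S \<times> T)|unit_square. (U - W) p) =
      (LINT p:(S \<times> T)|unit_square. (U - V) p) + (LINT p:(S \<times> T)|unit_square. (V - W) p)"
    using assms by (subst set_integral_add(2)[symmetric]) (auto intro!: * simp: fun_diff_def)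
  then show "\<bar>LINT p:(S \<times> T)|unit_square. (U - W) p\<bar> \<le> cut_norm (U - V) + cut_norm (V - W)"
    using cut_norm_upper[OF int(1) ST] cut_norm_upper[OF int(2) ST] by linarith
qed

lemma cut_norm_commute: "cut_norm (U - V) = cut_norm (V - U)"
proof -
  have "(LINT p:D|unit_square. (U - V) p) = - (LINT p:D|unit_square. (V - U) p)" for D
    unfolding set_lebesgue_integral_def by (simp add: algebra_simps flip: Bochner_Integration.integral_minus)
  then have "\<bar>LINT p:D|unit_square. (U - V) p\<bar> = \<bar>LINT p:D|unit_square. (V - U) p\<bar>" for D
    by (simp only: abs_minus_cancel)
  then show ?thesis unfolding cut_norm_def by (simp only:)
qed

lemma cut_norm_diff_le_2:
  assumes "U \<in> kernels" "V \<in> kernels"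
  shows "cut_norm (U - V) \<le> 2"
proof -
  have "cut_norm (U - V) \<le> (\<integral>p. \<bar>(U - V) p\<bar> \<partial>unit_square)" using assms by (intro cut_norm_le_L1) simp
  also have "\<dots> \<le> (\<integral>p. 2 \<partial>unit_square)"
  proof (intro integral_mono)
    show "\<bar>(U - V) p\<bar> \<le> 2" if "p \<in> space unit_square" for p
      using kernels_bound[OF assms(1), of p] kernels_bound[OF assms(2), of p] that
      by (simp add: mem_Times_iff fun_diff_def del: split_paired_All)
  qed (use assms in auto)
  also have "\<dots> = 2" using unit_square.P.prob_space by simp
  finally show ?thesis .
qed

subsection \<open>Step kernels\<close>

lemma Q_subset: "i < n \<Longrightarrow> Q n i \<subseteq> {0..1}"
proof
  fix x assume x: "i < n" "x \<in> Q n i"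
  have "real (Suc i) / real n \<le> 1" using \<open>i < n\<close> by simp
  moreover have "0 \<le> real i / real n" by simp
  moreover have "real i / real n \<le> x" "x \<le> 1 \<or> x < real (Suc i) / real n" using x by (auto simp: Q_def split: if_splits)
  ultimately show "x \<in> {0..1}" unfolding atLeastAtMost_iff by linarith
qed

lemma Q_sets [measurable]: "i < n \<Longrightarrow> Q n i \<in> sets unit_interval"
  using Q_subset[of i n] by (simp add: sets_unit_interval_iff) (simp add: Q_def)

lemma measure_Q: "i < n \<Longrightarrow> measure unit_interval (Q n i) = 1 / real n"
  by (subst measure_unit_interval[OF Q_subset])
     (auto simp: Q_def field_simps divide_le_cancel)

lemma mem_Q_iff:
  assumes "x \<in> {0..1}" "i < n"
  shows "x \<in> Q n i \<longleftrightarrow> i = min (n - 1) (nat \<lfloor>x * real n\<rfloor>)"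
proof -
  have n: "real n > 0" using assms by simp
  have floor: "nat \<lfloor>x * real n\<rfloor> = j \<longleftrightarrow> real j \<le> x * real n \<and> x * real n < real (Suc j)" for j
    using assms by (auto simp: nat_eq_iff floor_eq_iff) 
  show ?thesis
  proof (cases "Suc i = n")
    case True
    have "real i / real n \<le> x \<longleftrightarrow> real i \<le> x * real n"
      using n by (simp add: field_simps)
    also have "\<dots> \<longleftrightarrow> i \<le> nat \<lfloor>x * real n\<rfloor>"
    proof
      assume "i \<le> nat \<lfloor>x * real n\<rfloor>"
      then have "real i \<le> real (nat \<lfloor>x * real n\<rfloor>)" by simp
      also have "\<dots> \<le> x * real n" using assms by (intro of_nat_floor) auto
      finally show "real i \<le> x * real n" .
    qed (rule le_nat_floor)
    finally show ?thesis using True assms by (auto simp: Q_def)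
  next
    case False
    then have "x \<in> Q n i \<longleftrightarrow> nat \<lfloor>x * real n\<rfloor> = i"
      unfolding floor using n by (auto simp: Q_def field_simps)
    then show ?thesis using False assms by (auto simp: min_def)
  qed
qed

lemma Q_disjoint: "i < n \<Longrightarrow> j < n \<Longrightarrow> x \<in> Q n i \<Longrightarrow> x \<in> Q n j \<Longrightarrow> i = j"
  using mem_Q_iff[of x i n] mem_Q_iff[of x j n] Q_subset[of i n] by auto

lemma Q_cover:
  assumes "x \<in> {0..1}" "n \<ge> 1" obtains i where "i < n" "x \<in> Q n i"
proof -
  have "min (n - 1) (nat \<lfloor>x * real n\<rfloor>) < n" using assms by auto
  with mem_Q_iff[OF assms(1) this] show ?thesis using that by blast
qed

abbreviation block :: "nat \<Rightarrow> nat \<Rightarrow> nat \<Rightarrow> (real \<times> real) set" where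
  "block n i j \<equiv> Q n i \<times> Q n j"

definition block_integral :: "nat \<Rightarrow> (real \<times> real \<Rightarrow> real) \<Rightarrow> nat \<Rightarrow> nat \<Rightarrow> real" where
  "block_integral n V i j = (LINT p:block n i j|unit_square. V p)"

lemma block_sets: "i < n \<Longrightarrow> j < n \<Longrightarrow> block n i j \<in> sets unit_square"
  by (intro pair_measureI Q_sets)

lemma measure_block: "i < n \<Longrightarrow> j < n \<Longrightarrow> measure unit_square (block n i j) = 1 / (real n)\<^sup>2"
  using Q_sets[of i n] Q_sets[of j n] measure_Q[of i n] measure_Q[of j n]
  by (simp add: measure_def unit_interval.emeasure_pair_measure_Times enn2real_mult power2_eq_square)

lemma block_cover:
  assumes "p \<in> {0..1} \<times> {0..1}" "n \<ge> 1"
  obtains i j where "i < n" "j < n" "p \<in> block n i j"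
proof -
  from assms obtain i where "i < n" "fst p \<in> Q n i" by (auto elim: Q_cover)
  moreover from assms obtain j where "j < n" "snd p \<in> Q n j" by (auto elim: Q_cover)
  ultimately show ?thesis using that[of i j] by (simp add: mem_Times_iff)
qed

lemma K_indicator: "K n A p = (\<Sum>i<n. \<Sum>j<n. A i j * indicator (block n i j) p)"
  by (cases p) (simp add: K_def indicator_times mult.assoc)

lemma K_eq:
  assumes "i < n" "j < n" "p \<in> block n i j" shows "K n A p = A i j"
proof -
  have "A i' j' * indicator (block n i' j') p = (if i' = i \<and> j' = j then A i j else 0)"
    if "i' < n" "j' < n" for i' j'
  proof (cases "p \<in> block n i' j'")
    case True
    with assms that have "i' = i" "j' = j" by (metis Q_disjoint mem_Times_iff)+
    with True show ?thesis by simp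
  next
    case False
    with assms have "\<not> (i' = i \<and> j' = j)" by auto
    with False show ?thesis by auto
  qed
  then have "K n A p = (\<Sum>i'<n. \<Sum>j'<n. if i' = i \<and> j' = j then A i j else 0)"
    unfolding K_indicator by (intro sum.cong) auto
  also have "\<dots> = (\<Sum>i'<n. if i' = i then A i j else 0)"
    using assms by (intro sum.cong) auto
  finally show ?thesis using assms by simp
qed

lemma K_measurable [measurable]: "K n A \<in> borel_measurable unit_square"
  unfolding K_indicator[abs_def] using block_sets by (intro borel_measurable_sum borel_measurable_times borel_measurable_indicator) auto

lemma integrable_K [simp]: "integrable unit_square (K n A)"
proof -
  have "K n A = (\<lambda>p. \<Sum>i<n. \<Sum>j<n. A i j * indicator (block n i j) p)" by (simp add: K_indicator fun_eq_iff)
  moreover have "integrable unit_square (\<lambda>p. \<Sum>i<n. \<Sum>j<n. A i j * indicator (block n i j) p)"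
    by (intro Bochner_Integration.integrable_sum integrable_mult_right integrable_real_indicator block_sets)
       (simp_all add: unit_square.P.emeasure_eq_measure)
  ultimately show ?thesis by simp
qed

lemma K_diff: "K n A - K n B = K n (A - B)"
  by (auto simp: fun_eq_iff K_indicator sum_subtractf left_diff_distrib)

lemma K_in_kernels:
  assumes "A \<in> cube_mats n" "n \<ge> 1" shows "K n A \<in> kernels"
proof -
  have "K n A (x, y) = K n A (y, x) \<and> K n A (x, y) \<in> {-1..1}" if xy: "x \<in> {0..1}" "y \<in> {0..1}" for x y
  proof -
    from xy assms obtain i j where "i < n" "j < n" "(x, y) \<in> block n i j"
      using block_cover[of "(x, y)" n] by auto
    then show ?thesis using K_eq[of i n j "(x, y)" A] K_eq[of j n i "(y, x)" A] assms(1)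
      by (auto simp: cube_mats_def sym_mats_def)
  qed
  then show ?thesis by (auto simp: kernels_def)
qed

lemma integral_blocks:
  assumes "integrable unit_square V" "n \<ge> 1"
  shows "(\<integral>p. V p \<partial>unit_square) = (\<Sum>i<n. \<Sum>j<n. block_integral n V i j)"
proof -
  have "(\<integral>p. V p \<partial>unit_square) = (\<integral>p. (\<Sum>i<n. \<Sum>j<n. indicator (block n i j) p *\<^sub>R V p) \<partial>unit_square)"
  proof (rule Bochner_Integration.integral_cong[OF refl])
    fix p assume "p \<in> space unit_square"
    with assms(2) obtain i j where "i < n" "j < n" "p \<in> block n i j"
      using block_cover[of p n] by (auto simp del: split_paired_All split_paired_Ex)
    then have "K n (\<lambda>i j. 1) p = 1" by (simp add: K_eq)
    then show "V p = (\<Sum>i<n. \<Sum>j<n. indicator (block n i j) p *\<^sub>R V p)"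
      by (simp add: K_indicator sum_distrib_right[symmetric])
  qed
  also have "\<dots> = (\<Sum>i<n. \<integral>p. (\<Sum>j<n. indicator (block n i j) p *\<^sub>R V p) \<partial>unit_square)"
    by (rule Bochner_Integration.integral_sum)
       (intro Bochner_Integration.integrable_sum integrable_mult_indicator block_sets assms; simp)
  also have "\<dots> = (\<Sum>i<n. \<Sum>j<n. block_integral n V i j)"
    unfolding block_integral_def set_lebesgue_integral_def
    by (intro sum.cong refl Bochner_Integration.integral_sum integrable_mult_indicator block_sets assms) auto
  finally show ?thesis .
qed

lemma block_integral_const:
  assumes "i < n" "j < n" "\<And>p. p \<in> block n i j \<Longrightarrow> V p = c"
  shows "block_integral n V i j = c / (real n)\<^sup>2"
proof -
  have "block_integral n V i j = (LINT p:block n i j|unit_square. c)"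
    unfolding block_integral_def using assms by (intro set_lebesgue_integral_cong block_sets) auto
  also have "\<dots> = c / (real n)\<^sup>2"
    using measure_block[OF assms(1,2)] block_sets[OF assms(1,2)] by (simp add: set_integral_const unit_square.P.emeasure_eq_measure)
  finally show ?thesis .
qed

lemma integral_abs_K:
  assumes "n \<ge> 1"
  shows "(\<integral>p. \<bar>K n A p\<bar> \<partial>unit_square) = (\<Sum>i<n. \<Sum>j<n. \<bar>A i j\<bar>) / (real n)\<^sup>2"
proof -
  have "(\<integral>p. \<bar>K n A p\<bar> \<partial>unit_square) = (\<Sum>i<n. \<Sum>j<n. block_integral n (\<lambda>p. \<bar>K n A p\<bar>) i j)"
    using assms by (intro integral_blocks) auto
  also have "\<dots> = (\<Sum>i<n. \<Sum>j<n. \<bar>A i j\<bar> / (real n)\<^sup>2)"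
    by (intro sum.cong refl block_integral_const arg_cong[where f = abs] K_eq) auto
  finally show ?thesis by (simp add: sum_divide_distrib)
qed

lemma Linfty_sym_integrable: "V \<in> Linfty_sym \<Longrightarrow> integrable unit_square V"
proof -
  assume "V \<in> Linfty_sym"
  then obtain C where "V \<in> borel_measurable unit_square" "\<forall>p\<in>{0..1} \<times> {0..1}. \<bar>V p\<bar> \<le> C"
    unfolding Linfty_sym_def by blast
  then show ?thesis by (intro unit_square.P.integrable_const_bound[of _ C] AE_I2) auto
qed

lemma integral_mult_K:
  assumes V: "integrable unit_square V" and "n \<ge> 1"
  shows "(\<integral>p. V p * K n A p \<partial>unit_square) = (\<Sum>i<n. \<Sum>j<n. block_integral n V i j * A i j)"
    and "integrable unit_square (\<lambda>p. V p * K n A p)"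
proof -
  have *: "V p * K n A p = (\<Sum>i<n. \<Sum>j<n. A i j * (indicator (block n i j) p *\<^sub>R V p))" for p
    unfolding K_indicator sum_distrib_left by (intro sum.cong refl) simp
  have int: "integrable unit_square (\<lambda>p. A i j * (indicator (block n i j) p *\<^sub>R V p))" if "i < n" "j < n" for i j
    using that by (intro integrable_mult_right integrable_mult_indicator block_sets V)
  show "integrable unit_square (\<lambda>p. V p * K n A p)"
    unfolding * by (intro Bochner_Integration.integrable_sum int) auto
  have "(\<integral>p. V p * K n A p \<partial>unit_square)
      = (\<Sum>i<n. \<integral>p. (\<Sum>j<n. A i j * (indicator (block n i j) p *\<^sub>R V p)) \<partial>unit_square)"
    unfolding * by (intro Bochner_Integration.integral_sum Bochner_Integration.integrable_sum int) auto
  also have "\<dots> = (\<Sum>i<n. \<Sum>j<n. \<integral>p. A i j * (indicator (block n i j) p *\<^sub>R V p) \<partial>unit_square)"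
    by (intro sum.cong refl Bochner_Integration.integral_sum int) auto
  also have "\<dots> = (\<Sum>i<n. \<Sum>j<n. block_integral n V i j * A i j)"
    unfolding block_integral_def set_lebesgue_integral_def by (simp add: mult.commute)
  finally show "(\<integral>p. V p * K n A p \<partial>unit_square) = (\<Sum>i<n. \<Sum>j<n. block_integral n V i j * A i j)" .
qed

lemma L2_norm_K:
  assumes "n \<ge> 1" shows "L2_norm (K n A) = frobenius_norm n A / real n"
proof -
  have "(\<integral>p. (K n A p)\<^sup>2 \<partial>unit_square) = (\<Sum>i<n. \<Sum>j<n. block_integral n (K n A) i j * A i j)"
    using integral_mult_K(1)[OF integrable_K assms] by (simp add: power2_eq_square)
  also have "\<dots> = (\<Sum>i<n. \<Sum>j<n. (A i j / (real n)\<^sup>2) * A i j)"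
    by (intro sum.cong refl arg_cong2[where f = "(*)"] block_integral_const K_eq) auto
  also have "\<dots> = (\<Sum>i<n. \<Sum>j<n. (A i j)\<^sup>2) / (real n)\<^sup>2"
    by (simp add: sum_divide_distrib power2_eq_square)
  finally show ?thesis unfolding L2_norm_def frobenius_norm_def by (simp add: real_sqrt_divide)
qed

lemma block_integral_swap:
  assumes "V \<in> Linfty_sym" "i < n" "j < n"
  shows "block_integral n V i j = block_integral n V j i"
proof -
  have V: "V \<in> borel_measurable unit_square" and sym: "\<And>x y. x \<in> {0..1} \<Longrightarrow> y \<in> {0..1} \<Longrightarrow> V (x, y) = V (y, x)"
    using assms by (auto simp: Linfty_sym_def)
  let ?f = "\<lambda>p. indicator (block n i j) p *\<^sub>R V p"
  have "?f \<in> borel_measurable unit_square"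
    using V block_sets[OF assms(2,3)] by (intro borel_measurable_scaleR borel_measurable_indicator)
  from unit_square.integral_product_swap[OF this]
  have "block_integral n V i j = (\<integral>(x, y). ?f (y, x) \<partial>unit_square)"
    unfolding block_integral_def set_lebesgue_integral_def by simp
  also have "\<dots> = block_integral n V j i"
    unfolding block_integral_def set_lebesgue_integral_def
    by (intro Bochner_Integration.integral_cong refl) (auto simp: sym indicator_def)
  finally show ?thesis .
qed

subsection \<open>The gradient of the discretised functional\<close>

lemma has_gradient_step:
  assumes "frechet_like_derivative R \<phi>" "A \<in> cube_mats n" "n \<ge> 1"
  shows "has_gradient n (R \<circ> K n) A (\<lambda>i j. if i < n \<and> j < n then block_integral n (\<phi> (K n A)) i j else 0)"
    (is "has_gradient n _ A ?G")
proof -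
  have KA: "K n A \<in> kernels" using assms by (intro K_in_kernels)
  have \<phi>: "\<phi> (K n A) \<in> Linfty_sym" using assms KA by (auto simp: frechet_like_derivative_def)
  note int = Linfty_sym_integrable[OF \<phi>]
  have n: "real n > 0" using assms by simp
  show ?thesis unfolding has_gradient_def
  proof (intro conjI allI impI)
    show "?G \<in> sym_mats n" using block_integral_swap[OF \<phi>] by (auto simp: sym_mats_def)
    fix \<epsilon> :: real assume "\<epsilon> > 0"
    with n have "\<epsilon> * real n > 0" by simp
    with assms(1) KA obtain \<delta> where \<delta>: "\<delta> > 0" "\<And>W. W \<in> kernels \<Longrightarrow> L2_norm (W - K n A) < \<delta> \<Longrightarrow>
      \<bar>R W - R (K n A) - L2_inner (\<phi> (K n A)) (W - K n A)\<bar> \<le> \<epsilon> * real n * L2_norm (W - K n A)"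
      unfolding frechet_like_derivative_def by metis
    show "\<exists>\<delta>>0. \<forall>B\<in>cube_mats n. frobenius_norm n (B - A) < \<delta> \<longrightarrow>
        \<bar>(R \<circ> K n) B - (R \<circ> K n) A - (\<Sum>i<n. \<Sum>j<n. ?G i j * (B i j - A i j))\<bar>
          \<le> \<epsilon> * frobenius_norm n (B - A)"
    proof (intro exI conjI ballI impI)
      show "\<delta> * real n > 0" using \<delta>(1) n by simp
      fix B assume B: "B \<in> cube_mats n" "frobenius_norm n (B - A) < \<delta> * real n"
      have eq: "L2_norm (K n B - K n A) = frobenius_norm n (B - A) / real n"
        using L2_norm_K[OF assms(3)] by (simp add: K_diff)
      have "L2_inner (\<phi> (K n A)) (K n B - K n A) = (\<Sum>i<n. \<Sum>j<n. ?G i j * (B i j - A i j))"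
        unfolding L2_inner_def K_diff integral_mult_K(1)[OF int assms(3)] by simp
      with \<delta>(2)[OF K_in_kernels[OF B(1) assms(3)]] B(2) n
      show "\<bar>(R \<circ> K n) B - (R \<circ> K n) A - (\<Sum>i<n. \<Sum>j<n. ?G i j * (B i j - A i j))\<bar>
          \<le> \<epsilon> * frobenius_norm n (B - A)"
        by (simp add: eq field_simps)
    qed
  qed
qed

lemma has_gradient_unique:
  assumes A: "A \<in> cube_mats n" and G: "has_gradient n f A G" and G': "has_gradient n f A G'"
  shows "G = G'"
proof (intro ext)
  fix i j
  show "G i j = G' i j"
  proof (cases "i < n \<and> j < n")
    case False
    with G G' show ?thesis by (auto simp: has_gradient_def sym_mats_def)
  next
    case True
    define s :: real where "s = (if A i j > 0 then -1 else 1)"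
    define D where "D = (\<lambda>i j. G i j - G' i j)"
    have Dsym: "D i j = D j i" using G G' by (auto simp: D_def has_gradient_def sym_mats_def)
    have Aij: "A j i = A i j" "A i j \<in> {-1..1}" using A True by (auto simp: cube_mats_def sym_mats_def)
    have "\<bar>D i j\<bar> \<le> 0"
    proof (rule field_le_epsilon)
      fix \<epsilon> :: real assume "\<epsilon> > 0"
      then have "\<epsilon> / 4 > 0" by simp
      from G[unfolded has_gradient_def, THEN conjunct2, rule_format, OF this]
      obtain \<delta> where \<delta>: "\<delta> > 0" "\<And>B. B \<in> cube_mats n \<Longrightarrow> frobenius_norm n (B - A) < \<delta> \<Longrightarrow>
          \<bar>f B - f A - (\<Sum>i<n. \<Sum>j<n. G i j * (B i j - A i j))\<bar> \<le> \<epsilon> / 4 * frobenius_norm n (B - A)"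
        by blast
      from G'[unfolded has_gradient_def, THEN conjunct2, rule_format, OF \<open>\<epsilon> / 4 > 0\<close>]
      obtain \<delta>' where \<delta>': "\<delta>' > 0" "\<And>B. B \<in> cube_mats n \<Longrightarrow> frobenius_norm n (B - A) < \<delta>' \<Longrightarrow>
          \<bar>f B - f A - (\<Sum>i<n. \<Sum>j<n. G' i j * (B i j - A i j))\<bar> \<le> \<epsilon> / 4 * frobenius_norm n (B - A)"
        by blast
      define h where "h = min 1 (min \<delta> \<delta>' / 4)"
      have h: "h > 0" "h \<le> 1" "2 * h < \<delta>" "2 * h < \<delta>'" using \<delta>(1) \<delta>'(1) by (auto simp: h_def min_def)
      define P where "P = {(i, j), (j, i)}"
      define B where "B = (\<lambda>i' j'. A i' j' + (if (i', j') \<in> P then s * h else 0))"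
      have "A i j + s * h \<in> {-1..1}" using Aij(2) h(1,2) by (auto simp: s_def)
      then have B: "B \<in> cube_mats n"
        using A True Aij(1) by (auto simp: cube_mats_def sym_mats_def B_def P_def s_def)
      have P: "finite P" "P \<subseteq> {..<n} \<times> {..<n}" using True by (auto simp: P_def)
      have sumP: "(\<Sum>i'<n. \<Sum>j'<n. F i' j' (B i' j' - A i' j')) = (\<Sum>(i', j')\<in>P. F i' j' (s * h))"
        if "\<And>i' j'. F i' j' 0 = 0" for F :: "nat \<Rightarrow> nat \<Rightarrow> real \<Rightarrow> real"
      proof -
        have "(\<Sum>i'<n. \<Sum>j'<n. F i' j' (B i' j' - A i' j')) = (\<Sum>(i', j')\<in>{..<n} \<times> {..<n}. F i' j' (B i' j' - A i' j'))"
          by (rule sum.cartesian_product)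
        also have "\<dots> = (\<Sum>(i', j')\<in>P. F i' j' (B i' j' - A i' j'))"
          using P by (intro sum.mono_neutral_right) (auto simp: B_def that)
        also have "\<dots> = (\<Sum>(i', j')\<in>P. F i' j' (s * h))" by (intro sum.cong) (auto simp: B_def)
        finally show ?thesis .
      qed
      have s2: "s\<^sup>2 = 1" "\<bar>s\<bar> = 1" by (auto simp: s_def)
      have "(frobenius_norm n (B - A))\<^sup>2 = (\<Sum>(i', j')\<in>P. (s * h)\<^sup>2)"
        using sumP[of "\<lambda>_ _ x. x\<^sup>2"] by (simp add: frobenius_norm_def real_sqrt_pow2 sum_nonneg)
      also have "\<dots> \<le> 2 * h\<^sup>2" unfolding P_def by (cases "i = j") (auto simp: power_mult_distrib s2)
      also have "\<dots> \<le> (2 * h)\<^sup>2" by (simp add: power2_eq_square)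
      finally have frob: "frobenius_norm n (B - A) \<le> 2 * h" by (rule power2_le_imp_le) (use h in simp)
      have "(\<Sum>i<n. \<Sum>j<n. D i j * (B i j - A i j)) = (\<Sum>(i', j')\<in>P. D i' j' * (s * h))"
        by (rule sumP) simp
      then have "\<bar>D i j\<bar> * h \<le> \<bar>\<Sum>i<n. \<Sum>j<n. D i j * (B i j - A i j)\<bar>"
        unfolding P_def using h by (cases "i = j") (auto simp: abs_mult s2 Dsym)
      also have "(\<Sum>i<n. \<Sum>j<n. D i j * (B i j - A i j)) =
          (f B - f A - (\<Sum>i<n. \<Sum>j<n. G' i j * (B i j - A i j))) - (f B - f A - (\<Sum>i<n. \<Sum>j<n. G i j * (B i j - A i j)))"
        by (simp add: D_def left_diff_distrib sum_subtractf)
      also have "\<bar>\<dots>\<bar> \<le> \<epsilon> / 4 * frobenius_norm n (B - A) + \<epsilon> / 4 * frobenius_norm n (B - A)"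
        using \<delta>(2)[OF B] \<delta>'(2)[OF B] frob h by linarith
      also have "\<dots> \<le> \<epsilon> * h" using frob \<open>\<epsilon> > 0\<close> by (simp add: field_simps)
      finally show "\<bar>D i j\<bar> \<le> 0 + \<epsilon>" using h by simp
    qed
    then show ?thesis by (simp add: D_def)
  qed
qed

lemma gradient_step:
  assumes "frechet_like_derivative R \<phi>" "A \<in> cube_mats n" "i < n" "j < n"
  shows "gradient n (R \<circ> K n) A i j = block_integral n (\<phi> (K n A)) i j"
proof -
  have "gradient n (R \<circ> K n) A = (\<lambda>i j. if i < n \<and> j < n then block_integral n (\<phi> (K n A)) i j else 0)"
    unfolding gradient_def
  proof (rule the_equality)
    show *: "has_gradient n (R \<circ> K n) A (\<lambda>i j. if i < n \<and> j < n then block_integral n (\<phi> (K n A)) i j else 0)"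
      using assms by (intro has_gradient_step) auto
    show "G = (\<lambda>i j. if i < n \<and> j < n then block_integral n (\<phi> (K n A)) i j else 0)"
      if "has_gradient n (R \<circ> K n) A G" for G
      by (rule has_gradient_unique[OF assms(2) that *])
  qed
  with assms show ?thesis by simp
qed

subsection \<open>Block averages approximate in \<open>L\<^sup>1\<close>\<close>

definition block_average :: "nat \<Rightarrow> (real \<times> real \<Rightarrow> real) \<Rightarrow> nat \<Rightarrow> nat \<Rightarrow> real" where
  "block_average n V i j = (real n)\<^sup>2 * block_integral n V i j"

lemma block_integral_add:
  "integrable unit_square U \<Longrightarrow> integrable unit_square V \<Longrightarrow> i < n \<Longrightarrow> j < n \<Longrightarrow>
    block_integral n (\<lambda>p. U p + V p) i j = block_integral n U i j + block_integral n V i j"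
  unfolding block_integral_def
  by (rule set_integral_add; unfold set_integrable_def; intro integrable_mult_indicator block_sets)

lemma block_integral_diff:
  "integrable unit_square U \<Longrightarrow> integrable unit_square V \<Longrightarrow> i < n \<Longrightarrow> j < n \<Longrightarrow>
    block_integral n (\<lambda>p. U p - V p) i j = block_integral n U i j - block_integral n V i j"
  unfolding block_integral_def
  by (rule set_integral_diff; unfold set_integrable_def; intro integrable_mult_indicator block_sets)

lemma abs_block_integral_le: "\<bar>block_integral n V i j\<bar> \<le> block_integral n (\<lambda>p. \<bar>V p\<bar>) i j"
proof -
  have "\<bar>block_integral n V i j\<bar> \<le> (\<integral>p. \<bar>indicator (block n i j) p *\<^sub>R V p\<bar> \<partial>unit_square)"
    unfolding block_integral_def set_lebesgue_integral_def by (rule integral_abs_bound)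
  then show ?thesis unfolding block_integral_def set_lebesgue_integral_def by (simp add: abs_mult)
qed

lemma K_diff_block_average:
  assumes "integrable unit_square U" "integrable unit_square V"
  shows "K n (block_average n U) p - K n (block_average n V) p = K n (block_average n (\<lambda>p. U p - V p)) p"
  unfolding K_indicator block_average_def sum_subtractf[symmetric]
  by (intro sum.cong refl) (simp add: block_integral_diff assms algebra_simps)

lemma integral_abs_K_block_average_le:
  assumes "integrable unit_square V" "n \<ge> 1"
  shows "(\<integral>p. \<bar>K n (block_average n V) p\<bar> \<partial>unit_square) \<le> (\<integral>p. \<bar>V p\<bar> \<partial>unit_square)"
proof -
  have "(\<integral>p. \<bar>K n (block_average n V) p\<bar> \<partial>unit_square) = (\<Sum>i<n. \<Sum>j<n. \<bar>block_integral n V i j\<bar>)"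
    using assms(2) by (simp add: integral_abs_K block_average_def abs_mult sum_distrib_left[symmetric])
  also have "\<dots> \<le> (\<Sum>i<n. \<Sum>j<n. block_integral n (\<lambda>p. \<bar>V p\<bar>) i j)"
    by (intro sum_mono abs_block_integral_le)
  also have "\<dots> = (\<integral>p. \<bar>V p\<bar> \<partial>unit_square)"
    using assms by (intro integral_blocks[symmetric]) auto
  finally show ?thesis .
qed

definition L1_averageable :: "(real \<times> real \<Rightarrow> real) \<Rightarrow> bool" where
  "L1_averageable V \<longleftrightarrow>
     (\<lambda>n. \<integral>p. \<bar>K n (block_average n V) p - V p\<bar> \<partial>unit_square) \<longlonglongrightarrow> 0"

lemma L1_averageable_approx:
  assumes V: "integrable unit_square V"
    and approx: "\<And>\<epsilon>. \<epsilon> > 0 \<Longrightarrow> \<exists>U. integrable unit_square U \<and> L1_averageable U \<and> (\<integral>p. \<bar>U p - V p\<bar> \<partial>unit_square) < \<epsilon>"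
  shows "L1_averageable V"
  unfolding L1_averageable_def
proof (rule LIMSEQ_I)
  fix \<epsilon> :: real assume "\<epsilon> > 0"
  then have "\<epsilon> / 3 > 0" by simp
  from approx[OF this] obtain U where U: "integrable unit_square U" "L1_averageable U"
      "(\<integral>p. \<bar>U p - V p\<bar> \<partial>unit_square) < \<epsilon> / 3" by blast
  from U(2) \<open>\<epsilon> / 3 > 0\<close> obtain N where
    N: "\<And>n. n \<ge> N \<Longrightarrow> \<bar>\<integral>p. \<bar>K n (block_average n U) p - U p\<bar> \<partial>unit_square\<bar> < \<epsilon> / 3"
    unfolding L1_averageable_def using LIMSEQ_D[of _ 0 "\<epsilon> / 3"] by fastforce
  have "(\<integral>p. \<bar>K n (block_average n V) p - V p\<bar> \<partial>unit_square) < \<epsilon>" if "n \<ge> max 1 N" for n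
  proof -
    let ?K = "\<lambda>V p. K n (block_average n V) p"
    have int: "integrable unit_square (\<lambda>p. \<bar>?K V p - ?K U p\<bar>)" "integrable unit_square (\<lambda>p. \<bar>?K U p - U p\<bar>)"
      "integrable unit_square (\<lambda>p. \<bar>U p - V p\<bar>)"
      using U V by (auto intro!: integrable_abs Bochner_Integration.integrable_diff)
    have "(\<integral>p. \<bar>?K V p - V p\<bar> \<partial>unit_square) \<le>
        (\<integral>p. \<bar>?K V p - ?K U p\<bar> + (\<bar>?K U p - U p\<bar> + \<bar>U p - V p\<bar>) \<partial>unit_square)"
      using int V U by (intro integral_mono Bochner_Integration.integrable_add integrable_abs Bochner_Integration.integrable_diff) auto
    also have "\<dots> = (\<integral>p. \<bar>?K V p - ?K U p\<bar> \<partial>unit_square) + ((\<integral>p. \<bar>?K U p - U p\<bar> \<partial>unit_square) + (\<integral>p. \<bar>U p - V p\<bar> \<partial>unit_square))"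
      using int by simp
    also have "(\<integral>p. \<bar>?K V p - ?K U p\<bar> \<partial>unit_square) \<le> (\<integral>p. \<bar>V p - U p\<bar> \<partial>unit_square)"
      unfolding K_diff_block_average[OF V U(1)] using V U that by (intro integral_abs_K_block_average_le) auto
    finally show ?thesis using U(3) N[of n] that by (auto simp: abs_minus_commute)
  qed
  then show "\<exists>no. \<forall>n\<ge>no. norm ((\<integral>p. \<bar>K n (block_average n V) p - V p\<bar> \<partial>unit_square) - 0) < \<epsilon>"
    by (intro exI[of _ "max 1 N"]) auto
qed

lemma L1_averageable_add:
  assumes "integrable unit_square U" "L1_averageable U" "integrable unit_square V" "L1_averageable V"
  shows "L1_averageable (\<lambda>p. U p + c * V p)"
  unfolding L1_averageable_def
proof (rule tendsto_sandwich[OF _ _ tendsto_const])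
  let ?K = "\<lambda>n V p. K n (block_average n V) p"
  show "(\<lambda>n. (\<integral>p. \<bar>?K n U p - U p\<bar> \<partial>unit_square) + \<bar>c\<bar> * (\<integral>p. \<bar>?K n V p - V p\<bar> \<partial>unit_square)) \<longlonglongrightarrow> 0"
    using assms unfolding L1_averageable_def by (auto intro!: tendsto_eq_intros)
  have eq: "?K n (\<lambda>p. U p + c * V p) p = ?K n U p + c * ?K n V p" for n p
  proof -
    have "block_integral n (\<lambda>p. U p + c * V p) i j = block_integral n U i j + c * block_integral n V i j"
      if "i < n" "j < n" for i j
    proof (subst block_integral_add)
      show "block_integral n U i j + block_integral n (\<lambda>p. c * V p) i j = block_integral n U i j + c * block_integral n V i j"
        unfolding block_integral_def by simp
    qed (use assms that in auto)
    then show ?thesis unfolding K_indicator block_average_def sum_distrib_left sum.distrib[symmetric]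
      by (intro sum.cong refl) (simp add: algebra_simps)
  qed
  have "(\<integral>p. \<bar>?K n (\<lambda>p. U p + c * V p) p - (U p + c * V p)\<bar> \<partial>unit_square) \<le>
     (\<integral>p. \<bar>?K n U p - U p\<bar> + \<bar>c\<bar> * \<bar>?K n V p - V p\<bar> \<partial>unit_square)" for n
  proof (intro integral_mono)
    fix p
    have "?K n (\<lambda>p. U p + c * V p) p - (U p + c * V p) = (?K n U p - U p) + c * (?K n V p - V p)"
      by (simp add: eq algebra_simps)
    then show "\<bar>?K n (\<lambda>p. U p + c * V p) p - (U p + c * V p)\<bar> \<le> \<bar>?K n U p - U p\<bar> + \<bar>c\<bar> * \<bar>?K n V p - V p\<bar>"
      by (simp add: abs_mult[symmetric])
  qed (use assms in \<open>auto intro!: integrable_abs\<close>)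
  also have "\<dots> n = (\<integral>p. \<bar>?K n U p - U p\<bar> \<partial>unit_square) + \<bar>c\<bar> * (\<integral>p. \<bar>?K n V p - V p\<bar> \<partial>unit_square)" for n
    using assms by simp
  finally show "\<forall>\<^sub>F n in sequentially. (\<integral>p. \<bar>?K n (\<lambda>p. U p + c * V p) p - (U p + c * V p)\<bar> \<partial>unit_square)
     \<le> (\<integral>p. \<bar>?K n U p - U p\<bar> \<partial>unit_square) + \<bar>c\<bar> * (\<integral>p. \<bar>?K n V p - V p\<bar> \<partial>unit_square)"
    by auto
qed auto

lemma L1_averageable_limit:
  assumes V: "integrable unit_square V"
    and s: "\<And>i. integrable unit_square (s i)" "\<And>i. L1_averageable (s i)"
    and lim: "\<And>p. p \<in> space unit_square \<Longrightarrow> (\<lambda>i. s i p) \<longlonglongrightarrow> V p"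
    and bound: "\<And>i p. p \<in> space unit_square \<Longrightarrow> \<bar>s i p\<bar> \<le> w p" "integrable unit_square w"
  shows "L1_averageable V"
proof (rule L1_averageable_approx[OF V])
  fix \<epsilon> :: real assume "\<epsilon> > 0"
  have "(\<lambda>i. \<integral>p. \<bar>s i p - V p\<bar> \<partial>unit_square) \<longlonglongrightarrow> (\<integral>p. 0 \<partial>unit_square)"
  proof (rule integral_dominated_convergence[where w = "\<lambda>p. w p + \<bar>V p\<bar>"])
    show "AE p in unit_square. (\<lambda>i. \<bar>s i p - V p\<bar>) \<longlonglongrightarrow> 0"
      using lim by (intro AE_I2 tendsto_rabs_zero) (simp add: LIM_zero del: split_paired_All)
    show "AE p in unit_square. norm \<bar>s i p - V p\<bar> \<le> w p + \<bar>V p\<bar>" for i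
    proof (rule AE_I2)
      fix p assume "p \<in> space unit_square"
      from bound(1)[OF this, of i] show "norm \<bar>s i p - V p\<bar> \<le> w p + \<bar>V p\<bar>" unfolding real_norm_def by linarith
    qed
  qed (use s V bound in \<open>auto intro!: borel_measurable_integrable\<close>)
  then have "eventually (\<lambda>i. (\<integral>p. \<bar>s i p - V p\<bar> \<partial>unit_square) < \<epsilon>) sequentially"
    using \<open>\<epsilon> > 0\<close> by (intro order_tendstoD(2)) auto
  then obtain i where "(\<integral>p. \<bar>s i p - V p\<bar> \<partial>unit_square) < \<epsilon>" by (auto simp: eventually_sequentially)
  then show "\<exists>U. integrable unit_square U \<and> L1_averageable U \<and> (\<integral>p. \<bar>U p - V p\<bar> \<partial>unit_square) < \<epsilon>"
    using s by blast
qed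

lemma abs_block_average_le:
  assumes V: "V \<in> borel_measurable unit_square" and c: "AE p in unit_square. \<bar>V p\<bar> \<le> c"
    and "i < n" "j < n"
  shows "\<bar>block_average n V i j\<bar> \<le> c"
proof -
  have n: "real n > 0" using assms by simp
  note [measurable] = V block_sets[OF assms(3,4)]
  have "\<bar>block_integral n V i j\<bar> \<le> block_integral n (\<lambda>p. \<bar>V p\<bar>) i j" by (rule abs_block_integral_le)
  also have "\<dots> \<le> block_integral n (\<lambda>_. c) i j"
    unfolding block_integral_def set_lebesgue_integral_def
  proof (rule integral_mono_AE)
    have "integrable unit_square V" using c by (intro unit_square.P.integrable_const_bound[of _ c]) auto
    then show "integrable unit_square (\<lambda>p. indicator (block n i j) p *\<^sub>R \<bar>V p\<bar>)"
      by (intro integrable_mult_indicator integrable_abs block_sets assms)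
    show "integrable unit_square (\<lambda>p. indicator (block n i j) p *\<^sub>R c)"
      by (intro integrable_mult_indicator block_sets assms) simp
    show "AE p in unit_square. indicator (block n i j) p *\<^sub>R \<bar>V p\<bar> \<le> indicator (block n i j) p *\<^sub>R c"
      using c by eventually_elim (auto simp: indicator_def)
  qed
  also have "\<dots> = c / (real n)\<^sup>2" by (rule block_integral_const) (use assms in auto)
  finally show ?thesis using n by (simp add: block_average_def abs_mult field_simps)
qed

lemma Q_diameter:
  assumes "x \<in> Q n i" "y \<in> Q n i" "i < n" shows "\<bar>x - y\<bar> \<le> 1 / real n"
proof -
  have "real i / real n \<le> z \<and> z \<le> real i / real n + 1 / real n" if "z \<in> Q n i" for z
  proof -
    have "real i / real n + 1 / real n = real (Suc i) / real n" by (simp add: add_divide_distrib)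
    then show ?thesis using that assms(3) by (auto simp: Q_def split: if_splits)
  qed
  from this[OF assms(1)] this[OF assms(2)] show ?thesis by linarith
qed

lemma K_block_average_locally_const:
  assumes "p \<in> {0..1} \<times> {0..1}" "n \<ge> 1"
    and "\<And>q. q \<in> {0..1} \<times> {0..1} \<Longrightarrow> \<bar>fst q - fst p\<bar> \<le> 1 / real n \<Longrightarrow> \<bar>snd q - snd p\<bar> \<le> 1 / real n \<Longrightarrow> V q = V p"
  shows "K n (block_average n V) p = V p"
proof -
  obtain i j where ij: "i < n" "j < n" "p \<in> block n i j" using block_cover[OF assms(1,2)] .
  have "block_integral n V i j = V p / (real n)\<^sup>2"
  proof (rule block_integral_const[OF ij(1,2)])
    fix q assume "q \<in> block n i j"
    then have q: "fst q \<in> Q n i" "snd q \<in> Q n j" and p: "fst p \<in> Q n i" "snd p \<in> Q n j"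
      using ij by (auto simp: mem_Times_iff)
    show "V q = V p"
      using q p Q_subset[OF ij(1)] Q_subset[OF ij(2)]
      by (intro assms(3) Q_diameter[OF q(1) p(1) ij(1)] Q_diameter[OF q(2) p(2) ij(2)]) (auto simp: mem_Times_iff)
  qed
  then show ?thesis using assms(2) by (simp add: K_eq[OF ij] block_average_def)
qed

lemma L1_averageable_corner: "L1_averageable (indicator (({0..1} \<inter> {..a}) \<times> ({0..1} \<inter> {..b})))"
  (is "L1_averageable ?V")
proof -
  let ?D = "({0..1} \<inter> {..a}) \<times> ({0..1} \<inter> {..b::real}) :: (real \<times> real) set"
  have D: "?D \<in> sets unit_square" by (intro pair_measureI) (auto simp: sets_unit_interval_iff)
  then have meas [measurable]: "?V \<in> borel_measurable unit_square" by simp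
  have AE1: "AE x in unit_interval. x \<noteq> c" for c
    using AE_lborel_singleton[of c] by (subst AE_restrict_space_iff) auto
  have "AE p in unit_square. (case p of (x, y) \<Rightarrow> x \<noteq> a \<and> y \<noteq> b)"
  proof (rule unit_square.AE_pair_measure)
    show "AE x in unit_interval. AE y in unit_interval. case (x, y) of (x, y) \<Rightarrow> x \<noteq> a \<and> y \<noteq> b"
      using AE1[of a] AE1[of b] by (auto elim!: AE_mp)
    have [measurable]: "fst \<in> borel_measurable unit_square" "snd \<in> borel_measurable unit_square"
      using measurable_fst[of unit_interval unit_interval] measurable_snd[of unit_interval unit_interval]
      by (simp_all add: measurable_restrict_space2_iff)
    show "{p \<in> space unit_square. case p of (x, y) \<Rightarrow> x \<noteq> a \<and> y \<noteq> b} \<in> sets unit_square"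
      unfolding case_prod_unfold by measurable
  qed
  then have conv: "AE p in unit_square. (\<lambda>n. \<bar>K n (block_average n ?V) p - ?V p\<bar>) \<longlonglongrightarrow> 0"
  proof (rule AE_mp, intro AE_I2 impI)
    fix p assume p: "p \<in> space unit_square" "case p of (x, y) \<Rightarrow> x \<noteq> a \<and> y \<noteq> b"
    define \<epsilon> where "\<epsilon> = min \<bar>fst p - a\<bar> \<bar>snd p - b\<bar>"
    have "\<epsilon> > 0" using p by (auto simp: \<epsilon>_def split: prod.splits)
    have "(\<lambda>n. 1 / real n) \<longlonglongrightarrow> 0" by (rule lim_1_over_n)
    then have "eventually (\<lambda>n. 1 / real n < \<epsilon>) sequentially" using \<open>\<epsilon> > 0\<close> by (rule order_tendstoD)
    then have "eventually (\<lambda>n. \<bar>K n (block_average n ?V) p - ?V p\<bar> = 0) sequentially"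
      using eventually_ge_at_top[of 1]
    proof eventually_elim
      case (elim n)
      have "K n (block_average n ?V) p = ?V p"
      proof (rule K_block_average_locally_const)
        fix q :: "real \<times> real"
        assume q: "q \<in> {0..1} \<times> {0..1}" "\<bar>fst q - fst p\<bar> \<le> 1 / real n" "\<bar>snd q - snd p\<bar> \<le> 1 / real n"
        then have "fst q \<le> a \<longleftrightarrow> fst p \<le> a" "snd q \<le> b \<longleftrightarrow> snd p \<le> b"
          using elim unfolding \<epsilon>_def by linarith+
        with q p show "?V q = ?V p" by (auto simp: indicator_def mem_Times_iff split: if_splits)
      qed (use p elim in auto)
      then show ?case by simp
    qed
    then show "(\<lambda>n. \<bar>K n (block_average n ?V) p - ?V p\<bar>) \<longlonglongrightarrow> 0" by (rule tendsto_eventually)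
  qed
  have "(\<lambda>n. \<integral>p. \<bar>K n (block_average n ?V) p - ?V p\<bar> \<partial>unit_square) \<longlonglongrightarrow> (\<integral>p. 0 \<partial>unit_square)"
  proof (rule integral_dominated_convergence[where w = "\<lambda>_. 2", OF _ _ _ conv])
    show "AE p in unit_square. norm \<bar>K n (block_average n ?V) p - ?V p\<bar> \<le> 2" for n
    proof (rule AE_I2)
      fix p assume "p \<in> space unit_square"
      have "\<bar>K n (block_average n ?V) p\<bar> \<le> 1"
      proof (cases "n = 0")
        case False
        with \<open>p \<in> space unit_square\<close> obtain i j where ij: "i < n" "j < n" "p \<in> block n i j"
          using block_cover[of p n] by auto
        then show ?thesis using abs_block_average_le[OF meas, of 1 i n j] by (simp add: K_eq indicator_def)
      qed (simp add: K_def case_prod_unfold)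
      then show "norm \<bar>K n (block_average n ?V) p - ?V p\<bar> \<le> 2" by (auto simp: indicator_def)
    qed
    show "(\<lambda>p. \<bar>K n (block_average n ?V) p - ?V p\<bar>) \<in> borel_measurable unit_square" for n
      by (intro borel_measurable_abs borel_measurable_diff K_measurable meas)
  qed simp_all
  then show ?thesis by (simp add: L1_averageable_def)
qed

lemma sets_unit_interval_generator:
  "sets unit_interval = sigma_sets {0..1} (range (\<lambda>a. {0..1} \<inter> {..a}))"
proof -
  have "sets unit_interval = (\<inter>) {0..1} ` sigma_sets UNIV (range (\<lambda>a::real. {..a}))"
    by (simp add: sets_restrict_space borel_eq_atMost)
  also have "\<dots> = sigma_sets {0..1} ((\<inter>) {0..1} ` range (\<lambda>a::real. {..a}))"
  proof (rule sigma_sets_Int)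
    have "{0..1::real} \<in> sets borel" by simp
    then show "{0..1} \<in> sigma_sets UNIV (range (\<lambda>a::real. {..a}))" by (subst (asm) borel_eq_atMost) simp
  qed simp
  finally show ?thesis by (simp add: image_image)
qed

lemma L1_averageable_indicator:
  assumes "D \<in> sets unit_square" shows "L1_averageable (indicator D)"
proof -
  let ?E = "range (\<lambda>a::real. {0..1} \<inter> {..a})"
  let ?G = "{A \<times> B | A B. A \<in> ?E \<and> B \<in> ?E}"
  have cover: "\<Union>{{0..1} \<inter> {..1::real}} = space unit_interval" by auto
  have sets: "sets unit_square = sigma_sets ({0..1} \<times> {0..1}) ?G"
  proof -
    have "sets unit_square = sets (sigma (space unit_interval \<times> space unit_interval) ?G)"
      by (rule sets_pair_eq[OF _ _ _ _ cover _ _ _ _ cover]) (auto simp: sets_unit_interval_generator)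
    also have "\<dots> = sigma_sets (space unit_interval \<times> space unit_interval) ?G"
      by (rule sets_measure_of) auto
    finally show ?thesis unfolding space_unit_interval .
  qed
  have int: "integrable unit_square (indicator D :: _ \<Rightarrow> real)" if "D \<in> sets unit_square" for D
    using that by (simp add: unit_square.P.emeasure_eq_measure)
  have zero: "L1_averageable (\<lambda>_. 0)"
    by (simp add: L1_averageable_def block_average_def block_integral_def K_indicator)
  have "Int_stable ?G"
  proof (rule Int_stableI)
    fix D D' assume "D \<in> ?G" "D' \<in> ?G"
    then obtain a b a' b' where "D = ({0..1} \<inter> {..a}) \<times> ({0..1} \<inter> {..b})" "D' = ({0..1} \<inter> {..a'}) \<times> ({0..1} \<inter> {..b'})" by auto
    then have "D \<inter> D' = ({0..1} \<inter> {..min a a'}) \<times> ({0..1} \<inter> {..min b b'})" by auto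
    then show "D \<inter> D' \<in> ?G" by blast
  qed
  moreover have "?G \<subseteq> Pow ({0..1} \<times> {0..1})" by auto
  moreover have "D \<in> sigma_sets ({0..1} \<times> {0..1}) ?G" using assms sets by simp
  ultimately show ?thesis
  proof (induction rule: sigma_sets_induct_disjoint)
    case (basic D)
    then show ?case using L1_averageable_corner by auto
  next
    case empty
    then show ?case using zero by (simp add: indicator_def)
  next
    case (compl D)
    have D: "D \<in> sets unit_square" using compl sets by simp
    have "{0..1} \<times> {0..1::real} = ({0..1} \<inter> {..1}) \<times> ({0..1} \<inter> {..1::real})" by auto
    with L1_averageable_corner[of 1 1] have "L1_averageable (indicator ({0..1} \<times> {0..1}))" by simp
    moreover have "{0..1} \<times> {0..1::real} \<in> sets unit_square" using sets.top[of unit_square] by simp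
    ultimately have "L1_averageable (\<lambda>p. indicator ({0..1} \<times> {0..1}) p + (- 1) * indicator D p)"
      using compl D by (intro L1_averageable_add int) auto
    moreover have "indicator ({0..1} \<times> {0..1} - D) p = indicator ({0..1} \<times> {0..1}) p + (- 1) * (indicator D p :: real)" for p
      using sets.sets_into_space[OF D] by (auto simp: indicator_def)
    ultimately show ?case by presburger
  next
    case (union A)
    have A: "A i \<in> sets unit_square" for i using union sets by auto
    have partial: "L1_averageable (indicator (\<Union>i<n. A i))" for n
    proof (induction n)
      case (Suc n)
      have "L1_averageable (\<lambda>p. indicator (\<Union>i<n. A i) p + 1 * indicator (A n) p)"
        using union A Suc by (intro L1_averageable_add int) auto
      moreover have "indicator (\<Union>i<Suc n. A i) p = indicator (\<Union>i<n. A i) p + 1 * (indicator (A n) p :: real)" for p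
      proof (cases "p \<in> A n")
        case True
        have "p \<notin> A i" if "i < n" for i
          using True disjoint_family_onD[OF \<open>disjoint_family A\<close>, of i n] that by auto
        with True show ?thesis by (auto simp: indicator_def)
      qed (auto simp: indicator_def less_Suc_eq)
      ultimately show ?case by presburger
    qed (use zero in \<open>simp add: indicator_def[abs_def]\<close>)
    show ?case
    proof (rule L1_averageable_limit[where s = "\<lambda>n. indicator (\<Union>i<n. A i)" and w = "\<lambda>_. 1"])
      fix p assume "p \<in> space unit_square"
      have "incseq (\<lambda>n. \<Union>i<n. A i)" by (intro incseq_SucI UN_mono) auto
      from LIMSEQ_indicator_incseq[OF this]
      have "(\<lambda>n. indicator (\<Union>i<n. A i) p) \<longlonglongrightarrow> (indicator (\<Union>n. \<Union>i<n. A i) p :: real)" .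
      moreover have "(\<Union>n. \<Union>i<n. A i) = (\<Union>i. A i)"
        using UN_UN_finite_eq[of A] by (simp add: atLeast0LessThan)
      ultimately show "(\<lambda>n. indicator (\<Union>i<n. A i) p) \<longlonglongrightarrow> (indicator (\<Union>i. A i) p :: real)" by simp
    next
      show "integrable unit_square (indicator (\<Union>i. A i) :: _ \<Rightarrow> real)"
        using A by (intro int sets.countable_UN) auto
      show "integrable unit_square (indicator (\<Union>i<n. A i) :: _ \<Rightarrow> real)" for n
        using A by (intro int sets.finite_UN) auto
      show "\<bar>indicator (\<Union>i<n. A i) p :: real\<bar> \<le> 1" for n p by (simp add: indicator_def)
    qed (use partial in simp_all)
  qed
qed

lemma block_average_tendsto_L1:
  assumes "integrable unit_square V"
  shows "(\<lambda>n. \<integral>p. \<bar>K n (block_average n V) p - V p\<bar> \<partial>unit_square) \<longlonglongrightarrow> 0"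
proof -
  have zero: "L1_averageable (\<lambda>_. 0)"
    by (simp add: L1_averageable_def block_average_def block_integral_def K_indicator)
  from assms have "L1_averageable V"
  proof (induction rule: integrable_induct)
    case (base A c)
    then have "L1_averageable (\<lambda>p. 0 + c * indicator A p)"
      using zero by (intro L1_averageable_add L1_averageable_indicator) auto
    then show ?case by (simp add: mult.commute)
  next
    case (add f g)
    then have "L1_averageable (\<lambda>p. f p + 1 * g p)" by (intro L1_averageable_add)
    then show ?case by simp
  next
    case (lim f s)
    show ?case
      by (rule L1_averageable_limit[where s = s and w = "\<lambda>p. 2 * norm (f p)"])
         (use lim in \<open>simp_all del: split_paired_All\<close>)
  qed
  then show ?thesis by (simp add: L1_averageable_def)
qed

section \<open>Increments of Brownian families\<close>

definition increment :: "real \<Rightarrow> (real \<Rightarrow> 'a \<Rightarrow> real) \<Rightarrow> nat \<Rightarrow> 'a \<Rightarrow> real" where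
  "increment \<delta> b l \<omega> = b (real (Suc l) * \<delta>) \<omega> - b (real l * \<delta>) \<omega>"

definition gaussian :: "real \<Rightarrow> real measure" where
  "gaussian v = density lborel (normal_density 0 (sqrt v))"

definition increments_law :: "nat \<Rightarrow> real \<Rightarrow> (nat \<Rightarrow> real) measure" where
  "increments_law m \<delta> = (\<Pi>\<^sub>M l\<in>{..<m}. gaussian \<delta>)"

lemma sets_gaussian [simp, measurable_cong]: "sets (gaussian v) = sets borel"
  by (simp add: gaussian_def)

lemma space_gaussian [simp]: "space (gaussian v) = UNIV"
  by (simp add: gaussian_def)

lemma prob_space_gaussian: "v > 0 \<Longrightarrow> prob_space (gaussian v)"
  unfolding gaussian_def by (rule prob_space_normal_density) simp

lemma sets_increments_law [simp, measurable_cong]: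
  "sets (increments_law m \<delta>) = sets (\<Pi>\<^sub>M l\<in>{..<m}. borel)"
  unfolding increments_law_def by (intro sets_PiM_cong) auto

lemma prob_space_increments_law: "\<delta> > 0 \<Longrightarrow> prob_space (increments_law m \<delta>)"
  unfolding increments_law_def by (intro prob_space_PiM prob_space_gaussian)

locale brownian =
  fixes M :: "'a measure" and F :: "real \<Rightarrow> 'a measure" and I :: "'i set"
    and B :: "'i \<Rightarrow> real \<Rightarrow> 'a \<Rightarrow> real"
  assumes filtered: "filtered_prob_space M F" and family: "brownian_family M F I B"
    and finite_I: "finite I"
begin

sublocale prob_space M
  using filtered by (simp add: filtered_prob_space_def)

sublocale filtration "space M" F
  using filtered by (simp add: filtered_prob_space_def)

lemma sets_F_subset: "sets (F t) \<subseteq> sets M"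
  using filtered by (simp add: filtered_prob_space_def)

lemma B_measurable_F: "i \<in> I \<Longrightarrow> 0 \<le> s \<Longrightarrow> s \<le> t \<Longrightarrow> B i s \<in> borel_measurable (F t)"
proof -
  assume "i \<in> I" "0 \<le> s" "s \<le> t"
  then have "B i s \<in> borel_measurable (F s)" using family by (simp add: brownian_family_def)
  moreover have "borel_measurable (F s) \<subseteq> borel_measurable (F t)"
    using \<open>s \<le> t\<close> by (intro measurable_mono) (auto simp: space_F sets_F_mono)
  ultimately show ?thesis by blast
qed

lemma F_measurable: "f \<in> measurable (F t) N \<Longrightarrow> f \<in> measurable M N"
  using sets_F_subset measurable_mono[of N N "F t" M] by (auto simp: space_F)

lemma B_measurable: "i \<in> I \<Longrightarrow> 0 \<le> s \<Longrightarrow> B i s \<in> borel_measurable M"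
  using B_measurable_F[of i s s] F_measurable by blast

lemma increment_measurable_F:
  "i \<in> I \<Longrightarrow> \<delta> > 0 \<Longrightarrow> l < k \<Longrightarrow> increment \<delta> (B i) l \<in> borel_measurable (F (real k * \<delta>))"
  unfolding increment_def[abs_def]
  by (intro borel_measurable_diff B_measurable_F mult_right_mono) auto

lemma increment_measurable: "i \<in> I \<Longrightarrow> \<delta> > 0 \<Longrightarrow> increment \<delta> (B i) l \<in> borel_measurable M"
  using increment_measurable_F[of i \<delta> l "Suc l"] F_measurable by blast

definition increment_events :: "real \<Rightarrow> ('i \<times> nat) option \<Rightarrow> 'a set set" where
  "increment_events \<delta> k = (case k of None \<Rightarrow> sets (F 0)
     | Some (i, l) \<Rightarrow> {increment \<delta> (B i) l -` A \<inter> space M | A. A \<in> sets borel})"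

lemma increment_events_subset_F:
  assumes "\<delta> > 0" "k = None \<or> (\<exists>i l. k = Some (i, l) \<and> i \<in> I \<and> l < m)"
  shows "increment_events \<delta> k \<subseteq> sets (F (real m * \<delta>))"
  using assms(2)
proof
  assume "k = None"
  then show ?thesis using assms(1) sets_F_mono[of 0 "real m * \<delta>"] by (simp add: increment_events_def)
next
  assume "\<exists>i l. k = Some (i, l) \<and> i \<in> I \<and> l < m"
  then obtain i l where k: "k = Some (i, l)" "i \<in> I" "l < m" by blast
  from measurable_sets[OF increment_measurable_F[OF k(2) assms(1) k(3)]]
  show ?thesis by (auto simp: k increment_events_def space_F)
qed

lemma step_events_indep:
  assumes "\<delta> > 0" "P \<in> sets (F (real m * \<delta>))"
    "\<And>i. i \<in> I \<Longrightarrow> A i \<in> increment_events \<delta> (Some (i, m))"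
  shows "prob (P \<inter> (\<Inter>i\<in>I. A i)) = prob P * (\<Prod>i\<in>I. prob (A i))"
proof -
  let ?s = "real m * \<delta>" and ?t = "real (Suc m) * \<delta>"
  let ?E = "\<lambda>k. case k of None \<Rightarrow> sets (F ?s)
             | Some i \<Rightarrow> sets (vimage_algebra (space M) (\<lambda>\<omega>. B i ?t \<omega> - B i ?s \<omega>) borel)"
  have "0 \<le> ?s" "?s < ?t" using assms(1) by auto
  then have indep: "indep_sets ?E (insert None (Some ` I))"
    using family unfolding brownian_family_def by blast
  have "prob (\<Inter>j\<in>insert None (Some ` I). case_option P A j) = (\<Prod>j\<in>insert None (Some ` I). prob (case_option P A j))"
  proof (rule indep_setsD[OF indep])
    show "\<forall>j\<in>insert None (Some ` I). (case j of None \<Rightarrow> P | Some i \<Rightarrow> A i) \<in> ?E j"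
      using assms(2,3) by (auto simp: increment_events_def increment_def[abs_def] sets_vimage_algebra2)
  qed (use finite_I in auto)
  moreover have "(\<Inter>j\<in>insert None (Some ` I). case_option P A j) = P \<inter> (\<Inter>i\<in>I. A i)" by auto
  moreover have "(\<Prod>j\<in>insert None (Some ` I). prob (case_option P A j)) = prob P * (\<Prod>i\<in>I. prob (A i))"
    using finite_I by (subst prod.insert) (auto simp: prod.reindex)
  ultimately show ?thesis by simp
qed

lemma indep_increment_events:
  assumes "\<delta> > 0"
  shows "indep_sets (increment_events \<delta>) (insert None (Some ` (I \<times> {..<m})))"
proof -
  have "prob (\<Inter>j\<in>insert None (Some ` (I \<times> {..<m})). A j) = (\<Prod>j\<in>insert None (Some ` (I \<times> {..<m})). prob (A j))"
    if "A \<in> Pi (insert None (Some ` (I \<times> {..<m}))) (increment_events \<delta>)" for A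
    using that
  proof (induction m)
    case (Suc m)
    let ?S = "insert None (Some ` (I \<times> {..<m}))"
    have split: "insert None (Some ` (I \<times> {..<Suc m})) = ?S \<union> (\<lambda>i. Some (i, m)) ` I"
      by (auto simp: lessThan_Suc)
    have P: "(\<Inter>j\<in>?S. A j) \<in> sets (F (real m * \<delta>))"
    proof (rule sets.finite_INT)
      show "A j \<in> sets (F (real m * \<delta>))" if "j \<in> ?S" for j
      proof -
        have "A j \<in> increment_events \<delta> j" using Suc.prems that by (auto simp: lessThan_Suc)
        moreover have "increment_events \<delta> j \<subseteq> sets (F (real m * \<delta>))"
          using that by (intro increment_events_subset_F assms) auto
        ultimately show ?thesis by blast
      qed
    qed (use finite_I in auto)
    have "prob (\<Inter>j\<in>?S \<union> (\<lambda>i. Some (i, m)) ` I. A j) = prob ((\<Inter>j\<in>?S. A j) \<inter> (\<Inter>i\<in>I. A (Some (i, m))))"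
      by (intro arg_cong[where f = prob]) auto
    also have "\<dots> = prob (\<Inter>j\<in>?S. A j) * (\<Prod>i\<in>I. prob (A (Some (i, m))))"
      by (rule step_events_indep[OF assms P]) (use Suc.prems in auto)
    also have "prob (\<Inter>j\<in>?S. A j) = (\<Prod>j\<in>?S. prob (A j))"
      using Suc.prems by (intro Suc.IH) auto
    also have "(\<Prod>i\<in>I. prob (A (Some (i, m)))) = (\<Prod>j\<in>(\<lambda>i. Some (i, m)) ` I. prob (A j))"
      by (subst prod.reindex) (auto simp: inj_on_def)
    also have "(\<Prod>j\<in>?S. prob (A j)) * \<dots> = (\<Prod>j\<in>?S \<union> (\<lambda>i. Some (i, m)) ` I. prob (A j))"
      using finite_I by (intro prod.union_disjoint[symmetric]) auto
    finally show ?case unfolding split .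
  qed simp
  moreover have "increment_events \<delta> k \<subseteq> events \<and> space M \<in> increment_events \<delta> k"
    if "k \<in> insert None (Some ` (I \<times> {..<m}))" for k
  proof
    have "increment_events \<delta> k \<subseteq> sets (F (real m * \<delta>))"
      using that by (intro increment_events_subset_F assms) auto
    then show "increment_events \<delta> k \<subseteq> events" using sets_F_subset by blast
    show "space M \<in> increment_events \<delta> k"
      using sets.top[of "F 0"] by (auto simp: increment_events_def space_F split: option.split intro!: exI[of _ UNIV])
  qed
  ultimately show ?thesis
    by (subst indep_sets_finite) (use finite_I in auto)
qed

lemma indep_increments:
  assumes "\<delta> > 0"
  shows "indep_vars (\<lambda>_. borel) (\<lambda>(i, l). increment \<delta> (B i) l) (I \<times> {..<m})"
  unfolding indep_vars_def2
proof
  show "\<forall>il\<in>I \<times> {..<m}. random_variable borel (case il of (i, l) \<Rightarrow> increment \<delta> (B i) l)"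
    using increment_measurable assms by auto
  let ?E = "\<lambda>il. {(case il of (i, l) \<Rightarrow> increment \<delta> (B i) l) -` A \<inter> space M | A. A \<in> sets borel}"
  have "indep_sets (increment_events \<delta>) (Some ` (I \<times> {..<m}))"
    using indep_increment_events[OF assms] by (rule indep_sets_mono_index[rotated]) auto
  show "indep_sets ?E (I \<times> {..<m})"
  proof (rule indep_setsI)
    show "?E il \<subseteq> events" if "il \<in> I \<times> {..<m}" for il
      using that increment_measurable[OF _ assms] by (auto intro: measurable_sets)
    fix A J assume J: "J \<noteq> {}" "J \<subseteq> I \<times> {..<m}" "finite J" "\<forall>j\<in>J. A j \<in> ?E j"
    have "prob (\<Inter>j\<in>Some ` J. A (the j)) = (\<Prod>j\<in>Some ` J. prob (A (the j)))"
      by (rule indep_setsD[OF \<open>indep_sets (increment_events \<delta>) (Some ` (I \<times> {..<m}))\<close>])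
         (use J in \<open>auto simp: increment_events_def\<close>)
    then show "prob (\<Inter>j\<in>J. A j) = (\<Prod>j\<in>J. prob (A j))" by (simp add: prod.reindex)
  qed
qed

lemma distr_increment:
  assumes "\<delta> > 0" "i \<in> I" shows "distr M borel (increment \<delta> (B i) l) = gaussian \<delta>"
proof -
  have "0 \<le> real l * \<delta>" "real l * \<delta> < real (Suc l) * \<delta>" using assms by auto
  then have "distributed M lborel (\<lambda>\<omega>. B i (real (Suc l) * \<delta>) \<omega> - B i (real l * \<delta>) \<omega>)
      (normal_density 0 (sqrt (real (Suc l) * \<delta> - real l * \<delta>)))"
    using family assms(2) unfolding brownian_family_def by blast
  from distributed_distr_eq_density[OF this]
  have "distr M lborel (increment \<delta> (B i) l) = gaussian \<delta>"
    by (simp add: increment_def[abs_def] gaussian_def algebra_simps)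
  then show ?thesis by (simp cong: distr_cong)
qed

lemma increments_measurable:
  assumes "\<delta> > 0" "i \<in> I"
  shows "(\<lambda>\<omega>. \<lambda>l\<in>{..<m}. increment \<delta> (B i) l \<omega>) \<in> measurable M (\<Pi>\<^sub>M l\<in>{..<m}. borel)"
  by (intro measurable_restrict increment_measurable assms)

lemma distr_increments:
  assumes "\<delta> > 0" "i \<in> I"
  shows "distr M (\<Pi>\<^sub>M l\<in>{..<m}. borel) (\<lambda>\<omega>. \<lambda>l\<in>{..<m}. increment \<delta> (B i) l \<omega>) = increments_law m \<delta>"
proof (cases "m = 0")
  case True
  show ?thesis
  proof (rule measure_eqI)
    fix A assume "A \<in> sets (distr M (\<Pi>\<^sub>M l\<in>{..<m}. borel) (\<lambda>\<omega>. \<lambda>l\<in>{..<m}. increment \<delta> (B i) l \<omega>))"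
    then have "A \<in> {{}, {\<lambda>x. undefined}}" by (simp add: True sets_PiM_empty)
    moreover have "emeasure (increments_law m \<delta>) {\<lambda>x. undefined} = 1"
      unfolding increments_law_def True by (simp add: PiM_empty)
    ultimately show "emeasure (distr M (\<Pi>\<^sub>M l\<in>{..<m}. borel) (\<lambda>\<omega>. \<lambda>l\<in>{..<m}. increment \<delta> (B i) l \<omega>)) A = emeasure (increments_law m \<delta>) A"
      using assms by (auto simp: True emeasure_distr emeasure_space_1 restrict_def sets_PiM_empty measurable_def space_PiM)
  qed simp
next
  case False
  have "indep_sets (increment_events \<delta>) (Some ` ({i} \<times> {..<m}))"
    using indep_increment_events[OF assms(1), of m] by (rule indep_sets_mono_index[rotated]) (use assms in auto)
  have "indep_vars (\<lambda>_. borel) (increment \<delta> (B i)) {..<m}"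
    unfolding indep_vars_def2
  proof
    show "\<forall>l\<in>{..<m}. random_variable borel (increment \<delta> (B i) l)" using increment_measurable assms by auto
    show "indep_sets (\<lambda>l. {increment \<delta> (B i) l -` A \<inter> space M | A. A \<in> sets borel}) {..<m}"
    proof (rule indep_setsI)
      show "{increment \<delta> (B i) l -` A \<inter> space M | A. A \<in> sets borel} \<subseteq> events" for l
        using increment_measurable[OF assms(2,1)] by (auto intro: measurable_sets)
      fix A J assume J: "J \<noteq> {}" "J \<subseteq> {..<m}" "finite J"
        "\<forall>j\<in>J. A j \<in> {increment \<delta> (B i) j -` A \<inter> space M | A. A \<in> sets borel}"
      have "prob (\<Inter>j\<in>(\<lambda>l. Some (i, l)) ` J. A (snd (the j))) = (\<Prod>j\<in>(\<lambda>l. Some (i, l)) ` J. prob (A (snd (the j))))"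
        by (rule indep_setsD[OF \<open>indep_sets (increment_events \<delta>) (Some ` ({i} \<times> {..<m}))\<close>])
           (use J in \<open>auto simp: increment_events_def\<close>)
      then show "prob (\<Inter>j\<in>J. A j) = (\<Prod>j\<in>J. prob (A j))" by (simp add: prod.reindex inj_on_def)
    qed
  qed
  then have "distr M (\<Pi>\<^sub>M l\<in>{..<m}. borel) (\<lambda>\<omega>. \<lambda>l\<in>{..<m}. increment \<delta> (B i) l \<omega>)
      = (\<Pi>\<^sub>M l\<in>{..<m}. distr M borel (increment \<delta> (B i) l))"
    using False increment_measurable assms by (subst (asm) indep_vars_iff_distr_eq_PiM) auto
  also have "\<dots> = increments_law m \<delta>"
    by (simp add: distr_increment assms increments_law_def)
  finally show ?thesis .
qed

lemma distr_pair_increments: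
  assumes "\<delta> > 0" "i \<in> I" and V: "V \<in> measurable (F 0) S"
  shows "distr M (S \<Otimes>\<^sub>M (\<Pi>\<^sub>M l\<in>{..<m}. borel)) (\<lambda>\<omega>. (V \<omega>, \<lambda>l\<in>{..<m}. increment \<delta> (B i) l \<omega>))
    = distr M S V \<Otimes>\<^sub>M increments_law m \<delta>"
proof -
  let ?\<xi> = "\<lambda>\<omega>. \<lambda>l\<in>{..<m}. increment \<delta> (B i) l \<omega>" and ?P = "\<Pi>\<^sub>M l\<in>{..<m}. (borel :: real measure)"
  let ?J = "case_bool {None} (Some ` ({i} \<times> {..<m}))"
  let ?\<Sigma> = "\<lambda>b. sigma_sets (space M) (\<Union>j\<in>?J b. increment_events \<delta> j)"
  have "indep_sets ?\<Sigma> UNIV"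
  proof (rule indep_sets_collect_sigma)
    show "indep_sets (increment_events \<delta>) (\<Union>b. ?J b)"
      using indep_increment_events[OF assms(1), of m]
      by (rule indep_sets_mono_index[rotated]) (use assms in \<open>auto split: bool.splits\<close>)
    show "disjoint_family_on ?J UNIV" by (auto simp: disjoint_family_on_def split: bool.splits)
    show "Int_stable (increment_events \<delta> j)" for j
    proof (cases j)
      case (Some il)
      have "\<exists>C. (f -` A \<inter> space M) \<inter> (f -` A' \<inter> space M) = f -` C \<inter> space M \<and> C \<in> sets borel"
        if "A \<in> sets borel" "A' \<in> sets borel" for A A' and f :: "'a \<Rightarrow> real"
        by (rule exI[of _ "A \<inter> A'"]) (use that in auto)
      then show ?thesis unfolding Int_stable_def increment_events_def Some by (fastforce split: prod.splits)
    qed (auto simp: increment_events_def Int_stable_def)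
  qed
  then have indep: "indep_set (?\<Sigma> True) (?\<Sigma> False)"
    unfolding indep_set_def by (rule arg_cong2[where f = indep_sets, THEN iffD1, rotated -1]) (auto split: bool.splits)
  have V': "V \<in> measurable M S" by (rule F_measurable[OF V])
  have \<xi>: "?\<xi> \<in> measurable M ?P" by (rule increments_measurable[OF assms(1,2)])
  let ?G = "sigma (space M) (\<Union>j\<in>?J False. increment_events \<delta> j)"
  have sub: "(\<Union>j\<in>?J False. increment_events \<delta> j) \<subseteq> Pow (space M)"
    by (auto simp: increment_events_def)
  have \<xi>G: "?\<xi> \<in> measurable ?G ?P"
  proof (rule measurable_restrict)
    show "increment \<delta> (B i) l \<in> measurable ?G borel" if "l \<in> {..<m}" for l
    proof (rule measurableI)
      fix A :: "real set" assume "A \<in> sets borel"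
      then have "increment \<delta> (B i) l -` A \<inter> space M \<in> increment_events \<delta> (Some (i, l))"
        by (auto simp: increment_events_def)
      then have "increment \<delta> (B i) l -` A \<inter> space M \<in> (\<Union>j\<in>?J False. increment_events \<delta> j)"
        using that by auto
      then show "increment \<delta> (B i) l -` A \<inter> space ?G \<in> sets ?G"
        unfolding sets_measure_of[OF sub] space_measure_of[OF sub] by (rule sigma_sets.Basic)
    qed auto
  qed
  have "distr M S V \<Otimes>\<^sub>M distr M ?P ?\<xi> = distr M (S \<Otimes>\<^sub>M ?P) (\<lambda>\<omega>. (V \<omega>, ?\<xi> \<omega>))"
  proof (rule pair_measure_eqI)
    interpret V: prob_space "distr M S V" by (rule prob_space_distr[OF V'])
    interpret \<xi>: prob_space "distr M ?P ?\<xi>" by (rule prob_space_distr[OF \<xi>])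
    show "sigma_finite_measure (distr M S V)" "sigma_finite_measure (distr M ?P ?\<xi>)" by unfold_locales
    show "sets (distr M S V \<Otimes>\<^sub>M distr M ?P ?\<xi>) = sets (distr M (S \<Otimes>\<^sub>M ?P) (\<lambda>\<omega>. (V \<omega>, ?\<xi> \<omega>)))"
      by simp
    fix A C assume A: "A \<in> sets (distr M S V)" and C: "C \<in> sets (distr M ?P ?\<xi>)"
    let ?A = "V -` A \<inter> space M" and ?C = "?\<xi> -` C \<inter> space M"
    have "?A \<in> sets (F 0)" using measurable_sets[OF V] A by (simp add: space_F)
    then have "?A \<in> ?\<Sigma> True" by (auto simp: increment_events_def)
    moreover have "?C \<in> ?\<Sigma> False"
      using measurable_sets[OF \<xi>G, of C, unfolded sets_measure_of[OF sub] space_measure_of[OF sub]] C by simp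
    ultimately have "prob (?A \<inter> ?C) = prob ?A * prob ?C" using indep unfolding indep_sets2_eq by blast
    moreover have "(\<lambda>\<omega>. (V \<omega>, ?\<xi> \<omega>)) -` (A \<times> C) \<inter> space M = ?A \<inter> ?C" by auto
    ultimately show "emeasure (distr M S V) A * emeasure (distr M ?P ?\<xi>) C =
        emeasure (distr M (S \<Otimes>\<^sub>M ?P) (\<lambda>\<omega>. (V \<omega>, ?\<xi> \<omega>))) (A \<times> C)"
      using A C V' \<xi> by (simp add: emeasure_distr emeasure_eq_measure ennreal_mult)
  qed
  then show ?thesis unfolding distr_increments[OF assms(1,2)] by simp
qed

end

subsection \<open>Oscillation of Brownian paths\<close>

text \<open>
  The oscillation is measured on dyadic refinements of the grid only; its probability is then
  determined by the law of finitely many increments at a time, hence common to all Brownian motions.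
\<close>

definition rough_at :: "real \<Rightarrow> nat \<Rightarrow> real \<Rightarrow> nat \<Rightarrow> (real \<Rightarrow> real) \<Rightarrow> bool" where
  "rough_at T m \<eta> p b \<longleftrightarrow> (\<exists>k<m. \<exists>l\<le>2 ^ p. \<eta> <
     \<bar>b (real (k * 2 ^ p + l) * (T / real (m * 2 ^ p))) - b (real (k * 2 ^ p) * (T / real (m * 2 ^ p)))\<bar>)"

definition rough :: "real \<Rightarrow> nat \<Rightarrow> real \<Rightarrow> (real \<Rightarrow> real) \<Rightarrow> bool" where
  "rough T m \<eta> b \<longleftrightarrow> (\<exists>p. rough_at T m \<eta> p b)"

definition rough_increments :: "nat \<Rightarrow> real \<Rightarrow> nat \<Rightarrow> (nat \<Rightarrow> real) set" where
  "rough_increments m \<eta> p = {z \<in> {..<m * 2 ^ p} \<rightarrow>\<^sub>E UNIV.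
     \<exists>k<m. \<exists>l\<le>2 ^ p. \<eta> < \<bar>\<Sum>q\<in>{k * 2 ^ p..<k * 2 ^ p + l}. z q\<bar>}"

definition rough_prob :: "real \<Rightarrow> nat \<Rightarrow> real \<Rightarrow> ennreal" where
  "rough_prob T m \<eta> = (SUP p. emeasure (increments_law (m * 2 ^ p) (T / real (m * 2 ^ p))) (rough_increments m \<eta> p))"

lemma block_index_less:
  fixes k l m p :: nat
  assumes "k < m" "l \<le> 2 ^ p" "q < k * 2 ^ p + l"
  shows "q < m * 2 ^ p"
proof -
  have "k * 2 ^ p + l \<le> Suc k * 2 ^ p" using assms by simp
  also have "\<dots> \<le> m * 2 ^ p" using assms by (intro mult_right_mono) auto
  finally show ?thesis using assms by simp
qed

lemma rough_increments_sets: "rough_increments m \<eta> p \<in> sets (\<Pi>\<^sub>M l\<in>{..<m * 2 ^ p}. borel)"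
proof -
  have [measurable]: "(\<lambda>z. \<Sum>q\<in>{k * 2 ^ p..<k * 2 ^ p + l}. z q :: real) \<in> borel_measurable (\<Pi>\<^sub>M l\<in>{..<m * 2 ^ p}. borel)"
    if "k \<in> {..<m}" "l \<in> {..2 ^ p}" for k l :: nat
    using that block_index_less[of k m l p] by (intro borel_measurable_sum[where f = "\<lambda>q z. z q"] measurable_component_singleton) auto
  have "rough_increments m \<eta> p = (\<Union>k\<in>{..<m}. \<Union>l\<in>{..2 ^ p}.
      {z \<in> space (\<Pi>\<^sub>M l\<in>{..<m * 2 ^ p}. borel). \<eta> < \<bar>\<Sum>q\<in>{k * 2 ^ p..<k * 2 ^ p + l}. z q\<bar>})"
    by (auto simp: rough_increments_def space_PiM)
  also have "\<dots> \<in> sets (\<Pi>\<^sub>M l\<in>{..<m * 2 ^ p}. borel)"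
    by (intro sets.finite_UN) auto
  finally show ?thesis .
qed

lemma rough_at_Suc:
  assumes "rough_at T m \<eta> p b" shows "rough_at T m \<eta> (Suc p) b"
proof -
  from assms obtain k l where kl: "k < m" "l \<le> 2 ^ p"
    "\<eta> < \<bar>b (real (k * 2 ^ p + l) * (T / real (m * 2 ^ p))) - b (real (k * 2 ^ p) * (T / real (m * 2 ^ p)))\<bar>"
    by (auto simp: rough_at_def)
  have half: "real (2 * c) * (T / real (m * 2 ^ Suc p)) = real c * (T / real (m * 2 ^ p))" for c
    by simp
  have "k * 2 ^ Suc p + 2 * l = 2 * (k * 2 ^ p + l)" "k * 2 ^ Suc p = 2 * (k * 2 ^ p)" by simp_all
  then have "\<eta> < \<bar>b (real (k * 2 ^ Suc p + 2 * l) * (T / real (m * 2 ^ Suc p))) - b (real (k * 2 ^ Suc p) * (T / real (m * 2 ^ Suc p)))\<bar>"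
    using kl(3) by (simp only: half)
  with kl(1,2) show ?thesis unfolding rough_at_def by (intro exI[of _ k] conjI exI[of _ "2 * l"]) auto
qed

lemma not_rough_bound:
  assumes cont: "continuous_on {0..} b" and "T > 0" "\<not> rough T m \<eta> b" "k < m"
    and r: "real k * (T / real m) \<le> r" "r \<le> real (Suc k) * (T / real m)"
  shows "\<bar>b r - b (real k * (T / real m))\<bar> \<le> \<eta>"
proof -
  define h where "h = (\<lambda>p::nat. T / real (m * 2 ^ p))"
  have m: "real m > 0" using assms by simp
  have h: "h p > 0" for p using assms(2) m by (simp add: h_def)
  have t: "real (k * 2 ^ p) * h p = real k * (T / real m)" for p by (simp add: h_def)
  define l where "l = (\<lambda>p. nat \<lfloor>(r - real k * (T / real m)) / h p\<rfloor>)"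
  have nonneg: "0 \<le> (r - real k * (T / real m)) / h p" for p using r h[of p] by simp
  have l1: "real (l p) \<le> (r - real k * (T / real m)) / h p" "(r - real k * (T / real m)) / h p < real (l p) + 1" for p
    unfolding l_def using nonneg[of p] by (simp_all add: of_nat_floor)
  have "l p \<le> 2 ^ p" for p
  proof -
    have "(r - real k * (T / real m)) / h p \<le> (T / real m) / h p"
    proof (rule divide_right_mono)
      have "real (Suc k) * (T / real m) = real k * (T / real m) + T / real m" by (simp add: distrib_right add_divide_distrib)
      with r show "r - real k * (T / real m) \<le> T / real m" by linarith
    qed (use h[of p] in simp)
    also have "\<dots> = 2 ^ p" using assms(2) m by (simp add: h_def field_simps)
    finally have "real (l p) \<le> 2 ^ p" by (rule order_trans[OF l1(1)])
    then show ?thesis by simp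
  qed
  then have "\<not> \<eta> < \<bar>b (real (k * 2 ^ p + l p) * h p) - b (real (k * 2 ^ p) * h p)\<bar>" for p
    using assms(3,4) unfolding rough_def rough_at_def h_def by blast
  then have bound: "\<bar>b (real (k * 2 ^ p + l p) * h p) - b (real k * (T / real m))\<bar> \<le> \<eta>" for p
    unfolding t not_less .
  have dist: "\<bar>real (k * 2 ^ p + l p) * h p - r\<bar> \<le> h p" for p
  proof -
    have "real (k * 2 ^ p + l p) * h p = real k * (T / real m) + real (l p) * h p"
      using t[of p] by (simp add: algebra_simps)
    moreover have "real (l p) * h p \<le> r - real k * (T / real m)" "r - real k * (T / real m) < real (l p) * h p + h p"
      using l1[of p] h[of p] by (simp_all add: field_simps)
    ultimately show ?thesis using h[of p] by linarith
  qed
  have h0: "h \<longlonglongrightarrow> 0"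
  proof -
    have "(\<lambda>p. (T / real m) * (1 / 2) ^ p) \<longlonglongrightarrow> (T / real m) * 0"
      by (intro tendsto_mult tendsto_const LIMSEQ_realpow_zero) auto
    then show ?thesis by (simp add: h_def power_divide divide_divide_eq_left)
  qed
  have s: "(\<lambda>p. real (k * 2 ^ p + l p) * h p) \<longlonglongrightarrow> r"
    by (rule LIM_zero_cancel, rule Lim_null_comparison[OF _ h0]) (use dist in auto)
  have "0 \<le> real k * (T / real m)" using assms(2) by simp
  then have "r \<ge> 0" using r(1) by linarith
  then have "(\<lambda>p. b (real (k * 2 ^ p + l p) * h p)) \<longlonglongrightarrow> b r"
    using less_imp_le[OF h] by (intro continuous_on_tendsto_compose[OF cont s]) (auto intro!: always_eventually mult_nonneg_nonneg)
  then have "(\<lambda>p. \<bar>b (real (k * 2 ^ p + l p) * h p) - b (real k * (T / real m))\<bar>) \<longlonglongrightarrow> \<bar>b r - b (real k * (T / real m))\<bar>"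
    by (intro tendsto_intros)
  then show ?thesis by (rule LIMSEQ_le_const2) (use bound in auto)
qed

lemma eventually_not_rough:
  assumes cont: "continuous_on {0..} b" and "T > 0" "\<eta> > 0"
  shows "eventually (\<lambda>m. \<not> rough T m \<eta> b) sequentially"
proof -
  have "uniformly_continuous_on {0..T} b"
    by (intro compact_uniformly_continuous continuous_on_subset[OF cont]) auto
  then obtain d where d: "d > 0" "\<And>x y. x \<in> {0..T} \<Longrightarrow> y \<in> {0..T} \<Longrightarrow> dist y x < d \<Longrightarrow> dist (b y) (b x) < \<eta>"
    unfolding uniformly_continuous_on_def using assms(3) by blast
  have "(\<lambda>m. T / real m) \<longlonglongrightarrow> 0" by (rule lim_const_over_n)
  then have "eventually (\<lambda>m. T / real m < d) sequentially" using d(1) by (rule order_tendstoD)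
  then show ?thesis
  proof eventually_elim
    case (elim m)
    show ?case
    proof
      assume "rough T m \<eta> b"
      then obtain p k l where kl: "k < m" "l \<le> 2 ^ p"
        "\<eta> < \<bar>b (real (k * 2 ^ p + l) * (T / real (m * 2 ^ p))) - b (real (k * 2 ^ p) * (T / real (m * 2 ^ p)))\<bar>"
        by (auto simp: rough_def rough_at_def)
      let ?h = "T / real (m * 2 ^ p)"
      have m: "real m > 0" using kl by simp
      have in_range: "real c * ?h \<in> {0..T}" if "c \<le> m * 2 ^ p" for c
      proof -
        have "real c \<le> real (m * 2 ^ p)" using that by (simp only: of_nat_le_iff)
        then have "real c * ?h \<le> real (m * 2 ^ p) * ?h" using assms(2) by (intro mult_right_mono) auto
        also have "\<dots> = T" using m by simp
        finally show ?thesis using assms(2) by simp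
      qed
      have le: "k * 2 ^ p + l \<le> m * 2 ^ p"
      proof -
        have "k * 2 ^ p + l \<le> Suc k * 2 ^ p" using kl by simp
        also have "\<dots> \<le> m * 2 ^ p" using kl by (intro mult_right_mono) auto
        finally show ?thesis .
      qed
      have "dist (real (k * 2 ^ p + l) * ?h) (real (k * 2 ^ p) * ?h) = real l * ?h"
        using assms(2) by (simp add: dist_real_def algebra_simps add_divide_distrib[symmetric])
      also have "\<dots> \<le> 2 ^ p * ?h" using kl(2) assms(2) by (intro mult_right_mono) (auto simp flip: of_nat_power)
      also have "\<dots> = T / real m" by simp
      finally have "dist (real (k * 2 ^ p + l) * ?h) (real (k * 2 ^ p) * ?h) < d" using elim by simp
      then have "dist (b (real (k * 2 ^ p + l) * ?h)) (b (real (k * 2 ^ p) * ?h)) < \<eta>"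
        using le kl(1) by (intro d(2) in_range) auto
      with kl(3) show False by (simp add: dist_real_def)
    qed
  qed
qed

context brownian
begin

lemma
  assumes "T > 0" "m \<ge> 1" "i \<in> I"
  shows rough_event: "{\<omega> \<in> space M. rough T m \<eta> (\<lambda>t. B i t \<omega>)} \<in> events"
    and emeasure_rough: "emeasure M {\<omega> \<in> space M. rough T m \<eta> (\<lambda>t. B i t \<omega>)} = rough_prob T m \<eta>"
proof -
  let ?E = "\<lambda>p. {\<omega> \<in> space M. rough_at T m \<eta> p (\<lambda>t. B i t \<omega>)}"
  let ?\<xi> = "\<lambda>p \<omega>. \<lambda>l\<in>{..<m * 2 ^ p}. increment (T / real (m * 2 ^ p)) (B i) l \<omega>"
  have \<delta>: "T / real (m * 2 ^ p) > 0" for p using assms by simp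
  have "?E p = ?\<xi> p -` rough_increments m \<eta> p \<inter> space M" for p
  proof -
    let ?h = "T / real (m * 2 ^ p)"
    have "(\<Sum>q\<in>{k * 2 ^ p..<k * 2 ^ p + l}. ?\<xi> p \<omega> q) =
        B i (real (k * 2 ^ p + l) * ?h) \<omega> - B i (real (k * 2 ^ p) * ?h) \<omega>" if "k < m" "l \<le> 2 ^ p" for k l \<omega>
    proof -
      have "(\<Sum>q\<in>{k * 2 ^ p..<k * 2 ^ p + l}. ?\<xi> p \<omega> q) =
          (\<Sum>q\<in>{k * 2 ^ p..<k * 2 ^ p + l}. B i (real (Suc q) * ?h) \<omega> - B i (real q * ?h) \<omega>)"
        using block_index_less[OF that] by (intro sum.cong) (auto simp: increment_def)
      also have "\<dots> = B i (real (k * 2 ^ p + l) * ?h) \<omega> - B i (real (k * 2 ^ p) * ?h) \<omega>"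
        by (rule sum_Suc_diff') simp
      finally show ?thesis .
    qed
    then have "rough_at T m \<eta> p (\<lambda>t. B i t \<omega>) \<longleftrightarrow>
        (\<exists>k<m. \<exists>l\<le>2 ^ p. \<eta> < \<bar>\<Sum>q\<in>{k * 2 ^ p..<k * 2 ^ p + l}. ?\<xi> p \<omega> q\<bar>)" for \<omega>
      unfolding rough_at_def by (intro ex_cong1 conj_cong refl) (simp only:)
    then have "rough_at T m \<eta> p (\<lambda>t. B i t \<omega>) \<longleftrightarrow> ?\<xi> p \<omega> \<in> rough_increments m \<eta> p" for \<omega>
      unfolding rough_increments_def by (simp del: restrict_apply)
    then show ?thesis by blast
  qed
  then have E: "?E p \<in> events \<and> emeasure M (?E p) = emeasure (increments_law (m * 2 ^ p) (T / real (m * 2 ^ p))) (rough_increments m \<eta> p)" for p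
    using measurable_sets[OF increments_measurable[OF \<delta> assms(3)] rough_increments_sets]
      emeasure_distr[OF increments_measurable[OF \<delta> assms(3)] rough_increments_sets]
    unfolding distr_increments[OF \<delta> assms(3)] by simp
  have un: "{\<omega> \<in> space M. rough T m \<eta> (\<lambda>t. B i t \<omega>)} = (\<Union>p. ?E p)" by (auto simp: rough_def)
  show "{\<omega> \<in> space M. rough T m \<eta> (\<lambda>t. B i t \<omega>)} \<in> events" unfolding un using E by auto
  have "?E p \<le> ?E (Suc p)" for p using rough_at_Suc[of T m \<eta> p] by blast
  then have "incseq ?E" by (rule incseq_SucI)
  then show "emeasure M {\<omega> \<in> space M. rough T m \<eta> (\<lambda>t. B i t \<omega>)} = rough_prob T m \<eta>"
    unfolding un rough_prob_def using E by (subst SUP_emeasure_incseq[symmetric]) auto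
qed

lemma AE_continuous: "i \<in> I \<Longrightarrow> AE \<omega> in M. B i 0 \<omega> = 0 \<and> continuous_on {0..} (\<lambda>t. B i t \<omega>)"
  using family by (simp add: brownian_family_def)

lemma rough_prob_tendsto_0:
  assumes "T > 0" "\<eta> > 0" "i \<in> I"
  shows "(\<lambda>m. rough_prob T m \<eta>) \<longlonglongrightarrow> 0"
proof -
  let ?E = "\<lambda>m. {\<omega> \<in> space M. rough T m \<eta> (\<lambda>t. B i t \<omega>)}"
  have E: "?E (Suc m) \<in> events" for m using rough_event[OF assms(1) _ assms(3)] by simp
  have "(\<lambda>m. \<integral>\<omega>. indicator (?E (Suc m)) \<omega> \<partial>M) \<longlonglongrightarrow> (\<integral>\<omega>. (0::real) \<partial>M)"
  proof (rule integral_dominated_convergence[where w = "\<lambda>_. 1"])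
    show "AE \<omega> in M. (\<lambda>m. indicator (?E (Suc m)) \<omega> :: real) \<longlonglongrightarrow> 0"
      using AE_continuous[OF assms(3)]
    proof eventually_elim
      case (elim \<omega>)
      have "eventually (\<lambda>m. \<not> rough T m \<eta> (\<lambda>t. B i t \<omega>)) sequentially"
        using elim by (intro eventually_not_rough assms) auto
      then have "eventually (\<lambda>m. \<not> rough T (Suc m) \<eta> (\<lambda>t. B i t \<omega>)) sequentially"
        by (subst eventually_sequentially_Suc)
      then show ?case by (intro tendsto_eventually) (auto elim!: eventually_mono)
    qed
  qed (use E in auto)
  then have "(\<lambda>m. measure M (?E (Suc m))) \<longlonglongrightarrow> 0" using E by simp
  then have "(\<lambda>m. emeasure M (?E (Suc m))) \<longlonglongrightarrow> 0"
    unfolding emeasure_eq_measure using tendsto_ennrealI by fastforce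
  then have "(\<lambda>m. rough_prob T (Suc m) \<eta>) \<longlonglongrightarrow> 0" using emeasure_rough[OF assms(1) _ assms(3)] by simp
  then show ?thesis by (rule LIMSEQ_imp_Suc)
qed

end

section \<open>Comparison of reflected equations with the scheme\<close>

lemma drift_increment:
  fixes f :: "real \<Rightarrow> real"
  assumes int: "\<And>t. t \<ge> 0 \<Longrightarrow> set_integrable lborel {0..t} f" and ab: "0 \<le> a" "a \<le> b"
    and f: "\<And>r. a \<le> r \<Longrightarrow> r \<le> b \<Longrightarrow> \<bar>f r - c\<bar> \<le> w r"
    and W: "\<And>r. a \<le> r \<Longrightarrow> r \<le> b \<Longrightarrow> (W has_real_derivative w r) (at r)" and w: "continuous_on {a..b} w"
  shows "\<bar>(LINT s:{0..b}|lborel. f s) - (LINT s:{0..a}|lborel. f s) - (b - a) * c\<bar> \<le> W b - W a"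
proof -
  have intab: "set_integrable lborel {a<..b} f"
    by (rule set_integrable_subset[OF int[of b]]) (use ab in auto)
  have inta: "set_integrable lborel {0..a} f" by (rule int[OF ab(1)])
  have "{0..a} \<inter> {a<..b} = {}" "{0..b} = {0..a} \<union> {a<..b}" using ab by auto
  then have "(LINT s:{0..b}|lborel. f s) = (LINT s:{0..a}|lborel. f s) + (LINT s:{a<..b}|lborel. f s)"
    using set_integral_Un[OF _ inta intab] by simp
  moreover have "(LINT s:{a<..b}|lborel. c) = (b - a) * c" using ab by (simp add: set_integral_const)
  moreover have c: "set_integrable lborel {a<..b} (\<lambda>_. c)"
    using ab by (simp add: set_integrable_def)
  ultimately have "(LINT s:{0..b}|lborel. f s) - (LINT s:{0..a}|lborel. f s) - (b - a) * c = (LINT s:{a<..b}|lborel. f s - c)"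
    using intab by (simp add: set_integral_diff)
  also have "\<bar>\<dots>\<bar> \<le> (LINT s:{a<..b}|lborel. \<bar>f s - c\<bar>)"
    using integral_abs_bound[of lborel "\<lambda>s. indicator {a<..b} s *\<^sub>R (f s - c)"]
    by (simp add: set_lebesgue_integral_def abs_mult)
  also have "\<dots> \<le> (LINT s:{a..b}|lborel. w s)"
    unfolding set_lebesgue_integral_def
  proof (rule integral_mono)
    show "integrable lborel (\<lambda>s. indicator {a<..b} s *\<^sub>R \<bar>f s - c\<bar>)"
      using set_integrable_abs[OF set_integral_diff(1)[OF intab c]] by (simp add: set_integrable_def)
    show "integrable lborel (\<lambda>s. indicator {a..b} s *\<^sub>R w s)"
      using borel_integrable_atLeastAtMost'[OF w] by (simp add: set_integrable_def)
    show "indicator {a<..b} s *\<^sub>R \<bar>f s - c\<bar> \<le> indicator {a..b} s *\<^sub>R w s" for s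
      using f[of s] by (auto simp: indicator_def)
  qed
  also have "\<dots> = W b - W a"
    unfolding set_lebesgue_integral_def using ab w
    by (intro integral_FTC_Icc) (auto intro!: DERIV_subset[OF W] simp: has_real_derivative_iff_has_vector_derivative[symmetric])
  finally show ?thesis .
qed

locale reflected_path =
  fixes x lp lm f b :: "real \<Rightarrow> real" and \<beta> C \<eta> \<delta> :: real and m :: nat
  assumes skorokhod: "skorokhod_paths x lp lm"
    and integrable: "\<And>t. t \<ge> 0 \<Longrightarrow> set_integrable lborel {0..t} f"
    and path: "\<And>t. t \<ge> 0 \<Longrightarrow> x t = x 0 + (LINT s:{0..t}|lborel. f s) + \<beta> * b t + lm t - lp t"
    and pos: "\<beta> > 0" "\<delta> > 0" "\<eta> > 0"
    and f_bound: "\<And>r. r \<ge> 0 \<Longrightarrow> \<bar>f r\<bar> \<le> C"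
    and b_bound: "\<And>k r. k < m \<Longrightarrow> real k * \<delta> \<le> r \<Longrightarrow> r \<le> real (Suc k) * \<delta> \<Longrightarrow> \<bar>b r - b (real k * \<delta>)\<bar> \<le> \<eta>"
begin

definition driver :: "real \<Rightarrow> real" where
  "driver t = (LINT s:{0..t}|lborel. f s) + \<beta> * b t"

lemma path_driver: "t \<ge> 0 \<Longrightarrow> x t = x 0 + driver t + lm t - lp t"
  using path[of t] by (simp add: driver_def)

lemma C_nonneg: "C \<ge> 0"
  using f_bound[of 0] by linarith

lemma integral_increment:
  assumes "0 \<le> r" "r \<le> s"
  shows "\<bar>(LINT s:{0..s}|lborel. f s) - (LINT s:{0..r}|lborel. f s)\<bar> \<le> C * (s - r)"
proof -
  have "\<bar>(LINT s:{0..s}|lborel. f s) - (LINT s:{0..r}|lborel. f s) - (s - r) * 0\<bar> \<le> C * s - C * r"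
    using f_bound assms
    by (intro drift_increment[OF integrable assms, where w = "\<lambda>_. C" and W = "\<lambda>r. C * r"]) (auto intro!: derivative_eq_intros)
  then show ?thesis by (simp add: right_diff_distrib)
qed

lemma driver_increment:
  assumes "k < m" "real k * \<delta> \<le> r" "r \<le> s" "s \<le> real (Suc k) * \<delta>"
  shows "\<bar>driver s - driver r\<bar> \<le> C * \<delta> + 2 * (\<beta> * \<eta>)"
proof -
  have "0 \<le> real k * \<delta>" using pos by simp
  then have "\<bar>(LINT s:{0..s}|lborel. f s) - (LINT s:{0..r}|lborel. f s)\<bar> \<le> C * (s - r)"
    using assms by (intro integral_increment) auto
  also have "real (Suc k) * \<delta> = real k * \<delta> + \<delta>" by (simp add: distrib_right)
  then have "C * (s - r) \<le> C * \<delta>" using C_nonneg assms by (intro mult_left_mono) auto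
  finally have 1: "\<bar>(LINT s:{0..s}|lborel. f s) - (LINT s:{0..r}|lborel. f s)\<bar> \<le> C * \<delta>" .
  have "\<bar>b s - b r\<bar> \<le> 2 * \<eta>" using b_bound[of k s] b_bound[of k r] assms by linarith
  then have "\<bar>\<beta> * b s - \<beta> * b r\<bar> \<le> \<beta> * (2 * \<eta>)"
    using pos by (simp add: right_diff_distrib[symmetric] abs_mult)
  with 1 show ?thesis unfolding driver_def by linarith
qed

lemma path_modulus:
  assumes "k < m" "real k * \<delta> \<le> s" "s \<le> real (Suc k) * \<delta>"
  shows "\<bar>x s - x (real k * \<delta>)\<bar> \<le> 2 * (C * \<delta> + 2 * (\<beta> * \<eta>))"
proof -
  let ?t = "real k * \<delta>" and ?e = "C * \<delta> + 2 * (\<beta> * \<eta>)"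
  let ?\<tau> = "\<lambda>i::nat. if i = 0 then ?t else s"
  have e: "0 \<le> ?e" using C_nonneg pos by simp
  have t: "0 \<le> ?t" using pos by simp
  have x1: "\<bar>x ?t\<bar> \<le> 1" using skorokhod t by (force simp: skorokhod_paths_def abs_le_iff)
  have "\<bar>x (?\<tau> 1) - scheme (x ?t) (\<lambda>_. 0) 1\<bar> \<le> \<bar>x (?\<tau> 0) - x ?t\<bar> + ?e + ?e"
  proof (rule reflected_path_scheme[OF skorokhod path_driver])
    show "mono ?\<tau>" using assms by (auto simp: mono_def)
    show "\<bar>driver (?\<tau> b) - driver (?\<tau> a) - (\<Sum>i\<in>{a..<b}. 0)\<bar> \<le> ?e" if "a \<le> b" "b \<le> 1" for a b
      using that e driver_increment[OF assms(1) order_refl assms(2,3)] by auto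
    show "\<bar>driver (?\<tau> (Suc i)) - driver r\<bar> \<le> ?e" if "i < 1" "?\<tau> i \<le> r" "r \<le> ?\<tau> (Suc i)" for i r
      using that driver_increment[OF assms(1) _ _ assms(3), of r] by auto
  qed (use t x1 e in auto)
  then show ?thesis by (simp add: clamp_id[OF x1])
qed

lemma path_scheme:
  assumes steps: "\<And>l r. l < m \<Longrightarrow> real l * \<delta> \<le> r \<Longrightarrow> r \<le> real (Suc l) * \<delta> \<Longrightarrow> \<bar>f r - c l\<bar> \<le> w r"
    and W: "\<And>r. (W has_real_derivative w r) (at r)" and w: "continuous_on UNIV w"
    and k: "k < m" "real k * \<delta> \<le> s" "s \<le> real (Suc k) * \<delta>" and z: "\<bar>z\<bar> \<le> 1"
  shows "\<bar>x s - scheme z (\<lambda>l. \<delta> * c l + \<beta> * (b (real (Suc l) * \<delta>) - b (real l * \<delta>))) k\<bar>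
    \<le> \<bar>x 0 - z\<bar> + (W s - W 0) + 2 * (C * \<delta> + 2 * (\<beta> * \<eta>))"
proof -
  let ?d = "\<lambda>l. \<delta> * c l + \<beta> * (b (real (Suc l) * \<delta>) - b (real l * \<delta>))"
  let ?d' = "\<lambda>l. if l < k then ?d l else 0"
  let ?e = "C * \<delta> + 2 * (\<beta> * \<eta>)"
  let ?\<tau> = "\<lambda>i. if i \<le> k then real i * \<delta> else s"
  have e: "0 \<le> ?e" using C_nonneg pos by simp
  have Sucl: "real (Suc l) * \<delta> = real l * \<delta> + \<delta>" for l by (simp add: distrib_right)
  have t: "0 \<le> real l * \<delta>" for l using pos by simp
  have mono: "mono ?\<tau>"
  proof (rule incseq_SucI)
    fix i show "?\<tau> i \<le> ?\<tau> (Suc i)"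
      using k(2) pos by (cases "i = k") (auto simp: distrib_right)
  qed
  have Wmono: "W p \<le> W q" if "p \<le> q" "0 \<le> p" "q \<le> s" for p q
  proof (rule DERIV_nonneg_imp_nondecreasing[OF that(1)])
    fix y assume y: "p \<le> y" "y \<le> q"
    define l where "l = min k (nat \<lfloor>y / \<delta>\<rfloor>)"
    have y0: "0 \<le> y / \<delta>" using y that pos by simp
    have "l < m" using k by (simp add: l_def)
    moreover have "real l * \<delta> \<le> y"
    proof -
      have "real l \<le> real (nat \<lfloor>y / \<delta>\<rfloor>)" by (simp add: l_def)
      also have "\<dots> \<le> y / \<delta>" using y0 by (rule of_nat_floor)
      finally show ?thesis using pos by (simp add: field_simps)
    qed
    moreover have "y \<le> real (Suc l) * \<delta>"
    proof (cases "k \<le> nat \<lfloor>y / \<delta>\<rfloor>")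
      case True
      then have "l = k" by (simp add: l_def)
      then show ?thesis using y that k by simp
    next
      case False
      then have "real (Suc l) = real (nat \<lfloor>y / \<delta>\<rfloor>) + 1" by (simp add: l_def)
      moreover have "y / \<delta> \<le> real (nat \<lfloor>y / \<delta>\<rfloor>) + 1" using y0 by linarith
      ultimately have "y / \<delta> \<le> real (Suc l)" by simp
      then show ?thesis using pos by (simp add: field_simps)
    qed
    ultimately have "0 \<le> w y" using steps[of l y] by linarith
    then show "\<exists>d. (W has_real_derivative d) (at y) \<and> 0 \<le> d" using W by blast
  qed
  have one: "\<bar>driver (real (Suc l) * \<delta>) - driver (real l * \<delta>) - ?d l\<bar> \<le> W (real (Suc l) * \<delta>) - W (real l * \<delta>)"
    if "l < m" for l
  proof -
    have "\<bar>(LINT s:{0..real (Suc l) * \<delta>}|lborel. f s) - (LINT s:{0..real l * \<delta>}|lborel. f s) - (real (Suc l) * \<delta> - real l * \<delta>) * c l\<bar>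
        \<le> W (real (Suc l) * \<delta>) - W (real l * \<delta>)"
      by (rule drift_increment[OF integrable t, where w = w and W = W])
         (use steps[OF that] pos W w in \<open>auto simp: distrib_right intro: continuous_on_subset\<close>)
    then show ?thesis unfolding driver_def by (simp add: Sucl algebra_simps)
  qed
  have sums: "\<bar>driver (real q * \<delta>) - driver (real p * \<delta>) - (\<Sum>i\<in>{p..<q}. ?d i)\<bar> \<le> W (real q * \<delta>) - W (real p * \<delta>)"
    if "p \<le> q" "q \<le> m" for p q
    using that
  proof (induction q rule: dec_induct)
    case (step q)
    then have "\<bar>driver (real q * \<delta>) - driver (real p * \<delta>) - (\<Sum>i\<in>{p..<q}. ?d i)\<bar> \<le> W (real q * \<delta>) - W (real p * \<delta>)"
      and "\<bar>driver (real (Suc q) * \<delta>) - driver (real q * \<delta>) - ?d q\<bar> \<le> W (real (Suc q) * \<delta>) - W (real q * \<delta>)"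
      using one[of q] by auto
    moreover have "(\<Sum>i\<in>{p..<Suc q}. ?d i) = (\<Sum>i\<in>{p..<q}. ?d i) + ?d q" using step by simp
    ultimately show ?case by linarith
  qed simp
  have s0: "0 \<le> s" using k t[of k] by linarith
  have "\<bar>x (?\<tau> (Suc k)) - scheme z ?d' (Suc k)\<bar> \<le> \<bar>x (?\<tau> 0) - z\<bar> + (W s - W 0 + ?e) + ?e"
  proof (rule reflected_path_scheme[OF skorokhod path_driver mono])
    show "\<bar>driver (?\<tau> q) - driver (?\<tau> p) - (\<Sum>i\<in>{p..<q}. ?d' i)\<bar> \<le> W s - W 0 + ?e" if pq: "p \<le> q" "q \<le> Suc k" for p q
    proof (cases "q \<le> k")
      case True
      have "(\<Sum>i\<in>{p..<q}. ?d' i) = (\<Sum>i\<in>{p..<q}. ?d i)" using True by (intro sum.cong) auto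
      moreover have "real q * \<delta> \<le> s" using True k(2) pos by (meson less_imp_le mult_right_mono of_nat_le_iff order_trans)
      then have "W (real q * \<delta>) \<le> W s" using t s0 by (intro Wmono) auto
      moreover have "real p * \<delta> \<le> s" using \<open>real q * \<delta> \<le> s\<close> pq pos by (meson less_imp_le mult_right_mono of_nat_le_iff order_trans)
      then have "W 0 \<le> W (real p * \<delta>)" using t s0 by (intro Wmono) auto
      moreover have "\<bar>driver (real q * \<delta>) - driver (real p * \<delta>) - (\<Sum>i\<in>{p..<q}. ?d i)\<bar> \<le> W (real q * \<delta>) - W (real p * \<delta>)"
        using sums[of p q] pq True k by simp
      ultimately show ?thesis using True pq e by simp
    next
      case False
      then have q: "q = Suc k" using pq by simp
      show ?thesis
      proof (cases "p = q")
        case True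
        then show ?thesis using Wmono[of 0 s] s0 e by simp
      next
        case False
        then have p: "p \<le> k" using pq q by simp
        have "(\<Sum>i\<in>{p..<q}. ?d' i) = (\<Sum>i\<in>{p..<k}. ?d i)"
          unfolding q using p by (subst sum.atLeastLessThan_Suc) (auto intro!: sum.cong)
        moreover have "W (real k * \<delta>) \<le> W s" using t k by (intro Wmono) auto
        moreover have "real p * \<delta> \<le> s" using p k(2) pos by (meson less_imp_le mult_right_mono of_nat_le_iff order_trans)
        then have "W 0 \<le> W (real p * \<delta>)" using t by (intro Wmono) auto
        moreover have "\<bar>driver (real k * \<delta>) - driver (real p * \<delta>) - (\<Sum>i\<in>{p..<k}. ?d i)\<bar> \<le> W (real k * \<delta>) - W (real p * \<delta>)"
          using sums[of p k] p k by simp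
        moreover have "\<bar>driver s - driver (real k * \<delta>)\<bar> \<le> ?e" by (rule driver_increment[OF k(1) order_refl k(2,3)])
        ultimately show ?thesis using p q by simp
      qed
    qed
    show "\<bar>driver (?\<tau> (Suc i)) - driver r\<bar> \<le> ?e" if i: "i < Suc k" "?\<tau> i \<le> r" "r \<le> ?\<tau> (Suc i)" for i r
    proof (cases "i = k")
      case True
      then show ?thesis using i driver_increment[OF k(1) _ _ k(3), of r] by simp
    next
      case False
      then show ?thesis using i k driver_increment[of i r "real (Suc i) * \<delta>"] by (simp add: distrib_right)
    qed
  qed (use z e in auto)
  moreover have "scheme z ?d' (Suc k) = scheme z ?d k"
  proof -
    have "scheme z ?d' k = scheme z ?d k" by (rule scheme_cong) auto
    then show ?thesis using clamp_id[OF scheme_bounds[OF z]] by simp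
  qed
  ultimately show ?thesis by simp
qed

end

definition scheme_mean :: "nat \<Rightarrow> real \<Rightarrow> real \<Rightarrow> nat \<Rightarrow> real \<Rightarrow> (nat \<Rightarrow> real) \<Rightarrow> real" where
  "scheme_mean m \<delta> \<beta> k z c = (\<integral>\<xi>. scheme z (\<lambda>l. \<delta> * c l + \<beta> * \<xi> l) k \<partial>increments_law m \<delta>)"

lemma scheme_increments_measurable:
  assumes "k \<le> m"
  shows "(\<lambda>\<xi>. scheme z (\<lambda>l. \<delta> * c l + \<beta> * \<xi> l) k) \<in> borel_measurable (increments_law m \<delta>)"
proof (rule borel_measurable_scheme)
  fix l assume "l < k"
  then have "(\<lambda>\<xi>. \<xi> l) \<in> borel_measurable (increments_law m \<delta>)"
    unfolding increments_law_def using assms measurable_component_singleton[of l "{..<m}" "\<lambda>_. gaussian \<delta>"]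
    by (simp cong: measurable_cong_sets)
  then show "(\<lambda>\<xi>. \<delta> * c l + \<beta> * \<xi> l) \<in> borel_measurable (increments_law m \<delta>)" by simp
qed simp

lemma scheme_mean_lipschitz:
  assumes "\<delta> > 0" "k \<le> m" "\<bar>z\<bar> \<le> 1" "\<bar>z'\<bar> \<le> 1"
  shows "\<bar>scheme_mean m \<delta> \<beta> k z c - scheme_mean m \<delta> \<beta> k z' c'\<bar> \<le> \<bar>z - z'\<bar> + \<delta> * (\<Sum>l<k. \<bar>c l - c' l\<bar>)"
proof -
  interpret prob_space "increments_law m \<delta>" by (rule prob_space_increments_law) fact
  have int: "integrable (increments_law m \<delta>) (\<lambda>\<xi>. scheme z (\<lambda>l. \<delta> * c l + \<beta> * \<xi> l) k)" if "\<bar>z\<bar> \<le> 1" for z c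
    using scheme_increments_measurable[OF assms(2)] scheme_bounds[OF that] by (intro integrable_const_bound[of _ 1]) auto
  let ?D = "\<lambda>\<xi>. scheme z (\<lambda>l. \<delta> * c l + \<beta> * \<xi> l) k - scheme z' (\<lambda>l. \<delta> * c' l + \<beta> * \<xi> l) k"
  have "\<bar>?D \<xi>\<bar> \<le> \<bar>z - z'\<bar> + \<delta> * (\<Sum>l<k. \<bar>c l - c' l\<bar>)" for \<xi>
  proof -
    have "\<bar>?D \<xi>\<bar> \<le> \<bar>z - z'\<bar> + (\<Sum>l<k. \<bar>(\<delta> * c l + \<beta> * \<xi> l) - (\<delta> * c' l + \<beta> * \<xi> l)\<bar>)"
      by (rule scheme_lipschitz)
    also have "\<dots> = \<bar>z - z'\<bar> + \<delta> * (\<Sum>l<k. \<bar>c l - c' l\<bar>)"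
      using assms(1) by (simp add: right_diff_distrib[symmetric] abs_mult sum_distrib_left)
    finally show ?thesis .
  qed
  then have "(\<integral>\<xi>. \<bar>?D \<xi>\<bar> \<partial>increments_law m \<delta>) \<le> (\<integral>\<xi>. \<bar>z - z'\<bar> + \<delta> * (\<Sum>l<k. \<bar>c l - c' l\<bar>) \<partial>increments_law m \<delta>)"
    using int assms by (intro integral_mono) auto
  moreover have "\<bar>\<integral>\<xi>. ?D \<xi> \<partial>increments_law m \<delta>\<bar> \<le> (\<integral>\<xi>. \<bar>?D \<xi>\<bar> \<partial>increments_law m \<delta>)" by (rule integral_abs_bound)
  ultimately show ?thesis unfolding scheme_mean_def using int assms prob_space by simp
qed

section \<open>The limiting equation\<close>

locale cut_lipschitz =
  fixes \<phi> :: "(real \<times> real \<Rightarrow> real) \<Rightarrow> real \<times> real \<Rightarrow> real" and \<kappa> :: real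
  assumes Linfty: "V \<in> kernels \<Longrightarrow> \<phi> V \<in> Linfty_sym" and \<kappa>_nonneg: "\<kappa> \<ge> 0"
    and lipschitz: "AE p in unit_square. \<forall>U\<in>kernels. \<forall>V\<in>kernels. \<bar>\<phi> U p - \<phi> V p\<bar> \<le> \<kappa> * cut_norm (U - V)"
begin

lemma \<phi>_measurable: "V \<in> kernels \<Longrightarrow> \<phi> V \<in> borel_measurable unit_square"
  using Linfty by (auto simp: Linfty_sym_def)

lemma \<phi>_bounded: "\<exists>C. AE p in unit_square. \<forall>V\<in>kernels. \<bar>\<phi> V p\<bar> \<le> C"
proof -
  have zero: "(\<lambda>_. 0) \<in> kernels" by (simp add: kernels_def)
  from Linfty[OF zero] obtain C where C: "\<And>p. p \<in> {0..1} \<times> {0..1} \<Longrightarrow> \<bar>\<phi> (\<lambda>_. 0) p\<bar> \<le> C"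
    unfolding Linfty_sym_def by blast
  have "AE p in unit_square. p \<in> {0..1} \<times> {0..1}" by (rule AE_I2) simp
  with lipschitz have "AE p in unit_square. \<forall>V\<in>kernels. \<bar>\<phi> V p\<bar> \<le> C + \<kappa> * 2"
  proof eventually_elim
    case (elim p)
    show ?case
    proof
      fix V assume V: "V \<in> kernels"
      have "\<bar>\<phi> V p - \<phi> (\<lambda>_. 0) p\<bar> \<le> \<kappa> * cut_norm (V - (\<lambda>_. 0))" using elim(1) V zero by blast
      also have "\<dots> \<le> \<kappa> * 2" by (intro mult_left_mono cut_norm_diff_le_2 V zero \<kappa>_nonneg)
      finally show "\<bar>\<phi> V p\<bar> \<le> C + \<kappa> * 2" using C[OF elim(2)] by linarith
    qed
  qed
  then show ?thesis by blast
qed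

definition \<phi>_bound :: real where
  "\<phi>_bound = (SOME C. AE p in unit_square. \<forall>V\<in>kernels. \<bar>\<phi> V p\<bar> \<le> C)"

lemma AE_\<phi>_bound: "AE p in unit_square. \<forall>V\<in>kernels. \<bar>\<phi> V p\<bar> \<le> \<phi>_bound"
  unfolding \<phi>_bound_def using \<phi>_bounded by (rule someI_ex)

end

lemma (in prob_space) expectation_abs_le_off_event:
  fixes Y :: "'a \<Rightarrow> real"
  assumes Y: "Y \<in> borel_measurable M" "AE \<omega> in M. \<bar>Y \<omega>\<bar> \<le> 2"
    and R: "R \<in> events" and c: "AE \<omega> in M. \<omega> \<notin> R \<longrightarrow> \<bar>Y \<omega>\<bar> \<le> c" "c \<ge> 0"
  shows "expectation (\<lambda>\<omega>. \<bar>Y \<omega>\<bar>) \<le> c + 2 * prob R"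
proof -
  have "expectation (\<lambda>\<omega>. \<bar>Y \<omega>\<bar>) \<le> expectation (\<lambda>\<omega>. c + 2 * indicator R \<omega>)"
  proof (rule integral_mono_AE)
    show "integrable M (\<lambda>\<omega>. \<bar>Y \<omega>\<bar>)" using Y by (intro integrable_const_bound[of _ 2]) auto
    show "integrable M (\<lambda>\<omega>. c + 2 * indicator R \<omega>)"
      using R by (intro Bochner_Integration.integrable_add integrable_mult_right integrable_real_indicator) (auto simp: emeasure_eq_measure)
    show "AE \<omega> in M. \<bar>Y \<omega>\<bar> \<le> c + 2 * indicator R \<omega>"
      using Y(2) c(1) by eventually_elim (use c(2) in \<open>auto simp: indicator_def\<close>)
  qed
  also have "\<dots> = c + 2 * prob R"
    using R prob_space by (subst Bochner_Integration.integral_add) (auto simp: emeasure_eq_measure)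
  finally show ?thesis .
qed

locale limit_system = cut_lipschitz \<phi> \<kappa>
  for \<phi> :: "(real \<times> real \<Rightarrow> real) \<Rightarrow> real \<times> real \<Rightarrow> real" and \<kappa> :: real +
  fixes N :: "'b measure" and G :: "real \<Rightarrow> 'b measure" and \<beta> :: real and W0 :: "real \<times> real \<Rightarrow> real"
    and U1 U2 :: "'b \<Rightarrow> real" and B X Lp Lm :: "real \<Rightarrow> 'b \<Rightarrow> real" and \<Gamma> :: "real \<Rightarrow> real \<times> real \<Rightarrow> real"
  assumes coupled: "coupled_system N G \<phi> \<beta> W0 U1 U2 B X Lp Lm \<Gamma>"
    and \<beta>_pos: "\<beta> > 0" and W0: "W0 \<in> kernels"
begin

sublocale brownian N G "{()}" "\<lambda>_. B"
  using coupled by unfold_locales (auto simp: coupled_system_def brownian_motion_def)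

definition U :: "'b \<Rightarrow> real \<times> real" where
  "U \<omega> = (U1 \<omega>, U2 \<omega>)"

lemma U_measurable_G: "U \<in> measurable (G 0) unit_square"
  using coupled unfolding U_def[abs_def] coupled_system_def by (intro measurable_Pair) auto

lemma U_measurable [measurable]: "U \<in> measurable N unit_square"
  by (rule F_measurable[OF U_measurable_G])

lemma distr_U: "distr N unit_square U = unit_square"
proof -
  have "indep_var unit_interval U1 unit_interval U2" "distr N unit_interval U1 = unit_interval"
    "distr N unit_interval U2 = unit_interval"
    using coupled by (auto simp: coupled_system_def)
  then show ?thesis unfolding indep_var_distribution_eq U_def[abs_def] by simp
qed

lemma AE_U: "AE p in unit_square. P p \<Longrightarrow> AE \<omega> in N. P (U \<omega>)"
  by (rule AE_distrD[OF U_measurable]) (simp only: distr_U)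

lemma \<Gamma>_kernel: "t \<ge> 0 \<Longrightarrow> \<Gamma> t \<in> kernels"
  using coupled by (simp add: coupled_system_def)

lemma sde: "reflected_sde N G (\<lambda>s \<omega>. - \<phi> (\<Gamma> s) (U \<omega>)) \<beta> (\<lambda>\<omega>. W0 (U \<omega>)) B X Lp Lm"
  using coupled by (simp add: coupled_system_def U_def)

lemma X_measurable: "t \<ge> 0 \<Longrightarrow> X t \<in> borel_measurable N"
  using sde F_measurable by (auto simp: reflected_sde_def skorokhod_problem_def)

definition regular :: "'b \<Rightarrow> bool" where
  "regular \<omega> \<longleftrightarrow> skorokhod_paths (\<lambda>t. X t \<omega>) (\<lambda>t. Lp t \<omega>) (\<lambda>t. Lm t \<omega>) \<and> X 0 \<omega> = W0 (U \<omega>) \<and>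
     (\<forall>t\<ge>0. set_integrable lborel {0..t} (\<lambda>s. - \<phi> (\<Gamma> s) (U \<omega>)) \<and>
       X t \<omega> = X 0 \<omega> + (LINT s:{0..t}|lborel. - \<phi> (\<Gamma> s) (U \<omega>)) + \<beta> * B t \<omega> + Lm t \<omega> - Lp t \<omega>) \<and>
     continuous_on {0..} (\<lambda>t. B t \<omega>) \<and> \<bar>W0 (U \<omega>)\<bar> \<le> 1 \<and>
     (\<forall>V\<in>kernels. \<forall>V'\<in>kernels. \<bar>\<phi> V (U \<omega>) - \<phi> V' (U \<omega>)\<bar> \<le> \<kappa> * cut_norm (V - V')) \<and>
     (\<forall>V\<in>kernels. \<bar>\<phi> V (U \<omega>)\<bar> \<le> \<phi>_bound)"

lemma AE_regular: "AE \<omega> in N. regular \<omega>"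
proof -
  have "AE \<omega> in N. skorokhod_paths (\<lambda>t. X t \<omega>) (\<lambda>t. Lp t \<omega>) (\<lambda>t. Lm t \<omega>)"
    "AE \<omega> in N. X 0 \<omega> = W0 (U \<omega>) \<and> (\<forall>t\<ge>0. set_integrable lborel {0..t} (\<lambda>s. - \<phi> (\<Gamma> s) (U \<omega>)) \<and>
       X t \<omega> = X 0 \<omega> + (LINT s:{0..t}|lborel. - \<phi> (\<Gamma> s) (U \<omega>)) + \<beta> * B t \<omega> + Lm t \<omega> - Lp t \<omega>)"
    using sde unfolding reflected_sde_def skorokhod_problem_def by blast+
  moreover have "AE \<omega> in N. continuous_on {0..} (\<lambda>t. B t \<omega>)" using AE_continuous[of "()"] by auto
  moreover have "AE \<omega> in N. \<bar>W0 (U \<omega>)\<bar> \<le> 1" using kernels_bound[OF W0] by (intro AE_U AE_I2) auto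
  moreover note AE_U[OF lipschitz] AE_U[OF AE_\<phi>_bound]
  ultimately show ?thesis by eventually_elim (simp add: regular_def)
qed

lemma AE_X_bound:
  assumes "t \<ge> 0" shows "AE \<omega> in N. \<bar>X t \<omega>\<bar> \<le> 1"
  using AE_regular
proof eventually_elim
  case (elim \<omega>)
  then have "skorokhod_paths (\<lambda>t. X t \<omega>) (\<lambda>t. Lp t \<omega>) (\<lambda>t. Lm t \<omega>)" by (simp add: regular_def)
  from skorokhod_paths_bound[OF this assms] show ?case .
qed

lemma X_integrable: "t \<ge> 0 \<Longrightarrow> integrable N (X t)"
  using AE_X_bound X_measurable by (intro integrable_const_bound[of _ 1]) auto

lemma integral_\<Gamma>:
  assumes "t \<ge> 0" "A \<in> sets unit_square"
  shows "(LINT p:A|unit_square. \<Gamma> t p) = (\<integral>\<omega>. indicator A (U \<omega>) * X t \<omega> \<partial>N)"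
proof -
  let ?F = "vimage_algebra (space N) U unit_square"
  have U: "U \<in> space N \<rightarrow> space unit_square" using measurable_space[OF U_measurable] by auto
  interpret cond: finite_measure_subalgebra N ?F
  proof
    show "subalgebra N ?F"
      using measurable_sets[OF U_measurable] by (auto simp: subalgebra_def sets_vimage_algebra2[OF U])
  qed
  note [measurable] = assms(2) kernels_measurable[OF \<Gamma>_kernel[OF assms(1)]]
  let ?A = "U -` A \<inter> space N"
  have A: "?A \<in> sets ?F" using assms(2) by (rule in_vimage_algebra)
  have "(LINT p:A|unit_square. \<Gamma> t p) = (\<integral>p. indicator A p * \<Gamma> t p \<partial>distr N unit_square U)"
    unfolding set_lebesgue_integral_def distr_U by simp
  also have "\<dots> = (\<integral>\<omega>. indicator A (U \<omega>) * \<Gamma> t (U \<omega>) \<partial>N)"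
    by (rule integral_distr) measurable
  also have "\<dots> = (\<integral>\<omega>. indicator ?A \<omega> *\<^sub>R real_cond_exp N ?F (X t) \<omega> \<partial>N)"
  proof (rule integral_cong_AE)
    have "AE \<omega> in N. \<Gamma> t (U \<omega>) = real_cond_exp N ?F (X t) \<omega>"
      using coupled assms(1) unfolding coupled_system_def U_def[abs_def] by blast
    then show "AE \<omega> in N. indicator A (U \<omega>) * \<Gamma> t (U \<omega>) = indicator ?A \<omega> *\<^sub>R real_cond_exp N ?F (X t) \<omega>"
      using AE_space by eventually_elim (simp add: indicator_def)
    show "(\<lambda>\<omega>. indicator ?A \<omega> *\<^sub>R real_cond_exp N ?F (X t) \<omega>) \<in> borel_measurable N"
      by measurable
  qed measurable
  also have "\<dots> = (LINT \<omega>:?A|N. X t \<omega>)"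
    using cond.real_cond_exp_intA[OF X_integrable[OF assms(1)] A] by (simp add: set_lebesgue_integral_def)
  also have "\<dots> = (\<integral>\<omega>. indicator A (U \<omega>) * X t \<omega> \<partial>N)"
    unfolding set_lebesgue_integral_def by (intro Bochner_Integration.integral_cong) (auto simp: indicator_def)
  finally show ?thesis .
qed

text \<open>Testing against \<open>1\<^sub>A(U)\<close> for rectangles \<open>A\<close> is how a cut norm becomes an expectation.\<close>

lemma cut_norm_le_expectation:
  assumes Y: "integrable N Y"
    and D: "\<And>A. A \<in> sets unit_square \<Longrightarrow> (LINT p:A|unit_square. D p) = (\<integral>\<omega>. indicator A (U \<omega>) * Y \<omega> \<partial>N)"
  shows "cut_norm D \<le> expectation (\<lambda>\<omega>. \<bar>Y \<omega>\<bar>)"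
proof (rule cut_norm_least)
  fix S T assume "S \<in> sets unit_interval" "T \<in> sets unit_interval"
  then have A: "S \<times> T \<in> sets unit_square" by (rule pair_measureI)
  note [measurable] = A
  have "integrable N (\<lambda>\<omega>. indicator (S \<times> T) (U \<omega>) * Y \<omega>)"
    by (rule Bochner_Integration.integrable_bound[OF Y]) (use Y in \<open>auto simp: indicator_def\<close>)
  moreover have "\<bar>LINT p:(S \<times> T)|unit_square. D p\<bar> \<le> (\<integral>\<omega>. \<bar>indicator (S \<times> T) (U \<omega>) * Y \<omega>\<bar> \<partial>N)"
    unfolding D[OF A] by (rule integral_abs_bound)
  ultimately show "\<bar>LINT p:(S \<times> T)|unit_square. D p\<bar> \<le> expectation (\<lambda>\<omega>. \<bar>Y \<omega>\<bar>)"
    using Y by (elim order_trans) (intro integral_mono integrable_abs, auto simp: indicator_def)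
qed

definition \<Gamma>_scheme :: "nat \<Rightarrow> real \<Rightarrow> nat \<Rightarrow> real \<times> real \<Rightarrow> real" where
  "\<Gamma>_scheme m \<delta> k p = scheme_mean m \<delta> \<beta> k (W0 p) (\<lambda>l. - \<phi> (\<Gamma> (real l * \<delta>)) p)"

definition X_scheme :: "real \<Rightarrow> nat \<Rightarrow> 'b \<Rightarrow> real" where
  "X_scheme \<delta> k \<omega> = scheme (W0 (U \<omega>)) (\<lambda>l. \<delta> * - \<phi> (\<Gamma> (real l * \<delta>)) (U \<omega>) + \<beta> * (B (real (Suc l) * \<delta>) \<omega> - B (real l * \<delta>) \<omega>)) k"

lemma X_scheme_measurable: "\<delta> > 0 \<Longrightarrow> X_scheme \<delta> k \<in> borel_measurable N"
  unfolding X_scheme_def[abs_def]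
proof (rule borel_measurable_scheme)
  assume \<delta>: "\<delta> > 0"
  show "(\<lambda>\<omega>. W0 (U \<omega>)) \<in> borel_measurable N"
    by (rule measurable_compose[OF U_measurable kernels_measurable[OF W0]])
  fix l assume "l < k"
  have "(\<lambda>\<omega>. \<phi> (\<Gamma> (real l * \<delta>)) (U \<omega>)) \<in> borel_measurable N"
    using \<delta> by (intro measurable_compose[OF U_measurable \<phi>_measurable] \<Gamma>_kernel) simp
  moreover have "B (real q * \<delta>) \<in> borel_measurable N" for q
    using \<delta> by (intro B_measurable[of "()"]) auto
  ultimately show "(\<lambda>\<omega>. \<delta> * - \<phi> (\<Gamma> (real l * \<delta>)) (U \<omega>) + \<beta> * (B (real (Suc l) * \<delta>) \<omega> - B (real l * \<delta>) \<omega>)) \<in> borel_measurable N"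
    by (intro borel_measurable_add borel_measurable_times borel_measurable_uminus borel_measurable_diff borel_measurable_const)
qed

lemma AE_X_scheme_bound: "AE \<omega> in N. \<bar>X_scheme \<delta> k \<omega>\<bar> \<le> 1"
  using AE_regular by eventually_elim (simp add: X_scheme_def scheme_bounds regular_def)

lemma
  assumes \<delta>: "\<delta> > 0" and "k \<le> m"
  shows \<Gamma>_scheme_integrable: "integrable unit_square (\<Gamma>_scheme m \<delta> k)"
    and integral_\<Gamma>_scheme: "A \<in> sets unit_square \<Longrightarrow>
      (LINT p:A|unit_square. \<Gamma>_scheme m \<delta> k p) = (\<integral>\<omega>. indicator A (U \<omega>) * X_scheme \<delta> k \<omega> \<partial>N)"
proof -
  let ?P = "\<Pi>\<^sub>M l\<in>{..<m}. (borel :: real measure)" and ?\<nu> = "increments_law m \<delta>"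
  let ?S = "\<lambda>(p, \<xi>). scheme (W0 p) (\<lambda>l. \<delta> * - \<phi> (\<Gamma> (real l * \<delta>)) p + \<beta> * \<xi> l) k"
  interpret \<nu>: prob_space ?\<nu> by (rule prob_space_increments_law[OF \<delta>])
  interpret pair: pair_prob_space unit_square ?\<nu> ..
  have S [measurable]: "?S \<in> borel_measurable (unit_square \<Otimes>\<^sub>M ?P)"
    unfolding case_prod_unfold
  proof (rule borel_measurable_scheme)
    show "(\<lambda>q. W0 (fst q)) \<in> borel_measurable (unit_square \<Otimes>\<^sub>M ?P)"
      by (rule measurable_compose[OF measurable_fst kernels_measurable[OF W0]])
    fix l assume "l < k"
    have "(\<lambda>q. \<phi> (\<Gamma> (real l * \<delta>)) (fst q)) \<in> borel_measurable (unit_square \<Otimes>\<^sub>M ?P)"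
      using \<delta> by (intro measurable_compose[OF measurable_fst \<phi>_measurable] \<Gamma>_kernel) auto
    moreover have "(\<lambda>q. snd q l) \<in> borel_measurable (unit_square \<Otimes>\<^sub>M ?P)"
      using \<open>l < k\<close> assms(2) by (intro measurable_compose[OF measurable_snd measurable_component_singleton]) auto
    ultimately show "(\<lambda>q. \<delta> * - \<phi> (\<Gamma> (real l * \<delta>)) (fst q) + \<beta> * snd q l) \<in> borel_measurable (unit_square \<Otimes>\<^sub>M ?P)"
      by (intro borel_measurable_add borel_measurable_times borel_measurable_uminus borel_measurable_const)
  qed
  then have S\<nu>: "?S \<in> borel_measurable (unit_square \<Otimes>\<^sub>M ?\<nu>)" by (simp cong: measurable_cong_sets)
  have S_bound: "\<bar>?S q\<bar> \<le> 1" if "q \<in> space (unit_square \<Otimes>\<^sub>M ?\<nu>)" for q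
    using that kernels_bound[OF W0, of "fst q"] by (auto simp: case_prod_unfold space_pair_measure intro!: scheme_bounds)
  have int: "integrable (unit_square \<Otimes>\<^sub>M ?\<nu>) ?S"
    using S\<nu> S_bound by (intro pair.P.integrable_const_bound[of _ 1] AE_I2) auto
  have eq: "\<Gamma>_scheme m \<delta> k p = (\<integral>\<xi>. ?S (p, \<xi>) \<partial>?\<nu>)" for p
    by (simp add: \<Gamma>_scheme_def scheme_mean_def)
  show "integrable unit_square (\<Gamma>_scheme m \<delta> k)"
    unfolding eq[abs_def] by (rule pair.integrable_fst'[OF int])
  assume A: "A \<in> sets unit_square"
  let ?f = "\<lambda>q. indicator A (fst q) * ?S q"
  have Af: "(\<lambda>q. indicator A (fst q) :: real) \<in> borel_measurable (unit_square \<Otimes>\<^sub>M ?P)"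
    using A by (intro measurable_compose[OF measurable_fst]) auto
  have f: "?f \<in> borel_measurable (unit_square \<Otimes>\<^sub>M ?P)"
    using Af S by (rule borel_measurable_times)
  then have f\<nu>: "?f \<in> borel_measurable (unit_square \<Otimes>\<^sub>M ?\<nu>)" by (simp cong: measurable_cong_sets)
  have fint: "integrable (unit_square \<Otimes>\<^sub>M ?\<nu>) ?f"
    by (rule Bochner_Integration.integrable_bound[OF int f\<nu>]) (auto simp: indicator_def)
  let ?\<xi> = "\<lambda>\<omega>. \<lambda>l\<in>{..<m}. increment \<delta> B l \<omega>"
  have \<xi>: "(\<lambda>\<omega>. (U \<omega>, ?\<xi> \<omega>)) \<in> measurable N (unit_square \<Otimes>\<^sub>M ?P)"
    using increments_measurable[OF \<delta>, of "()"] by (intro measurable_Pair U_measurable) auto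
  have "(LINT p:A|unit_square. \<Gamma>_scheme m \<delta> k p) = (\<integral>p. (\<integral>\<xi>. ?f (p, \<xi>) \<partial>?\<nu>) \<partial>unit_square)"
    unfolding set_lebesgue_integral_def eq by simp
  also have "\<dots> = integral\<^sup>L (unit_square \<Otimes>\<^sub>M ?\<nu>) ?f" by (rule pair.integral_fst'[OF fint])
  also have "unit_square \<Otimes>\<^sub>M ?\<nu> = distr N (unit_square \<Otimes>\<^sub>M ?P) (\<lambda>\<omega>. (U \<omega>, ?\<xi> \<omega>))"
    using distr_pair_increments[OF \<delta> _ U_measurable_G, of "()" m] by (simp add: distr_U)
  also have "integral\<^sup>L \<dots> ?f = (\<integral>\<omega>. ?f (U \<omega>, ?\<xi> \<omega>) \<partial>N)"
    by (rule integral_distr[OF \<xi> f])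
  also have "\<dots> = (\<integral>\<omega>. indicator A (U \<omega>) * X_scheme \<delta> k \<omega> \<partial>N)"
  proof -
    have "?S (U \<omega>, ?\<xi> \<omega>) = X_scheme \<delta> k \<omega>" for \<omega>
      unfolding X_scheme_def split using assms(2) by (intro scheme_cong) (simp add: increment_def)
    then show ?thesis by simp
  qed
  finally show "(LINT p:A|unit_square. \<Gamma>_scheme m \<delta> k p) = (\<integral>\<omega>. indicator A (U \<omega>) * X_scheme \<delta> k \<omega> \<partial>N)" .
qed

lemma reflected_path:
  assumes "regular \<omega>" "T > 0" "\<eta> > 0" "m \<ge> 1" "\<not> rough T m \<eta> (\<lambda>t. B t \<omega>)"
  shows "reflected_path (\<lambda>t. X t \<omega>) (\<lambda>t. Lp t \<omega>) (\<lambda>t. Lm t \<omega>) (\<lambda>s. - \<phi> (\<Gamma> s) (U \<omega>)) (\<lambda>t. B t \<omega>) \<beta> \<phi>_bound \<eta> (T / real m) m"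
proof
  have cont: "continuous_on {0..} (\<lambda>t. B t \<omega>)" using assms(1) by (simp add: regular_def)
  show "\<bar>B r \<omega> - B (real k * (T / real m)) \<omega>\<bar> \<le> \<eta>"
    if "k < m" "real k * (T / real m) \<le> r" "r \<le> real (Suc k) * (T / real m)" for k r
    using not_rough_bound[OF cont assms(2,5) that] .
qed (use assms \<beta>_pos \<Gamma>_kernel in \<open>auto simp: regular_def\<close>)

lemma discretisation:
  assumes T: "T > 0" and \<eta>: "\<eta> > 0" and m: "m \<ge> 1" and k: "k < m"
  defines "\<delta> \<equiv> T / real m"
  defines "e \<equiv> 2 * (\<phi>_bound * \<delta> + 2 * (\<beta> * \<eta>)) + 2 * enn2real (rough_prob T m \<eta>)"
  shows "real k * \<delta> \<le> s \<Longrightarrow> s \<le> real (Suc k) * \<delta> \<Longrightarrow> cut_norm (\<Gamma> s - \<Gamma> (real k * \<delta>)) \<le> e"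
    and "cut_norm (\<Gamma> (real k * \<delta>) - \<Gamma>_scheme m \<delta> k) \<le> (\<kappa> * T + 1) * e"
proof -
  let ?R = "{\<omega> \<in> space N. rough T m \<eta> (\<lambda>t. B t \<omega>)}"
  have R: "?R \<in> events" by (rule rough_event[OF T m]) simp
  have prob_R: "prob ?R = enn2real (rough_prob T m \<eta>)"
    using emeasure_rough[OF T m, of "()"] by (simp add: measure_def)
  have \<delta>: "\<delta> > 0" using T m by (simp add: \<delta>_def)
  have t: "0 \<le> real l * \<delta>" for l using \<delta> by simp
  have \<phi>_bound: "\<phi>_bound \<ge> 0"
  proof -
    have "AE \<omega> in N. \<phi>_bound \<ge> 0"
      using AE_regular
    proof eventually_elim
      case (elim \<omega>)
      have "\<bar>\<phi> (\<Gamma> 0) (U \<omega>)\<bar> \<le> \<phi>_bound" using elim \<Gamma>_kernel[of 0] by (simp add: regular_def)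
      then show ?case by linarith
    qed
    then show ?thesis by simp
  qed
  have e: "2 * (\<phi>_bound * \<delta> + 2 * (\<beta> * \<eta>)) \<ge> 0" using \<phi>_bound \<delta> \<eta> \<beta>_pos by simp
  then have e0: "e \<ge> 0" by (simp add: e_def)
  have modulus: "cut_norm (\<Gamma> s - \<Gamma> (real l * \<delta>)) \<le> e" if l: "l < m" "real l * \<delta> \<le> s" "s \<le> real (Suc l) * \<delta>" for l s
  proof -
    let ?Y = "\<lambda>\<omega>. X s \<omega> - X (real l * \<delta>) \<omega>"
    have s: "0 \<le> s" using l t[of l] by linarith
    have Y: "integrable N ?Y" using s t by (intro Bochner_Integration.integrable_diff X_integrable)
    have "cut_norm (\<Gamma> s - \<Gamma> (real l * \<delta>)) \<le> expectation (\<lambda>\<omega>. \<bar>?Y \<omega>\<bar>)"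
    proof (rule cut_norm_le_expectation[OF Y])
      fix A assume A: "A \<in> sets unit_square"
      note [measurable] = A
      have int\<Gamma>: "set_integrable unit_square A (\<Gamma> r)" if "r \<ge> 0" for r
        unfolding set_integrable_def using \<Gamma>_kernel[OF that] A by (intro integrable_mult_indicator) auto
      have intX: "integrable N (\<lambda>\<omega>. indicator A (U \<omega>) * X r \<omega>)" if "r \<ge> 0" for r
        by (rule Bochner_Integration.integrable_bound[OF X_integrable[OF that]])
           (use X_measurable[OF that] in \<open>auto simp: indicator_def\<close>)
      show "(LINT p:A|unit_square. (\<Gamma> s - \<Gamma> (real l * \<delta>)) p) = (\<integral>\<omega>. indicator A (U \<omega>) * ?Y \<omega> \<partial>N)"
        using intX[OF s] intX[OF t] set_integral_diff(2)[OF int\<Gamma>[OF s] int\<Gamma>[OF t]]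
        by (simp add: fun_diff_def right_diff_distrib integral_\<Gamma>[OF s A] integral_\<Gamma>[OF t A])
    qed
    also have "\<dots> \<le> e" unfolding e_def prob_R[symmetric]
    proof (rule expectation_abs_le_off_event[OF _ _ R _ e])
      show "AE \<omega> in N. \<bar>?Y \<omega>\<bar> \<le> 2" using AE_X_bound[OF s] AE_X_bound[OF t[of l]] by eventually_elim linarith
      show "AE \<omega> in N. \<omega> \<notin> ?R \<longrightarrow> \<bar>?Y \<omega>\<bar> \<le> 2 * (\<phi>_bound * \<delta> + 2 * (\<beta> * \<eta>))"
        using AE_regular AE_space
      proof eventually_elim
        case (elim \<omega>)
        show ?case
        proof
          assume "\<omega> \<notin> ?R"
          then interpret reflected_path "\<lambda>t. X t \<omega>" "\<lambda>t. Lp t \<omega>" "\<lambda>t. Lm t \<omega>" "\<lambda>s. - \<phi> (\<Gamma> s) (U \<omega>)" "\<lambda>t. B t \<omega>" \<beta> \<phi>_bound \<eta> \<delta> m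
            unfolding \<delta>_def using elim by (intro reflected_path T \<eta> m) auto
          show "\<bar>?Y \<omega>\<bar> \<le> 2 * (\<phi>_bound * \<delta> + 2 * (\<beta> * \<eta>))" by (rule path_modulus[OF l])
        qed
      qed
    qed (use Y in auto)
    finally show ?thesis .
  qed
  show "cut_norm (\<Gamma> s - \<Gamma> (real k * \<delta>)) \<le> e" if "real k * \<delta> \<le> s" "s \<le> real (Suc k) * \<delta>"
    by (rule modulus[OF k that])
  let ?Y = "\<lambda>\<omega>. X (real k * \<delta>) \<omega> - X_scheme \<delta> k \<omega>"
  have int: "integrable N (X_scheme \<delta> k)"
    using AE_X_scheme_bound X_scheme_measurable[OF \<delta>] by (intro integrable_const_bound[of _ 1]) auto
  have Y: "integrable N ?Y" using t int by (intro Bochner_Integration.integrable_diff X_integrable)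
  have "cut_norm (\<Gamma> (real k * \<delta>) - \<Gamma>_scheme m \<delta> k) \<le> expectation (\<lambda>\<omega>. \<bar>?Y \<omega>\<bar>)"
  proof (rule cut_norm_le_expectation[OF Y])
    fix A assume A: "A \<in> sets unit_square"
    note [measurable] = A
    have int\<Gamma>: "set_integrable unit_square A (\<Gamma> (real k * \<delta>))" "set_integrable unit_square A (\<Gamma>_scheme m \<delta> k)"
      unfolding set_integrable_def
      using integrable_mult_indicator[OF A kernels_integrable[OF \<Gamma>_kernel[OF t]]]
        integrable_mult_indicator[OF A \<Gamma>_scheme_integrable[OF \<delta>, of k m]] k
      by simp_all
    have intX: "integrable N (\<lambda>\<omega>. indicator A (U \<omega>) * Z \<omega>)" if "integrable N Z" for Z :: "'b \<Rightarrow> real"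
      by (rule Bochner_Integration.integrable_bound[OF that]) (use that in \<open>auto simp: indicator_def\<close>)
    show "(LINT p:A|unit_square. (\<Gamma> (real k * \<delta>) - \<Gamma>_scheme m \<delta> k) p) = (\<integral>\<omega>. indicator A (U \<omega>) * ?Y \<omega> \<partial>N)"
      using intX[OF X_integrable[OF t]] intX[OF int] set_integral_diff(2)[OF int\<Gamma>] k
      by (simp add: fun_diff_def right_diff_distrib integral_\<Gamma>[OF t A] integral_\<Gamma>_scheme[OF \<delta> _ A])
  qed
  also have "\<dots> \<le> (\<kappa> * T * e + 2 * (\<phi>_bound * \<delta> + 2 * (\<beta> * \<eta>))) + 2 * prob ?R"
  proof (rule expectation_abs_le_off_event[OF _ _ R])
    show "AE \<omega> in N. \<bar>?Y \<omega>\<bar> \<le> 2" using AE_X_bound[OF t[of k]] AE_X_scheme_bound[of \<delta> k] by eventually_elim linarith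
    show "0 \<le> \<kappa> * T * e + 2 * (\<phi>_bound * \<delta> + 2 * (\<beta> * \<eta>))" using e e0 \<kappa>_nonneg T by simp
    show "AE \<omega> in N. \<omega> \<notin> ?R \<longrightarrow> \<bar>?Y \<omega>\<bar> \<le> \<kappa> * T * e + 2 * (\<phi>_bound * \<delta> + 2 * (\<beta> * \<eta>))"
      using AE_regular AE_space
    proof eventually_elim
      case (elim \<omega>)
      show ?case
      proof
        assume "\<omega> \<notin> ?R"
        then interpret reflected_path "\<lambda>t. X t \<omega>" "\<lambda>t. Lp t \<omega>" "\<lambda>t. Lm t \<omega>" "\<lambda>s. - \<phi> (\<Gamma> s) (U \<omega>)" "\<lambda>t. B t \<omega>" \<beta> \<phi>_bound \<eta> \<delta> m
          unfolding \<delta>_def using elim by (intro reflected_path T \<eta> m) auto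
        have *: "\<bar>- \<phi> (\<Gamma> r) (U \<omega>) - - \<phi> (\<Gamma> (real l * \<delta>)) (U \<omega>)\<bar> \<le> \<kappa> * e"
          if "l < m" "real l * \<delta> \<le> r" "r \<le> real (Suc l) * \<delta>" for l r
        proof -
          have "r \<ge> 0" using that t[of l] by linarith
          then have "\<bar>\<phi> (\<Gamma> r) (U \<omega>) - \<phi> (\<Gamma> (real l * \<delta>)) (U \<omega>)\<bar> \<le> \<kappa> * cut_norm (\<Gamma> r - \<Gamma> (real l * \<delta>))"
            using elim(1) \<Gamma>_kernel t[of l] by (simp add: regular_def)
          also have "\<dots> \<le> \<kappa> * e" by (intro mult_left_mono modulus that \<kappa>_nonneg)
          finally show ?thesis by linarith
        qed
        have "\<bar>X (real k * \<delta>) \<omega> - X_scheme \<delta> k \<omega>\<bar> \<le>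
            \<bar>X 0 \<omega> - W0 (U \<omega>)\<bar> + (\<kappa> * e * (real k * \<delta>) - \<kappa> * e * 0) + 2 * (\<phi>_bound * \<delta> + 2 * (\<beta> * \<eta>))"
          unfolding X_scheme_def
          by (rule path_scheme[where c = "\<lambda>l. - \<phi> (\<Gamma> (real l * \<delta>)) (U \<omega>)" and w = "\<lambda>_. \<kappa> * e" and W = "\<lambda>r. \<kappa> * e * r", OF * _ _ k])
             (use elim \<delta> in \<open>auto intro!: derivative_eq_intros mult_right_mono simp: regular_def\<close>)
        also have "\<dots> \<le> \<kappa> * T * e + 2 * (\<phi>_bound * \<delta> + 2 * (\<beta> * \<eta>))"
        proof -
          have "real k * \<delta> \<le> real m * \<delta>" using k \<delta> by (intro mult_right_mono) auto
          also have "\<dots> = T" using m by (simp add: \<delta>_def)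
          finally have "\<kappa> * e * (real k * \<delta>) \<le> \<kappa> * e * T" using e0 \<kappa>_nonneg by (intro mult_left_mono) auto
          then show ?thesis using elim(1) by (simp add: regular_def mult_ac)
        qed
        finally show "\<bar>?Y \<omega>\<bar> \<le> \<kappa> * T * e + 2 * (\<phi>_bound * \<delta> + 2 * (\<beta> * \<eta>))" .
      qed
    qed
  qed (use Y in auto)
  also have "\<dots> = (\<kappa> * T + 1) * e" unfolding e_def prob_R by (simp add: algebra_simps)
  finally show "cut_norm (\<Gamma> (real k * \<delta>) - \<Gamma>_scheme m \<delta> k) \<le> (\<kappa> * T + 1) * e" .
qed

lemma discretisation_exists:
  assumes T: "T > 0" and "\<epsilon> > 0"
  obtains m \<eta> where "m \<ge> 1" "\<eta> > 0" "\<beta> * \<eta> \<le> \<epsilon>" "\<phi>_bound * (T / real m) \<le> \<epsilon>"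
    "rough_prob T m \<eta> \<le> ennreal \<epsilon>"
    "\<And>k s. k < m \<Longrightarrow> real k * (T / real m) \<le> s \<Longrightarrow> s \<le> real (Suc k) * (T / real m) \<Longrightarrow> cut_norm (\<Gamma> s - \<Gamma> (real k * (T / real m))) \<le> \<epsilon>"
    "\<And>k. k < m \<Longrightarrow> cut_norm (\<Gamma> (real k * (T / real m)) - \<Gamma>_scheme m (T / real m) k) \<le> \<epsilon>"
proof -
  define a where "a = \<epsilon> / (8 * (\<kappa> * T + 1))"
  have \<kappa>T: "\<kappa> * T + 1 \<ge> 1" using \<kappa>_nonneg T by simp
  then have a: "a > 0" using assms by (simp add: a_def)
  have a8: "(\<kappa> * T + 1) * (8 * a) = \<epsilon>" using \<kappa>T by (simp add: a_def field_simps)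
  have a8': "8 * a \<le> \<epsilon>"
    using mult_right_mono[OF \<kappa>T, of "8 * a"] a unfolding a8 by simp
  define \<eta> where "\<eta> = a / \<beta>"
  have \<eta>: "\<eta> > 0" "\<beta> * \<eta> = a" using a \<beta>_pos by (auto simp: \<eta>_def)
  have "(\<lambda>m. \<phi>_bound * (T / real m)) \<longlonglongrightarrow> \<phi>_bound * 0" by (intro tendsto_mult tendsto_const lim_const_over_n)
  then have "eventually (\<lambda>m. \<phi>_bound * (T / real m) < a) sequentially" using a by (intro order_tendstoD) auto
  moreover have "eventually (\<lambda>m. rough_prob T m \<eta> < ennreal a) sequentially"
    using a rough_prob_tendsto_0[OF T \<eta>(1), of "()"] by (intro order_tendstoD) auto
  ultimately have "eventually (\<lambda>m. \<phi>_bound * (T / real m) < a \<and> rough_prob T m \<eta> < ennreal a \<and> m \<ge> 1) sequentially"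
    using eventually_ge_at_top[of 1] by eventually_elim auto
  then obtain m where m: "\<phi>_bound * (T / real m) < a" "rough_prob T m \<eta> < ennreal a" "m \<ge> 1"
    by (auto simp: eventually_sequentially)
  have "enn2real (rough_prob T m \<eta>) \<le> a" using m(2) a by (intro enn2real_leI) auto
  then have e: "2 * (\<phi>_bound * (T / real m) + 2 * (\<beta> * \<eta>)) + 2 * enn2real (rough_prob T m \<eta>) \<le> 8 * a"
    using m(1) \<eta>(2) by simp
  show ?thesis
  proof (rule that[OF m(3) \<eta>(1)])
    show "\<beta> * \<eta> \<le> \<epsilon>" "\<phi>_bound * (T / real m) \<le> \<epsilon>" using \<eta>(2) m(1) a8' a by linarith+
    show "rough_prob T m \<eta> \<le> ennreal \<epsilon>"
      using less_imp_le[OF m(2)] a8' a by (elim order_trans) (auto intro!: ennreal_leI)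
    fix k assume k: "k < m"
    show "cut_norm (\<Gamma> s - \<Gamma> (real k * (T / real m))) \<le> \<epsilon>"
      if "real k * (T / real m) \<le> s" "s \<le> real (Suc k) * (T / real m)" for s
      using discretisation(1)[OF T \<eta>(1) m(3) k that] e a8' by linarith
    show "cut_norm (\<Gamma> (real k * (T / real m)) - \<Gamma>_scheme m (T / real m) k) \<le> \<epsilon>"
      using discretisation(2)[OF T \<eta>(1) m(3) k] mult_left_mono[OF e, of "\<kappa> * T + 1"] \<kappa>T unfolding a8 by linarith
  qed
qed

end

section \<open>Concentration in cut norm\<close>

definition gram_energy :: "nat \<Rightarrow> (nat \<Rightarrow> nat \<Rightarrow> real) \<Rightarrow> real" where
  "gram_energy n T = (\<Sum>j<n. \<Sum>k<n. (\<Sum>i<n. T i j * T i k)\<^sup>2)"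

text \<open>
  The row and column weights are removed by two applications of Cauchy-Schwarz; the remaining
  Gram entries see only products of distinct matrix entries off the diagonal.
\<close>

lemma bilinear_form_le_gram_energy:
  fixes a b :: "nat \<Rightarrow> real"
  assumes "\<And>i. i < n \<Longrightarrow> \<bar>a i\<bar> \<le> 1" "\<And>i. i < n \<Longrightarrow> \<bar>b i\<bar> \<le> 1"
  shows "(\<Sum>i<n. \<Sum>j<n. T i j * a i * b j) ^ 4 \<le> real n ^ 4 * gram_energy n T"
proof -
  define c where "c = (\<lambda>i. \<Sum>j<n. T i j * b j)"
  define C where "C = (\<lambda>j k. \<Sum>i<n. T i j * T i k)"
  have "(\<Sum>i<n. \<Sum>j<n. T i j * a i * b j) = (\<Sum>i<n. a i * c i)"
    unfolding c_def by (simp add: sum_distrib_left mult_ac)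
  also have "(\<Sum>i<n. a i * c i)\<^sup>2 \<le> (\<Sum>i<n. (a i)\<^sup>2) * (\<Sum>i<n. (c i)\<^sup>2)"
    by (rule Cauchy_Schwarz_ineq_sum)
  also have "\<dots> \<le> real n * (\<Sum>i<n. (c i)\<^sup>2)"
  proof (rule mult_right_mono)
    have "(\<Sum>i<n. (a i)\<^sup>2) \<le> (\<Sum>i<n. 1)" using assms(1) by (intro sum_mono) (simp add: abs_square_le_1)
    then show "(\<Sum>i<n. (a i)\<^sup>2) \<le> real n" by simp
  qed (simp add: sum_nonneg)
  also have "(\<Sum>i<n. (c i)\<^sup>2) = (\<Sum>i<n. \<Sum>j<n. \<Sum>k<n. b j * b k * (T i j * T i k))"
    by (simp add: c_def power2_eq_square sum_product mult_ac)
  also have "\<dots> = (\<Sum>j<n. \<Sum>i<n. \<Sum>k<n. b j * b k * (T i j * T i k))" by (rule sum.swap)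
  also have "\<dots> = (\<Sum>j<n. \<Sum>k<n. \<Sum>i<n. b j * b k * (T i j * T i k))" by (intro sum.cong refl sum.swap)
  also have "\<dots> = (\<Sum>j<n. \<Sum>k<n. b j * b k * C j k)" by (simp add: C_def sum_distrib_left)
  also have "\<dots> \<le> (\<Sum>j<n. \<Sum>k<n. \<bar>C j k\<bar>)"
  proof (intro sum_mono)
    fix j k assume "j \<in> {..<n}" "k \<in> {..<n}"
    then have "\<bar>b j * b k\<bar> \<le> 1" using assms(2) by (simp add: abs_mult mult_le_one)
    then have "\<bar>b j * b k * C j k\<bar> \<le> 1 * \<bar>C j k\<bar>" unfolding abs_mult[of "b j * b k"] by (intro mult_right_mono) auto
    then show "b j * b k * C j k \<le> \<bar>C j k\<bar>" by linarith
  qed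
  finally have square: "(\<Sum>i<n. \<Sum>j<n. T i j * a i * b j)\<^sup>2 \<le> real n * (\<Sum>j<n. \<Sum>k<n. \<bar>C j k\<bar>)"
    by (simp add: mult_left_mono)
  have "(\<Sum>j<n. \<Sum>k<n. \<bar>C j k\<bar>)\<^sup>2 = (\<Sum>(j, k)\<in>{..<n} \<times> {..<n}. 1 * \<bar>C j k\<bar>)\<^sup>2"
    by (simp add: sum.cartesian_product)
  also have "\<dots> \<le> (\<Sum>jk\<in>{..<n} \<times> {..<n}. 1\<^sup>2) * (\<Sum>jk\<in>{..<n} \<times> {..<n}. (case jk of (j, k) \<Rightarrow> \<bar>C j k\<bar>)\<^sup>2)"
    using Cauchy_Schwarz_ineq_sum[of "\<lambda>_. 1" "\<lambda>(j, k). \<bar>C j k\<bar>" "{..<n} \<times> {..<n}"] by (simp add: case_prod_unfold)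
  also have "\<dots> = (real n)\<^sup>2 * gram_energy n T"
    by (simp add: gram_energy_def C_def sum.cartesian_product case_prod_unfold power2_eq_square)
  finally have C: "(\<Sum>j<n. \<Sum>k<n. \<bar>C j k\<bar>)\<^sup>2 \<le> (real n)\<^sup>2 * gram_energy n T" .
  have "(\<Sum>i<n. \<Sum>j<n. T i j * a i * b j) ^ 4 = ((\<Sum>i<n. \<Sum>j<n. T i j * a i * b j)\<^sup>2)\<^sup>2" by simp
  also have "\<dots> \<le> (real n * (\<Sum>j<n. \<Sum>k<n. \<bar>C j k\<bar>))\<^sup>2" by (rule power_mono[OF square]) simp
  also have "\<dots> = (real n)\<^sup>2 * (\<Sum>j<n. \<Sum>k<n. \<bar>C j k\<bar>)\<^sup>2" by (rule power_mult_distrib)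
  also have "\<dots> \<le> (real n)\<^sup>2 * ((real n)\<^sup>2 * gram_energy n T)" by (intro mult_left_mono C) simp
  also have "\<dots> = real n ^ 4 * gram_energy n T" by (simp add: power4_eq_xxxx power2_eq_square mult_ac)
  finally show ?thesis .
qed

lemma bilinear_form_le:
  fixes a b :: "nat \<Rightarrow> real"
  assumes "\<And>i. i < n \<Longrightarrow> \<bar>a i\<bar> \<le> 1" "\<And>i. i < n \<Longrightarrow> \<bar>b i\<bar> \<le> 1"
    and "gram_energy n T \<le> real n ^ 4 * \<epsilon> ^ 4" "\<epsilon> \<ge> 0"
  shows "\<bar>\<Sum>i<n. \<Sum>j<n. T i j * a i * b j\<bar> \<le> (real n)\<^sup>2 * \<epsilon>"
proof -
  let ?s = "\<Sum>i<n. \<Sum>j<n. T i j * a i * b j"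
  have "\<bar>?s\<bar> ^ 4 = ?s ^ 4" by simp
  also have "\<dots> \<le> real n ^ 4 * gram_energy n T" by (rule bilinear_form_le_gram_energy[OF assms(1,2)])
  also have "\<dots> \<le> real n ^ 4 * (real n ^ 4 * \<epsilon> ^ 4)" by (intro mult_left_mono assms(3)) simp
  also have "\<dots> = ((real n)\<^sup>2 * \<epsilon>) ^ 4" by (simp add: power_mult_distrib flip: power_mult power_add)
  finally show ?thesis by (subst (asm) power_mono_iff) (use assms(4) in auto)
qed

lemma cut_norm_K_le:
  assumes "n \<ge> 1"
    and "\<And>a b. (\<And>i. i < n \<Longrightarrow> \<bar>a i\<bar> \<le> 1) \<Longrightarrow> (\<And>i. i < n \<Longrightarrow> \<bar>b i\<bar> \<le> 1) \<Longrightarrow>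
      \<bar>\<Sum>i<n. \<Sum>j<n. A i j * a i * b j\<bar> \<le> (real n)\<^sup>2 * c"
  shows "cut_norm (K n A) \<le> c"
proof (rule cut_norm_least)
  fix S T assume ST: "S \<in> sets unit_interval" "T \<in> sets unit_interval"
  have n: "real n > 0" using assms(1) by simp
  define a b where "a = (\<lambda>i. real n * measure unit_interval (Q n i \<inter> S))"
    and "b = (\<lambda>i. real n * measure unit_interval (Q n i \<inter> T))"
  have weight: "\<bar>real n * measure unit_interval (Q n i \<inter> S')\<bar> \<le> 1" if "i < n" "S' \<in> sets unit_interval" for i S'
  proof -
    have "measure unit_interval (Q n i \<inter> S') \<le> measure unit_interval (Q n i)"
      using that Q_sets by (intro unit_interval.finite_measure_mono) auto
    then show ?thesis using n that by (simp add: measure_Q field_simps)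
  qed
  have "(LINT p:(S \<times> T)|unit_square. K n A p) = (\<integral>p. (\<Sum>i<n. \<Sum>j<n. A i j * indicator ((Q n i \<inter> S) \<times> (Q n j \<inter> T)) p) \<partial>unit_square)"
    unfolding set_lebesgue_integral_def K_indicator real_scaleR_def sum_distrib_left
    by (intro Bochner_Integration.integral_cong sum.cong refl) (auto simp: indicator_def)
  also have "\<dots> = (\<Sum>i<n. \<Sum>j<n. A i j * measure unit_square ((Q n i \<inter> S) \<times> (Q n j \<inter> T)))"
  proof -
    have sets: "(Q n i \<inter> S) \<times> (Q n j \<inter> T) \<in> sets unit_square" if "i < n" "j < n" for i j
      using that ST Q_sets by (intro pair_measureI sets.Int) auto
    have int: "integrable unit_square (\<lambda>p. A i j * indicator ((Q n i \<inter> S) \<times> (Q n j \<inter> T)) p)" if "i < n" "j < n" for i j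
      using sets[OF that] by (intro integrable_mult_right integrable_real_indicator) (auto simp: unit_square.P.emeasure_eq_measure)
    have "(\<integral>p. (\<Sum>i<n. \<Sum>j<n. A i j * indicator ((Q n i \<inter> S) \<times> (Q n j \<inter> T)) p) \<partial>unit_square) =
      (\<Sum>i<n. \<integral>p. (\<Sum>j<n. A i j * indicator ((Q n i \<inter> S) \<times> (Q n j \<inter> T)) p) \<partial>unit_square)"
      by (intro Bochner_Integration.integral_sum Bochner_Integration.integrable_sum int) auto
    also have "\<dots> = (\<Sum>i<n. \<Sum>j<n. \<integral>p. A i j * indicator ((Q n i \<inter> S) \<times> (Q n j \<inter> T)) p \<partial>unit_square)"
      by (intro sum.cong refl Bochner_Integration.integral_sum int) auto
    also have "\<dots> = (\<Sum>i<n. \<Sum>j<n. A i j * measure unit_square ((Q n i \<inter> S) \<times> (Q n j \<inter> T)))"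
      using sets.sets_into_space[OF sets] by (intro sum.cong refl) (simp add: Int_absorb2)
    finally show ?thesis .
  qed
  also have "\<dots> = (\<Sum>i<n. \<Sum>j<n. A i j * a i * b j) / (real n)\<^sup>2"
    unfolding sum_divide_distrib
  proof (intro sum.cong refl)
    fix i j assume "i \<in> {..<n}" "j \<in> {..<n}"
    then have "Q n i \<inter> S \<in> sets unit_interval" "Q n j \<inter> T \<in> sets unit_interval"
      using ST Q_sets by auto
    then have "measure unit_square ((Q n i \<inter> S) \<times> (Q n j \<inter> T)) = measure unit_interval (Q n i \<inter> S) * measure unit_interval (Q n j \<inter> T)"
      by (simp add: measure_def unit_interval.emeasure_pair_measure_Times enn2real_mult)
    then show "A i j * measure unit_square ((Q n i \<inter> S) \<times> (Q n j \<inter> T)) = A i j * a i * b j / (real n)\<^sup>2"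
      using n by (simp add: a_def b_def power2_eq_square)
  qed
  finally have "\<bar>LINT p:(S \<times> T)|unit_square. K n A p\<bar> = \<bar>\<Sum>i<n. \<Sum>j<n. A i j * a i * b j\<bar> / (real n)\<^sup>2" by simp
  also have "\<dots> \<le> ((real n)\<^sup>2 * c) / (real n)\<^sup>2"
    unfolding a_def b_def by (intro divide_right_mono assms(2) weight ST) auto
  finally show "\<bar>LINT p:(S \<times> T)|unit_square. K n A p\<bar> \<le> c" using n by simp
qed

lemma cut_norm_K_le_gram_energy:
  assumes "n \<ge> 1" "\<epsilon> \<ge> 0" and sym: "\<And>i j. A i j = A j i"
    and "gram_energy n (\<lambda>i j. if i \<le> j then A i j else 0) \<le> real n ^ 4 * \<epsilon> ^ 4"
    and "gram_energy n (\<lambda>i j. if i < j then A i j else 0) \<le> real n ^ 4 * \<epsilon> ^ 4"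
  shows "cut_norm (K n A) \<le> 2 * \<epsilon>"
proof (rule cut_norm_K_le[OF assms(1)])
  fix a b :: "nat \<Rightarrow> real"
  assume a: "\<And>i. i < n \<Longrightarrow> \<bar>a i\<bar> \<le> 1" and b: "\<And>i. i < n \<Longrightarrow> \<bar>b i\<bar> \<le> 1"
  let ?T = "\<lambda>i j. if i \<le> j then A i j else 0" and ?T' = "\<lambda>i j. if i < j then A i j else 0"
  have "(\<Sum>i<n. \<Sum>j<n. A i j * a i * b j) = (\<Sum>i<n. \<Sum>j<n. ?T i j * a i * b j) + (\<Sum>i<n. \<Sum>j<n. ?T' j i * b j * a i)"
    unfolding sum.distrib[symmetric] using sym by (intro sum.cong refl) auto
  also have "(\<Sum>i<n. \<Sum>j<n. ?T' j i * b j * a i) = (\<Sum>j<n. \<Sum>i<n. ?T' j i * b j * a i)" by (rule sum.swap)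
  finally have "(\<Sum>i<n. \<Sum>j<n. A i j * a i * b j) = (\<Sum>i<n. \<Sum>j<n. ?T i j * a i * b j) + (\<Sum>j<n. \<Sum>i<n. ?T' j i * b j * a i)" .
  moreover have "\<bar>\<Sum>i<n. \<Sum>j<n. ?T i j * a i * b j\<bar> \<le> (real n)\<^sup>2 * \<epsilon>"
    by (rule bilinear_form_le[OF a b assms(4,2)])
  moreover have "\<bar>\<Sum>j<n. \<Sum>i<n. ?T' j i * b j * a i\<bar> \<le> (real n)\<^sup>2 * \<epsilon>"
    by (rule bilinear_form_le[OF b a assms(5,2)])
  ultimately show "\<bar>\<Sum>i<n. \<Sum>j<n. A i j * a i * b j\<bar> \<le> (real n)\<^sup>2 * (2 * \<epsilon>)" by (simp add: abs_le_iff)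
qed

context prob_space
begin

lemma
  fixes D :: "nat \<times> nat \<Rightarrow> 'a \<Rightarrow> real"
  assumes indep: "indep_vars (\<lambda>_. borel) D J" and "finite J"
    and bound: "\<And>x \<omega>. x \<in> J \<Longrightarrow> \<bar>D x \<omega>\<bar> \<le> 2" and mean: "\<And>x. x \<in> J \<Longrightarrow> expectation (D x) = 0"
  defines "T \<equiv> \<lambda>\<omega> i j. if (i, j) \<in> J then D (i, j) \<omega> else 0"
  shows gram_energy_integrable: "integrable M (\<lambda>\<omega>. gram_energy n (T \<omega>))"
    and expectation_gram_energy_le: "expectation (\<lambda>\<omega>. gram_energy n (T \<omega>)) \<le> 32 * real n ^ 3"
proof -
  have D: "D x \<in> borel_measurable M" if "x \<in> J" for x
    using indep that by (auto simp: indep_vars_def)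
  have T: "(\<lambda>\<omega>. T \<omega> i j) \<in> borel_measurable M" for i j unfolding T_def using D by (cases "(i, j) \<in> J") simp_all
  have T2: "\<bar>T \<omega> i j\<bar> \<le> 2" for \<omega> i j unfolding T_def using bound by auto
  define P where "P = (\<lambda>j k i i' \<omega>. T \<omega> i j * T \<omega> i k * (T \<omega> i' j * T \<omega> i' k))"
  have gram: "gram_energy n (T \<omega>) = (\<Sum>j<n. \<Sum>k<n. \<Sum>i<n. \<Sum>i'<n. P j k i i' \<omega>)" for \<omega>
    by (simp add: gram_energy_def P_def power2_eq_square sum_product)
  have P16: "\<bar>P j k i i' \<omega>\<bar> \<le> 16" for j k i i' \<omega>
  proof -
    have "\<bar>T \<omega> i j * T \<omega> i k\<bar> \<le> 2 * 2" for i j k unfolding abs_mult by (intro mult_mono T2) auto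
    then have "\<bar>T \<omega> i j * T \<omega> i k * (T \<omega> i' j * T \<omega> i' k)\<bar> \<le> (2 * 2) * (2 * 2)"
      unfolding abs_mult[of "T \<omega> i j * T \<omega> i k"] by (intro mult_mono) auto
    then show ?thesis by (simp add: P_def)
  qed
  have P: "integrable M (P j k i i')" for j k i i'
    using P16 T by (intro integrable_const_bound[of _ 16]) (auto simp: P_def)
  show "integrable M (\<lambda>\<omega>. gram_energy n (T \<omega>))"
    unfolding gram by (intro Bochner_Integration.integrable_sum P)
  have zero: "expectation (P j k i i') = 0" if "j \<noteq> k" "i \<noteq> i'" for j k i i'
  proof (cases "{(i, j), (i, k), (i', j), (i', k)} \<subseteq> J")
    case True
    let ?S = "{(i, j), (i, k), (i', j), (i', k)}"
    have "indep_vars (\<lambda>_. borel) D ?S" using indep True by (rule indep_vars_subset)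
    then have "expectation (\<lambda>\<omega>. \<Prod>x\<in>?S. D x \<omega>) = (\<Prod>x\<in>?S. expectation (D x))"
      using D bound True by (intro indep_vars_lebesgue_integral integrable_const_bound[of _ 2]) auto
    moreover have "(\<Prod>x\<in>?S. D x \<omega>) = P j k i i' \<omega>" for \<omega>
      using that True by (simp add: P_def T_def)
    moreover have "(\<Prod>x\<in>?S. expectation (D x)) = 0" using mean True by (subst prod_zero_iff) auto
    ultimately show ?thesis by simp
  next
    case False
    then have "P j k i i' = (\<lambda>_. 0)" by (auto simp: P_def T_def)
    then show ?thesis by simp
  qed
  have le: "expectation (P j k i i') \<le> 16 * of_bool (j = k) + 16 * of_bool (i = i')" for j k i i'
  proof (cases "j = k \<or> i = i'")
    case True
    have "expectation (P j k i i') \<le> expectation (\<lambda>_. 16)"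
      using P16[of j k i i'] by (intro integral_mono P) (auto simp: abs_le_iff)
    also have "\<dots> = 16" using prob_space by simp
    finally show ?thesis using True by auto
  qed (use zero in auto)
  have "expectation (\<lambda>\<omega>. gram_energy n (T \<omega>)) = (\<Sum>j<n. \<Sum>k<n. \<Sum>i<n. \<Sum>i'<n. expectation (P j k i i'))"
    unfolding gram by (simp add: Bochner_Integration.integral_sum Bochner_Integration.integrable_sum P)
  also have "\<dots> \<le> (\<Sum>j<n. \<Sum>k<n. \<Sum>i<n. \<Sum>i'<n. 16 * of_bool (j = k) + 16 * of_bool (i = i'))"
    by (intro sum_mono le)
  also have "\<dots> = 32 * real n ^ 3"
  proof -
    have diag: "(\<Sum>i'<n. of_bool (i = i')) = (1::real)" if "i < n" for i
      using that by (simp add: of_bool_def)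
    have "(\<Sum>i<n. \<Sum>i'<n. 16 * of_bool (j = k) + 16 * of_bool (i = i')) = 16 * (real n)\<^sup>2 * of_bool (j = k) + 16 * real n" for j k :: nat
    proof -
      have "(\<Sum>i<n. \<Sum>i'<n. 16 * of_bool (j = k) + 16 * of_bool (i = i')) = (\<Sum>i<n. real n * (16 * of_bool (j = k)) + 16 * 1)"
        by (intro sum.cong refl) (simp add: sum.distrib sum_distrib_left[symmetric] diag)
      then show ?thesis by (simp add: power2_eq_square algebra_simps)
    qed
    then have "(\<Sum>j<n. \<Sum>k<n. \<Sum>i<n. \<Sum>i'<n. 16 * of_bool (j = k) + 16 * of_bool (i = i')) =
        (\<Sum>j<n. \<Sum>k<n. 16 * (real n)\<^sup>2 * of_bool (j = k) + 16 * real n)" by simp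
    also have "\<dots> = (\<Sum>j<n. 16 * (real n)\<^sup>2 * 1 + real n * (16 * real n))"
      by (intro sum.cong refl) (simp add: sum.distrib sum_distrib_left[symmetric] diag)
    also have "\<dots> = 32 * real n ^ 3" by (simp add: power2_eq_square power3_eq_cube algebra_simps)
    finally show ?thesis .
  qed
  finally show "expectation (\<lambda>\<omega>. gram_energy n (T \<omega>)) \<le> 32 * real n ^ 3" .
qed

lemma prob_gram_energy_le:
  fixes D :: "nat \<times> nat \<Rightarrow> 'a \<Rightarrow> real"
  assumes indep: "indep_vars (\<lambda>_. borel) D J" and "finite J"
    and bound: "\<And>x \<omega>. x \<in> J \<Longrightarrow> \<bar>D x \<omega>\<bar> \<le> 2" and mean: "\<And>x. x \<in> J \<Longrightarrow> expectation (D x) = 0"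
    and "\<epsilon> > 0" "n \<ge> 1"
  defines "R \<equiv> {\<omega> \<in> space M. real n ^ 4 * \<epsilon> ^ 4 < gram_energy n (\<lambda>i j. if (i, j) \<in> J then D (i, j) \<omega> else 0)}"
  shows "R \<in> events" "emeasure M R \<le> ennreal (32 / \<epsilon> ^ 4 / real n)"
proof -
  let ?Z = "\<lambda>\<omega>. gram_energy n (\<lambda>i j. if (i, j) \<in> J then D (i, j) \<omega> else 0)"
  note Z = gram_energy_integrable[OF assms(1-4), of n] expectation_gram_energy_le[OF assms(1-4), of n]
  show R: "R \<in> events" unfolding R_def using borel_measurable_integrable[OF Z(1)] by measurable
  have n: "real n > 0" using assms by simp
  have nonneg: "?Z \<omega> \<ge> 0" for \<omega> by (simp add: gram_energy_def sum_nonneg)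
  have c: "real n ^ 4 * \<epsilon> ^ 4 > 0" using n assms by simp
  have "(real n ^ 4 * \<epsilon> ^ 4) * prob R \<le> expectation ?Z"
  proof -
    have "(real n ^ 4 * \<epsilon> ^ 4) * prob R = expectation (\<lambda>\<omega>. (real n ^ 4 * \<epsilon> ^ 4) * indicator R \<omega>)"
      using R by simp
    also have "\<dots> \<le> expectation ?Z"
    proof (rule integral_mono)
      show "integrable M (\<lambda>\<omega>. (real n ^ 4 * \<epsilon> ^ 4) * indicator R \<omega>)"
        using R by (intro integrable_mult_right integrable_real_indicator) (auto simp: emeasure_eq_measure)
      show "(real n ^ 4 * \<epsilon> ^ 4) * indicator R \<omega> \<le> ?Z \<omega>" for \<omega>
        using nonneg[of \<omega>] by (auto simp: R_def indicator_def)
    qed (rule Z(1))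
    finally show ?thesis .
  qed
  also have "\<dots> \<le> 32 * real n ^ 3" by (rule Z(2))
  finally have "prob R \<le> 32 * real n ^ 3 / (real n ^ 4 * \<epsilon> ^ 4)" using c by (simp add: field_simps)
  also have "\<dots> = 32 / \<epsilon> ^ 4 / real n" using n by (simp add: power4_eq_xxxx power3_eq_cube)
  finally show "emeasure M R \<le> ennreal (32 / \<epsilon> ^ 4 / real n)"
    unfolding emeasure_eq_measure by (rule ennreal_leI)
qed

end

section \<open>The matrix-valued equation\<close>

abbreviation upper :: "nat \<Rightarrow> (nat \<times> nat) set" where
  "upper n \<equiv> {(i, j). i \<le> j \<and> j < n}"

lemma finite_upper: "finite (upper n)"
  by (rule finite_subset[of _ "{..<n} \<times> {..<n}"]) auto

lemma cube_mats_bound: "A \<in> cube_mats n \<Longrightarrow> \<bar>A i j\<bar> \<le> 1"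
proof (cases "i < n \<and> j < n")
  case True
  assume "A \<in> cube_mats n"
  then have "A i j \<in> {-1..1}" using True unfolding cube_mats_def by blast
  then show ?thesis by auto
next
  case False
  assume "A \<in> cube_mats n"
  then have "A i j = 0" using False unfolding cube_mats_def sym_mats_def by blast
  then show ?thesis by simp
qed

lemma cube_mats_sym: "A \<in> cube_mats n \<Longrightarrow> A i j = A j i"
  by (simp add: cube_mats_def sym_mats_def)

lemma block_average_swap:
  "V \<in> Linfty_sym \<Longrightarrow> i < n \<Longrightarrow> j < n \<Longrightarrow> block_average n V i j = block_average n V j i"
  by (simp add: block_average_def block_integral_swap)

lemma Mat_K:
  assumes "A \<in> sym_mats n" shows "Mat n (K n A) = A"
proof -
  have "inj_on (K n) (sym_mats n)"
  proof (rule inj_onI, intro ext)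
    fix A B i j assume A: "A \<in> sym_mats n" and B: "B \<in> sym_mats n" and eq: "K n A = K n B"
    show "A i j = B i j"
    proof (cases "i < n \<and> j < n")
      case True
      have "real i / real n \<in> Q n i" if "i < n" for i using that by (auto simp: Q_def divide_simps)
      then have "(real i / real n, real j / real n) \<in> block n i j" using True by auto
      then show ?thesis using K_eq[of i n j] True eq by metis
    qed (use A B in \<open>auto simp: sym_mats_def\<close>)
  qed
  then show ?thesis unfolding Mat_def using assms by (rule inv_into_f_f)
qed

locale matrix_system = cut_lipschitz \<phi> \<kappa>
  for \<phi> :: "(real \<times> real \<Rightarrow> real) \<Rightarrow> real \<times> real \<Rightarrow> real" and \<kappa> :: real +
  fixes n :: nat and M :: "'a measure" and F :: "real \<Rightarrow> 'a measure" and R :: "(real \<times> real \<Rightarrow> real) \<Rightarrow> real"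
    and \<beta> :: real and A :: "nat \<Rightarrow> nat \<Rightarrow> real" and B X Lp Lm :: "real \<Rightarrow> 'a \<Rightarrow> nat \<Rightarrow> nat \<Rightarrow> real"
  assumes n: "n \<ge> 1" and frechet: "frechet_like_derivative R \<phi>" and \<beta>_pos: "\<beta> > 0" and A: "A \<in> cube_mats n"
    and sde: "matrix_sde n M F (R \<circ> K n) \<beta> A B X Lp Lm"
begin

sublocale brownian M F "upper n" "\<lambda>(i, j) t \<omega>. B t \<omega> i j"
  using sde finite_upper by unfold_locales (auto simp: matrix_sde_def)

definition regular :: "'a \<Rightarrow> bool" where
  "regular \<omega> \<longleftrightarrow> (\<forall>t\<ge>0. X t \<omega> \<in> cube_mats n) \<and> (\<forall>(i, j)\<in>upper n.
     skorokhod_paths (\<lambda>t. X t \<omega> i j) (\<lambda>t. Lp t \<omega> i j) (\<lambda>t. Lm t \<omega> i j) \<and> X 0 \<omega> i j = A i j \<and>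
     (\<forall>t\<ge>0. set_integrable lborel {0..t} (\<lambda>s. - ((real n)\<^sup>2 * gradient n (R \<circ> K n) (X s \<omega>) i j)) \<and>
       X t \<omega> i j = X 0 \<omega> i j + (LINT s:{0..t}|lborel. - ((real n)\<^sup>2 * gradient n (R \<circ> K n) (X s \<omega>) i j))
         + \<beta> * B t \<omega> i j + Lm t \<omega> i j - Lp t \<omega> i j) \<and>
     continuous_on {0..} (\<lambda>t. B t \<omega> i j))"

lemma AE_regular: "AE \<omega> in M. regular \<omega>"
proof -
  have "AE \<omega> in M. \<forall>t\<ge>0. X t \<omega> \<in> cube_mats n"
    using sde unfolding matrix_sde_def by (auto elim: AE_mp)
  moreover have "AE \<omega> in M. \<forall>ij\<in>upper n. case ij of (i, j) \<Rightarrow>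
     skorokhod_paths (\<lambda>t. X t \<omega> i j) (\<lambda>t. Lp t \<omega> i j) (\<lambda>t. Lm t \<omega> i j) \<and> X 0 \<omega> i j = A i j \<and>
     (\<forall>t\<ge>0. set_integrable lborel {0..t} (\<lambda>s. - ((real n)\<^sup>2 * gradient n (R \<circ> K n) (X s \<omega>) i j)) \<and>
       X t \<omega> i j = X 0 \<omega> i j + (LINT s:{0..t}|lborel. - ((real n)\<^sup>2 * gradient n (R \<circ> K n) (X s \<omega>) i j))
         + \<beta> * B t \<omega> i j + Lm t \<omega> i j - Lp t \<omega> i j) \<and>
     continuous_on {0..} (\<lambda>t. B t \<omega> i j)"
  proof (rule AE_finite_allI[OF finite_upper])
    fix ij assume ij: "ij \<in> upper n"
    obtain i j where [simp]: "ij = (i, j)" by (cases ij)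
    have "reflected_sde M F (\<lambda>s \<omega>. - ((real n)\<^sup>2 * gradient n (R \<circ> K n) (X s \<omega>) i j)) \<beta> (\<lambda>_. A i j)
        (\<lambda>t \<omega>. B t \<omega> i j) (\<lambda>t \<omega>. X t \<omega> i j) (\<lambda>t \<omega>. Lp t \<omega> i j) (\<lambda>t \<omega>. Lm t \<omega> i j)"
      using sde ij unfolding matrix_sde_def by auto
    then have "AE \<omega> in M. skorokhod_paths (\<lambda>t. X t \<omega> i j) (\<lambda>t. Lp t \<omega> i j) (\<lambda>t. Lm t \<omega> i j)"
      "AE \<omega> in M. X 0 \<omega> i j = A i j \<and> (\<forall>t\<ge>0. set_integrable lborel {0..t} (\<lambda>s. - ((real n)\<^sup>2 * gradient n (R \<circ> K n) (X s \<omega>) i j)) \<and>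
       X t \<omega> i j = X 0 \<omega> i j + (LINT s:{0..t}|lborel. - ((real n)\<^sup>2 * gradient n (R \<circ> K n) (X s \<omega>) i j))
         + \<beta> * B t \<omega> i j + Lm t \<omega> i j - Lp t \<omega> i j)"
      unfolding reflected_sde_def skorokhod_problem_def by blast+
    moreover have "AE \<omega> in M. B 0 \<omega> i j = 0 \<and> continuous_on {0..} (\<lambda>t. B t \<omega> i j)"
      using AE_continuous[OF ij] by simp
    ultimately show "AE \<omega> in M. case ij of (i, j) \<Rightarrow>
     skorokhod_paths (\<lambda>t. X t \<omega> i j) (\<lambda>t. Lp t \<omega> i j) (\<lambda>t. Lm t \<omega> i j) \<and> X 0 \<omega> i j = A i j \<and>
     (\<forall>t\<ge>0. set_integrable lborel {0..t} (\<lambda>s. - ((real n)\<^sup>2 * gradient n (R \<circ> K n) (X s \<omega>) i j)) \<and>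
       X t \<omega> i j = X 0 \<omega> i j + (LINT s:{0..t}|lborel. - ((real n)\<^sup>2 * gradient n (R \<circ> K n) (X s \<omega>) i j))
         + \<beta> * B t \<omega> i j + Lm t \<omega> i j - Lp t \<omega> i j) \<and>
     continuous_on {0..} (\<lambda>t. B t \<omega> i j)"
      unfolding \<open>ij = (i, j)\<close> prod.case by eventually_elim blast
  qed
  ultimately show ?thesis unfolding regular_def by eventually_elim blast
qed

lemma drift:
  assumes "A' \<in> cube_mats n" "i < n" "j < n"
  shows "(real n)\<^sup>2 * gradient n (R \<circ> K n) A' i j = block_average n (\<phi> (K n A')) i j"
  using gradient_step[OF frechet assms] by (simp add: block_average_def)

lemma drift_bound:
  assumes "A' \<in> cube_mats n" "i < n" "j < n"
  shows "\<bar>block_average n (\<phi> (K n A')) i j\<bar> \<le> \<phi>_bound"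
proof (rule abs_block_average_le[OF _ _ assms(2,3)])
  have KA: "K n A' \<in> kernels" by (rule K_in_kernels[OF assms(1) n])
  then show "\<phi> (K n A') \<in> borel_measurable unit_square" by (rule \<phi>_measurable)
  show "AE p in unit_square. \<bar>\<phi> (K n A') p\<bar> \<le> \<phi>_bound" using AE_\<phi>_bound by eventually_elim (use KA in blast)
qed

lemma block_average_\<phi>_lipschitz:
  assumes V: "V \<in> kernels" "V' \<in> kernels" and ij: "i < n" "j < n"
  shows "\<bar>block_average n (\<phi> V) i j - block_average n (\<phi> V') i j\<bar> \<le> \<kappa> * cut_norm (V - V')"
proof -
  have "block_average n (\<phi> V) i j - block_average n (\<phi> V') i j = block_average n (\<lambda>p. \<phi> V p - \<phi> V' p) i j"
    using Linfty[OF V(1)] Linfty[OF V(2)] ij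
    by (simp add: block_average_def block_integral_diff Linfty_sym_integrable right_diff_distrib)
  also have "\<bar>\<dots>\<bar> \<le> \<kappa> * cut_norm (V - V')"
  proof (rule abs_block_average_le[OF _ _ ij])
    show "(\<lambda>p. \<phi> V p - \<phi> V' p) \<in> borel_measurable unit_square"
      by (intro borel_measurable_diff \<phi>_measurable V)
    show "AE p in unit_square. \<bar>\<phi> V p - \<phi> V' p\<bar> \<le> \<kappa> * cut_norm (V - V')"
      using lipschitz by eventually_elim (use V in blast)
  qed
  finally show ?thesis .
qed

end

locale matrix_grid = matrix_system \<phi> \<kappa> n M F R \<beta> A B X Lp Lm
  for \<phi> :: "(real \<times> real \<Rightarrow> real) \<Rightarrow> real \<times> real \<Rightarrow> real" and \<kappa> :: real and n :: nat and M :: "'a measure"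
    and F :: "real \<Rightarrow> 'a measure" and R :: "(real \<times> real \<Rightarrow> real) \<Rightarrow> real" and \<beta> :: real
    and A :: "nat \<Rightarrow> nat \<Rightarrow> real" and B X Lp Lm :: "real \<Rightarrow> 'a \<Rightarrow> nat \<Rightarrow> nat \<Rightarrow> real" +
  fixes \<Gamma> :: "real \<Rightarrow> real \<times> real \<Rightarrow> real" and T \<eta> \<epsilon> :: real and m :: nat
  assumes \<Gamma>_kernel: "t \<ge> 0 \<Longrightarrow> \<Gamma> t \<in> kernels"
    and T: "T > 0" and m: "m \<ge> 1" and \<eta>: "\<eta> > 0" "\<beta> * \<eta> \<le> \<epsilon>" and mesh: "\<phi>_bound * (T / real m) \<le> \<epsilon>"
    and \<Gamma>_modulus: "\<And>k s. k < m \<Longrightarrow> real k * (T / real m) \<le> s \<Longrightarrow> s \<le> real (Suc k) * (T / real m) \<Longrightarrow>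
      cut_norm (\<Gamma> s - \<Gamma> (real k * (T / real m))) \<le> \<epsilon>"
begin

definition \<delta> :: real where "\<delta> = T / real m"

lemma \<delta>_pos: "\<delta> > 0"
  using T m by (simp add: \<delta>_def)

lemma \<epsilon>_pos: "\<epsilon> > 0"
  using \<eta> \<beta>_pos mult_pos_pos[of \<beta> \<eta>] by linarith

lemma grid_nonneg: "0 \<le> real k * \<delta>"
  using \<delta>_pos by simp

lemma grid_le: "k \<le> m \<Longrightarrow> real k * \<delta> \<le> T"
proof -
  assume "k \<le> m"
  then have "real k * \<delta> \<le> real m * \<delta>" using \<delta>_pos by (intro mult_right_mono) auto
  then show ?thesis using m by (simp add: \<delta>_def)
qed

lemma grid_cover:
  assumes "0 \<le> s" "s \<le> T" obtains k where "k < m" "real k * \<delta> \<le> s" "s \<le> real (Suc k) * \<delta>"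
proof -
  define k where "k = min (m - 1) (nat \<lfloor>s / \<delta>\<rfloor>)"
  have s0: "0 \<le> s / \<delta>" using assms \<delta>_pos by simp
  have "real k \<le> real (nat \<lfloor>s / \<delta>\<rfloor>)" by (simp add: k_def)
  also have "\<dots> \<le> s / \<delta>" using s0 by (rule of_nat_floor)
  finally have 1: "real k * \<delta> \<le> s" using \<delta>_pos by (simp add: field_simps)
  have 2: "s \<le> real (Suc k) * \<delta>"
  proof (cases "m - 1 \<le> nat \<lfloor>s / \<delta>\<rfloor>")
    case True
    then have "Suc k = m" using m by (simp add: k_def)
    then have "real (Suc k) * \<delta> = T" using m by (simp add: \<delta>_def)
    then show ?thesis using assms by simp
  next
    case False
    then have "real (Suc k) = real (nat \<lfloor>s / \<delta>\<rfloor>) + 1" by (simp add: k_def)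
    moreover have "s / \<delta> \<le> real (nat \<lfloor>s / \<delta>\<rfloor>) + 1" using s0 by linarith
    ultimately have "s / \<delta> \<le> real (Suc k)" by simp
    then show ?thesis using \<delta>_pos by (simp add: field_simps)
  qed
  have "k < m" using m by (simp add: k_def)
  then show ?thesis using 1 2 by (rule that)
qed

definition c :: "nat \<Rightarrow> nat \<Rightarrow> nat \<Rightarrow> real" where
  "c i j l = - block_average n (\<phi> (\<Gamma> (real l * \<delta>))) i j"

definition Y :: "nat \<Rightarrow> nat \<Rightarrow> nat \<Rightarrow> 'a \<Rightarrow> real" where
  "Y i j k \<omega> = scheme (A i j) (\<lambda>l. \<delta> * c i j l + \<beta> * (B (real (Suc l) * \<delta>) \<omega> i j - B (real l * \<delta>) \<omega> i j)) k"

definition Y_matrix :: "nat \<Rightarrow> 'a \<Rightarrow> nat \<Rightarrow> nat \<Rightarrow> real" where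
  "Y_matrix k \<omega> = (\<lambda>i j. if i < n \<and> j < n then Y (min i j) (max i j) k \<omega> else 0)"

definition Y_mean :: "nat \<Rightarrow> nat \<Rightarrow> nat \<Rightarrow> real" where
  "Y_mean k = (\<lambda>i j. if i < n \<and> j < n then scheme_mean m \<delta> \<beta> k (A i j) (c i j) else 0)"

definition rough_fraction :: "'a \<Rightarrow> real" where
  "rough_fraction \<omega> = (\<Sum>i<n. \<Sum>j<n. of_bool (rough T m \<eta> (\<lambda>t. B t \<omega> (min i j) (max i j)))) / (real n)\<^sup>2"

lemma c_swap: "i < n \<Longrightarrow> j < n \<Longrightarrow> c i j l = c j i l"
  unfolding c_def using block_average_swap[OF Linfty[OF \<Gamma>_kernel[OF grid_nonneg]]] by simp

lemma Y_bound: "\<bar>Y i j k \<omega>\<bar> \<le> 1"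
  unfolding Y_def by (intro scheme_bounds cube_mats_bound[OF A])

subsection \<open>Pathwise Gronwall estimate\<close>

lemma entry_close:
  assumes reg: "regular \<omega>" and ij: "(i, j) \<in> upper n" and smooth: "\<not> rough T m \<eta> (\<lambda>t. B t \<omega> i j)"
    and S: "\<And>r. 0 \<le> r \<Longrightarrow> r \<le> T \<Longrightarrow> cut_norm (K n (X r \<omega>) - \<Gamma> r) \<le> S * exp (2 * \<kappa> * r)" "S \<ge> 0"
    and k: "k < m" "real k * \<delta> \<le> s" "s \<le> real (Suc k) * \<delta>"
  shows "\<bar>X s \<omega> i j - Y i j k \<omega>\<bar> \<le> S / 2 * exp (2 * \<kappa> * s) + (\<kappa> * T + 6) * \<epsilon>"
proof -
  have ijn: "i < n" "j < n" using ij by auto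
  have X: "X t \<omega> \<in> cube_mats n" if "t \<ge> 0" for t using reg that by (simp add: regular_def)
  have cont: "continuous_on {0..} (\<lambda>t. B t \<omega> i j)" using reg ij by (auto simp: regular_def)
  interpret reflected_path "\<lambda>t. X t \<omega> i j" "\<lambda>t. Lp t \<omega> i j" "\<lambda>t. Lm t \<omega> i j"
    "\<lambda>s. - ((real n)\<^sup>2 * gradient n (R \<circ> K n) (X s \<omega>) i j)" "\<lambda>t. B t \<omega> i j" \<beta> \<phi>_bound \<eta> \<delta> m
  proof
    show "\<bar>B r \<omega> i j - B (real k * \<delta>) \<omega> i j\<bar> \<le> \<eta>" if "k < m" "real k * \<delta> \<le> r" "r \<le> real (Suc k) * \<delta>" for k r
      using not_rough_bound[OF cont T smooth that(1)] that unfolding \<delta>_def by blast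
    show "\<bar>- ((real n)\<^sup>2 * gradient n (R \<circ> K n) (X r \<omega>) i j)\<bar> \<le> \<phi>_bound" if "r \<ge> 0" for r
      using drift_bound[OF X[OF that] ijn] by (simp only: drift[OF X[OF that] ijn] abs_minus_cancel)
    show "skorokhod_paths (\<lambda>t. X t \<omega> i j) (\<lambda>t. Lp t \<omega> i j) (\<lambda>t. Lm t \<omega> i j)"
      using reg ij unfolding regular_def by blast
    fix t :: real assume "t \<ge> 0"
    then show "set_integrable lborel {0..t} (\<lambda>s. - ((real n)\<^sup>2 * gradient n (R \<circ> K n) (X s \<omega>) i j))"
      "X t \<omega> i j = X 0 \<omega> i j + (LINT s:{0..t}|lborel. - ((real n)\<^sup>2 * gradient n (R \<circ> K n) (X s \<omega>) i j))
         + \<beta> * B t \<omega> i j + Lm t \<omega> i j - Lp t \<omega> i j"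
      using reg ij unfolding regular_def by blast+
  qed (use \<beta>_pos \<delta>_pos \<eta> in auto)
  define w where "w = (\<lambda>r. \<kappa> * (S * exp (2 * \<kappa> * r) + \<epsilon>))"
  define W where "W = (\<lambda>r. S / 2 * exp (2 * \<kappa> * r) + \<kappa> * \<epsilon> * r)"
  have steps: "\<bar>- ((real n)\<^sup>2 * gradient n (R \<circ> K n) (X r \<omega>) i j) - c i j l\<bar> \<le> w r"
    if l: "l < m" "real l * \<delta> \<le> r" "r \<le> real (Suc l) * \<delta>" for l r
  proof -
    have r: "0 \<le> r" "r \<le> T" using l grid_nonneg[of l] grid_le[of "Suc l"] by linarith+
    have KX: "K n (X r \<omega>) \<in> kernels" by (rule K_in_kernels[OF X[OF r(1)] n])
    note G = \<Gamma>_kernel[OF r(1)] \<Gamma>_kernel[OF grid_nonneg[of l]]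
    have "- ((real n)\<^sup>2 * gradient n (R \<circ> K n) (X r \<omega>) i j) - c i j l =
        - (block_average n (\<phi> (K n (X r \<omega>))) i j - block_average n (\<phi> (\<Gamma> (real l * \<delta>))) i j)"
      unfolding drift[OF X[OF r(1)] ijn] c_def by simp
    then have "\<bar>- ((real n)\<^sup>2 * gradient n (R \<circ> K n) (X r \<omega>) i j) - c i j l\<bar> \<le> \<kappa> * cut_norm (K n (X r \<omega>) - \<Gamma> (real l * \<delta>))"
      using block_average_\<phi>_lipschitz[OF KX G(2) ijn] by linarith
    also have "\<dots> \<le> \<kappa> * (cut_norm (K n (X r \<omega>) - \<Gamma> r) + cut_norm (\<Gamma> r - \<Gamma> (real l * \<delta>)))"
      using KX G by (intro mult_left_mono cut_norm_triangle \<kappa>_nonneg) auto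
    also have "\<dots> \<le> w r"
      unfolding w_def using S(1)[OF r] \<Gamma>_modulus[OF l[unfolded \<delta>_def]] unfolding \<delta>_def[symmetric]
      by (intro mult_left_mono add_mono \<kappa>_nonneg)
    finally show ?thesis .
  qed
  have "\<bar>X s \<omega> i j - Y i j k \<omega>\<bar> \<le> \<bar>X 0 \<omega> i j - A i j\<bar> + (W s - W 0) + 2 * (\<phi>_bound * \<delta> + 2 * (\<beta> * \<eta>))"
    unfolding Y_def
  proof (rule path_scheme[where w = w and W = W, OF steps _ _ k cube_mats_bound[OF A]])
    show "(W has_real_derivative w r) (at r)" for r
      unfolding W_def w_def by (auto intro!: derivative_eq_intros simp: algebra_simps)
    show "continuous_on UNIV w" unfolding w_def by (intro continuous_intros)
  qed
  also have "X 0 \<omega> i j = A i j" using reg ij unfolding regular_def by blast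
  also have "\<bar>A i j - A i j\<bar> + (W s - W 0) + 2 * (\<phi>_bound * \<delta> + 2 * (\<beta> * \<eta>)) \<le> S / 2 * exp (2 * \<kappa> * s) + (\<kappa> * T + 6) * \<epsilon>"
  proof -
    have "s \<le> T" using k grid_le[of "Suc k"] by linarith
    then have "\<kappa> * \<epsilon> * s \<le> \<kappa> * \<epsilon> * T" using \<kappa>_nonneg \<epsilon>_pos by (intro mult_left_mono) auto
    moreover have "\<phi>_bound * \<delta> \<le> \<epsilon>" using mesh by (simp add: \<delta>_def)
    moreover have "(\<kappa> * T + 6) * \<epsilon> = \<kappa> * \<epsilon> * T + 6 * \<epsilon>" by (simp add: algebra_simps)
    ultimately show ?thesis using \<eta>(2) S(2) unfolding W_def by simp
  qed
  finally show ?thesis .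
qed

lemma step_kernel_close:
  assumes reg: "regular \<omega>"
    and S: "\<And>r. 0 \<le> r \<Longrightarrow> r \<le> T \<Longrightarrow> cut_norm (K n (X r \<omega>) - \<Gamma> r) \<le> S * exp (2 * \<kappa> * r)" "S \<ge> 0"
    and k: "k < m" "real k * \<delta> \<le> s" "s \<le> real (Suc k) * \<delta>"
  shows "cut_norm (K n (X s \<omega>) - K n (Y_matrix k \<omega>)) \<le> S / 2 * exp (2 * \<kappa> * s) + (\<kappa> * T + 6) * \<epsilon> + 2 * rough_fraction \<omega>"
proof -
  let ?b = "S / 2 * exp (2 * \<kappa> * s) + (\<kappa> * T + 6) * \<epsilon>"
  let ?r = "\<lambda>i j. rough T m \<eta> (\<lambda>t. B t \<omega> (min i j) (max i j))"
  have nn: "real n > 0" using n by simp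
  have s0: "0 \<le> s" using k grid_nonneg[of k] by linarith
  have X: "X s \<omega> \<in> cube_mats n" using reg s0 by (simp add: regular_def)
  have b0: "?b \<ge> 0" using S(2) \<kappa>_nonneg T \<epsilon>_pos by (intro add_nonneg_nonneg mult_nonneg_nonneg) auto
  have "cut_norm (K n (X s \<omega>) - K n (Y_matrix k \<omega>)) = cut_norm (K n (X s \<omega> - Y_matrix k \<omega>))" by (simp add: K_diff)
  also have "\<dots> \<le> (\<integral>p. \<bar>K n (X s \<omega> - Y_matrix k \<omega>) p\<bar> \<partial>unit_square)" by (rule cut_norm_le_L1) simp
  also have "\<dots> = (\<Sum>i<n. \<Sum>j<n. \<bar>(X s \<omega> - Y_matrix k \<omega>) i j\<bar>) / (real n)\<^sup>2" by (rule integral_abs_K[OF n])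
  also have "\<dots> \<le> (\<Sum>i<n. \<Sum>j<n. ?b + 2 * of_bool (?r i j)) / (real n)\<^sup>2"
  proof (intro divide_right_mono sum_mono)
    fix i j assume ij: "i \<in> {..<n}" "j \<in> {..<n}"
    let ?i = "min i j" and ?j = "max i j"
    have up: "(?i, ?j) \<in> upper n" using ij by auto
    have "X s \<omega> i j = X s \<omega> ?i ?j" using cube_mats_sym[OF X] by (auto simp: min_def max_def)
    then have eq: "(X s \<omega> - Y_matrix k \<omega>) i j = X s \<omega> ?i ?j - Y ?i ?j k \<omega>" using ij by (simp add: Y_matrix_def)
    show "\<bar>(X s \<omega> - Y_matrix k \<omega>) i j\<bar> \<le> ?b + 2 * of_bool (?r i j)"
    proof (cases "?r i j")
      case True
      have "\<bar>X s \<omega> ?i ?j - Y ?i ?j k \<omega>\<bar> \<le> 2" using cube_mats_bound[OF X, of ?i ?j] Y_bound[of ?i ?j k \<omega>] by linarith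
      then show ?thesis using True b0 unfolding eq by simp
    next
      case False
      then show ?thesis using entry_close[OF reg up False S k] unfolding eq by simp
    qed
  qed simp
  also have "\<dots> = ?b + 2 * rough_fraction \<omega>"
    using nn unfolding rough_fraction_def
    by (simp add: sum.distrib sum_distrib_left[symmetric] add_divide_distrib power2_eq_square)
  finally show ?thesis by simp
qed

lemma gronwall:
  assumes reg: "regular \<omega>" and s: "0 \<le> s" "s \<le> T"
    and a: "\<And>k. k < m \<Longrightarrow> 2 * rough_fraction \<omega> + cut_norm (K n (Y_matrix k \<omega>) - K n (Y_mean k))
      + cut_norm (K n (Y_mean k) - \<Gamma> (real k * \<delta>)) \<le> a"
  shows "cut_norm (K n (X s \<omega>) - \<Gamma> s) \<le> 2 * ((\<kappa> * T + 7) * \<epsilon> + a) * exp (2 * \<kappa> * T)"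
proof -
  let ?D = "\<lambda>r. cut_norm (K n (X r \<omega>) - \<Gamma> r)"
  let ?e = "\<lambda>r. exp (2 * \<kappa> * r)"
  have KX: "K n (X r \<omega>) \<in> kernels" if "0 \<le> r" for r
    using reg that by (intro K_in_kernels n) (simp add: regular_def)
  have D: "0 \<le> ?D r" "?D r \<le> 2" if "0 \<le> r" for r
    using KX[OF that] \<Gamma>_kernel[OF that] by (auto intro!: cut_norm_nonneg cut_norm_diff_le_2)
  define S where "S = (SUP r\<in>{0..T}. ?D r / ?e r)"
  have e1: "?e r \<ge> 1" if "0 \<le> r" for r using that \<kappa>_nonneg by simp
  have bdd: "bdd_above ((\<lambda>r. ?D r / ?e r) ` {0..T})"
  proof (rule bdd_aboveI2)
    fix r assume "r \<in> {0..T}"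
    then have r: "0 \<le> r" by simp
    have "?D r / ?e r \<le> ?D r / 1" using e1[OF r] D[OF r] by (intro divide_left_mono) auto
    then show "?D r / ?e r \<le> 2" using D[OF r] by linarith
  qed
  have upper: "?D r / ?e r \<le> S" if "0 \<le> r" "r \<le> T" for r
    unfolding S_def using that by (intro cSUP_upper bdd) auto
  have S0: "S \<ge> 0" using upper[of 0] D(1)[of 0] T by simp
  have S: "?D r \<le> S * ?e r" if "0 \<le> r" "r \<le> T" for r
    using upper[OF that] by (simp add: field_simps)
  have bound: "?D r \<le> S / 2 * ?e r + ((\<kappa> * T + 7) * \<epsilon> + a)" if r: "0 \<le> r" "r \<le> T" for r
  proof -
    obtain k where k: "k < m" "real k * \<delta> \<le> r" "r \<le> real (Suc k) * \<delta>" using grid_cover[OF r] .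
    note G = \<Gamma>_kernel[OF r(1)] \<Gamma>_kernel[OF grid_nonneg[of k]]
    have "?D r \<le> cut_norm (K n (X r \<omega>) - K n (Y_matrix k \<omega>)) + cut_norm (K n (Y_matrix k \<omega>) - \<Gamma> r)"
      "cut_norm (K n (Y_matrix k \<omega>) - \<Gamma> r) \<le> cut_norm (K n (Y_matrix k \<omega>) - K n (Y_mean k)) + cut_norm (K n (Y_mean k) - \<Gamma> r)"
      "cut_norm (K n (Y_mean k) - \<Gamma> r) \<le> cut_norm (K n (Y_mean k) - \<Gamma> (real k * \<delta>)) + cut_norm (\<Gamma> (real k * \<delta>) - \<Gamma> r)"
      using G by (intro cut_norm_triangle; simp)+
    moreover have "cut_norm (\<Gamma> (real k * \<delta>) - \<Gamma> r) \<le> \<epsilon>"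
      unfolding cut_norm_commute[of "\<Gamma> (real k * \<delta>)"] using \<Gamma>_modulus[OF k[unfolded \<delta>_def]] unfolding \<delta>_def .
    moreover have "(\<kappa> * T + 7) * \<epsilon> = (\<kappa> * T + 6) * \<epsilon> + \<epsilon>" by (simp add: algebra_simps)
    ultimately show ?thesis
      using step_kernel_close[OF reg S S0 k] a[OF k(1)] by linarith
  qed
  let ?c = "(\<kappa> * T + 7) * \<epsilon> + a"
  have c0: "0 \<le> ?c"
  proof -
    have "0 \<le> rough_fraction \<omega>" unfolding rough_fraction_def by (intro divide_nonneg_nonneg sum_nonneg) auto
    moreover have "0 \<le> cut_norm (K n (Y_matrix 0 \<omega>) - K n (Y_mean 0))" "0 \<le> cut_norm (K n (Y_mean 0) - \<Gamma> (real 0 * \<delta>))"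
      using \<Gamma>_kernel[OF grid_nonneg[of 0]] by (auto intro!: cut_norm_nonneg simp: K_diff fun_diff_def)
    ultimately have "0 \<le> a" using a[of 0] m by simp
    then show ?thesis using \<kappa>_nonneg T \<epsilon>_pos by (intro add_nonneg_nonneg mult_nonneg_nonneg) auto
  qed
  have "?D r / ?e r \<le> S / 2 + ?c" if r: "0 \<le> r" "r \<le> T" for r
  proof -
    have "?D r / ?e r \<le> (S / 2 * ?e r + ?c) / ?e r" by (intro divide_right_mono bound r) simp
    also have "\<dots> = S / 2 + ?c / ?e r" by (simp add: add_divide_distrib)
    also have "?c / ?e r \<le> ?c / 1" using c0 e1[OF r(1)] by (intro divide_left_mono) auto
    finally show ?thesis by simp
  qed
  then have "S \<le> S / 2 + ?c" unfolding S_def using T by (intro cSUP_least) auto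
  then have "S \<le> 2 * ?c" by simp
  have "?D s \<le> S * ?e s" by (rule S[OF s])
  also have "\<dots> \<le> (2 * ?c) * ?e T" using \<open>S \<le> 2 * ?c\<close> S0 s \<kappa>_nonneg
    by (intro mult_mono) (auto intro: mult_left_mono)
  finally show ?thesis .
qed

end

section \<open>Convergence in probability\<close>

context matrix_grid
begin

lemma Y_increments:
  assumes "k \<le> m"
  shows "Y i j k \<omega> = scheme (A i j) (\<lambda>l. \<delta> * c i j l + \<beta> * (\<lambda>l\<in>{..<m}. increment \<delta> (\<lambda>t \<omega>. B t \<omega> i j) l \<omega>) l) k"
  unfolding Y_def using assms by (intro scheme_cong) (simp add: increment_def)

lemma expectation_Y:
  assumes ij: "(i, j) \<in> upper n" and "k \<le> m"
  shows "Y i j k \<in> borel_measurable M" "expectation (Y i j k) = Y_mean k i j"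
proof -
  let ?P = "\<Pi>\<^sub>M l\<in>{..<m}. (borel :: real measure)"
  let ?\<xi> = "\<lambda>\<omega>. \<lambda>l\<in>{..<m}. increment \<delta> (\<lambda>t \<omega>. B t \<omega> i j) l \<omega>"
  let ?S = "\<lambda>\<xi>. scheme (A i j) (\<lambda>l. \<delta> * c i j l + \<beta> * \<xi> l) k"
  have \<xi>: "?\<xi> \<in> measurable M ?P" using increments_measurable[OF \<delta>_pos ij, of m] by simp
  have S: "?S \<in> borel_measurable ?P"
    using scheme_increments_measurable[OF assms(2), of _ \<delta>] by (simp cong: measurable_cong_sets)
  have Y: "Y i j k = (\<lambda>\<omega>. ?S (?\<xi> \<omega>))" using Y_increments[OF assms(2)] by blast
  show "Y i j k \<in> borel_measurable M" unfolding Y by (rule measurable_compose[OF \<xi> S])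
  have "expectation (Y i j k) = (\<integral>\<xi>. ?S \<xi> \<partial>distr M ?P ?\<xi>)"
    unfolding Y by (rule integral_distr[OF \<xi> S, symmetric])
  also have "distr M ?P ?\<xi> = increments_law m \<delta>"
    using distr_increments[OF \<delta>_pos ij, of m] by simp
  finally show "expectation (Y i j k) = Y_mean k i j"
    using ij by (simp add: Y_mean_def scheme_mean_def)
qed

lemma Y_mean_bound: "(i, j) \<in> upper n \<Longrightarrow> k \<le> m \<Longrightarrow> \<bar>Y_mean k i j\<bar> \<le> 1"
proof -
  assume ij: "(i, j) \<in> upper n" "k \<le> m"
  have int: "integrable M (Y i j k)" using expectation_Y(1)[OF ij] Y_bound by (intro integrable_const_bound[of _ 1]) auto
  have "\<bar>expectation (Y i j k)\<bar> \<le> expectation (\<lambda>\<omega>. \<bar>Y i j k \<omega>\<bar>)" by (rule integral_abs_bound)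
  also have "\<dots> \<le> expectation (\<lambda>_. 1)" using int Y_bound by (intro integral_mono integrable_abs) auto
  finally show ?thesis using expectation_Y(2)[OF ij] prob_space by simp
qed

definition deviation :: "nat \<Rightarrow> nat \<times> nat \<Rightarrow> 'a \<Rightarrow> real" where
  "deviation k = (\<lambda>(i, j) \<omega>. Y i j k \<omega> - Y_mean k i j)"

lemma indep_deviation:
  assumes "k \<le> m" shows "indep_vars (\<lambda>_. borel) (deviation k) (upper n)"
proof -
  let ?X = "\<lambda>(ij, l). increment \<delta> (case ij of (i, j) \<Rightarrow> \<lambda>t \<omega>. B t \<omega> i j) l"
  let ?K = "\<lambda>ij. {ij} \<times> {..<m}"
  let ?f = "\<lambda>(i, j) z. scheme (A i j) (\<lambda>l. \<delta> * c i j l + \<beta> * z ((i, j), l)) k - Y_mean k i j"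
  have "indep_vars (\<lambda>ij. \<Pi>\<^sub>M p\<in>?K ij. borel) (\<lambda>ij \<omega>. restrict (\<lambda>p. ?X p \<omega>) (?K ij)) (upper n)"
    using indep_increments[OF \<delta>_pos, of m]
    by (rule indep_vars_restrict) (auto simp: disjoint_family_on_def)
  then have "indep_vars (\<lambda>_. borel) (\<lambda>ij \<omega>. ?f ij (restrict (\<lambda>p. ?X p \<omega>) (?K ij))) (upper n)"
  proof (rule indep_vars_compose2)
    fix ij assume "ij \<in> upper n"
    obtain i j where [simp]: "ij = (i, j)" by (cases ij)
    have "(\<lambda>z. scheme (A i j) (\<lambda>l. \<delta> * c i j l + \<beta> * z ((i, j), l)) k) \<in> borel_measurable (\<Pi>\<^sub>M p\<in>?K (i, j). borel)"
    proof (rule borel_measurable_scheme)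
      fix l assume "l < k"
      then have "(\<lambda>z. z ((i, j), l)) \<in> borel_measurable (\<Pi>\<^sub>M p\<in>?K (i, j). (borel :: real measure))"
        using assms by (intro measurable_component_singleton) auto
      then show "(\<lambda>z. \<delta> * c i j l + \<beta> * z ((i, j), l)) \<in> borel_measurable (\<Pi>\<^sub>M p\<in>?K (i, j). borel)" by simp
    qed simp
    then show "?f ij \<in> borel_measurable (\<Pi>\<^sub>M p\<in>?K ij. borel)" by simp
  qed
  moreover have "(\<lambda>ij \<omega>. ?f ij (restrict (\<lambda>p. ?X p \<omega>) (?K ij))) = deviation k"
  proof (intro ext)
    fix ij :: "nat \<times> nat" and \<omega>
    obtain i j where [simp]: "ij = (i, j)" by (cases ij)
    have "scheme (A i j) (\<lambda>l. \<delta> * c i j l + \<beta> * restrict (\<lambda>p. ?X p \<omega>) (?K (i, j)) ((i, j), l)) k = Y i j k \<omega>"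
      unfolding Y_def using assms by (intro scheme_cong) (simp add: increment_def)
    then show "?f ij (restrict (\<lambda>p. ?X p \<omega>) (?K ij)) = deviation k ij \<omega>" by (simp add: deviation_def)
  qed
  ultimately show ?thesis by (simp only:)
qed

lemma concentration:
  assumes k: "k \<le> m" and "e > 0"
  shows "\<exists>E\<in>events. emeasure M E \<le> ennreal (64 / e ^ 4 / real n) \<and>
    (\<forall>\<omega>\<in>space M - E. cut_norm (K n (Y_matrix k \<omega>) - K n (Y_mean k)) \<le> 2 * e)"
proof -
  define J where "J = {(i, j). i < j \<and> j < n}"
  have J: "J \<subseteq> upper n" "finite J" by (auto simp: J_def intro: finite_subset[OF _ finite_upper[of n]])
  let ?G = "\<lambda>J \<omega>. gram_energy n (\<lambda>i j. if (i, j) \<in> J then deviation k (i, j) \<omega> else 0)"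
  let ?E = "\<lambda>J. {\<omega> \<in> space M. real n ^ 4 * e ^ 4 < ?G J \<omega>}"
  have bound: "\<bar>deviation k x \<omega>\<bar> \<le> 2" if "x \<in> upper n" for x \<omega>
  proof -
    obtain i j where [simp]: "x = (i, j)" by (cases x)
    show ?thesis using Y_bound[of i j k \<omega>] Y_mean_bound[of i j k] that k by (simp add: deviation_def)
  qed
  have mean: "expectation (deviation k x) = 0" if "x \<in> upper n" for x
  proof -
    obtain i j where [simp]: "x = (i, j)" by (cases x)
    have "integrable M (Y i j k)" using that expectation_Y(1)[of i j k] Y_bound k by (intro integrable_const_bound[of _ 1]) auto
    then show ?thesis using that expectation_Y(2)[of i j k] k prob_space by (simp add: deviation_def)
  qed
  note E1 = prob_gram_energy_le[OF indep_deviation[OF k] finite_upper bound mean assms(2) n]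
  note E2 = prob_gram_energy_le[OF indep_vars_subset[OF indep_deviation[OF k] J(1)] J(2) bound mean assms(2) n, OF subsetD[OF J(1)] subsetD[OF J(1)]]
  show ?thesis
  proof (intro bexI[of _ "?E (upper n) \<union> ?E J"] conjI ballI)
    show "?E (upper n) \<union> ?E J \<in> events" using E1(1) E2(1) by (rule sets.Un)
    have "emeasure M (?E (upper n) \<union> ?E J) \<le> emeasure M (?E (upper n)) + emeasure M (?E J)"
      using E1(1) E2(1) by (rule emeasure_subadditive)
    also have "\<dots> \<le> ennreal (32 / e ^ 4 / real n) + ennreal (32 / e ^ 4 / real n)" using E1(2) E2(2) by (rule add_mono)
    also have "\<dots> = ennreal (64 / e ^ 4 / real n)" using assms(2) by (simp flip: ennreal_plus add: add_divide_distrib[symmetric])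
    finally show "emeasure M (?E (upper n) \<union> ?E J) \<le> ennreal (64 / e ^ 4 / real n)" .
    fix \<omega> assume \<omega>: "\<omega> \<in> space M - (?E (upper n) \<union> ?E J)"
    let ?D = "Y_matrix k \<omega> - Y_mean k"
    have D: "?D i j = deviation k (i, j) \<omega>" if "(i, j) \<in> upper n" for i j
      using that by (simp add: deviation_def Y_matrix_def min_def max_def)
    have "gram_energy n (\<lambda>i j. if i \<le> j then ?D i j else 0) = ?G (upper n) \<omega>"
      unfolding gram_energy_def by (intro sum.cong refl arg_cong[where f = "\<lambda>x. x\<^sup>2"] arg_cong2[where f = "(*)"]) (use D in auto)
    moreover have "gram_energy n (\<lambda>i j. if i < j then ?D i j else 0) = ?G J \<omega>"
      unfolding gram_energy_def by (intro sum.cong refl arg_cong[where f = "\<lambda>x. x\<^sup>2"] arg_cong2[where f = "(*)"]) (use D in \<open>auto simp: J_def\<close>)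
    moreover have "?D i j = ?D j i" for i j
    proof -
      have "scheme_mean m \<delta> \<beta> k (A i j) (c i j) = scheme_mean m \<delta> \<beta> k (A j i) (c j i)" if "i < n" "j < n"
        using cube_mats_sym[OF A, of i j] c_swap[OF that] by (simp add: scheme_mean_def)
      then show ?thesis by (simp add: Y_matrix_def Y_mean_def min.commute max.commute)
    qed
    ultimately have "cut_norm (K n ?D) \<le> 2 * e"
      using \<omega> assms(2) by (intro cut_norm_K_le_gram_energy n) (simp_all add: not_less)
    then show "cut_norm (K n (Y_matrix k \<omega>) - K n (Y_mean k)) \<le> 2 * e" by (simp only: K_diff)
  qed
qed

lemma rough_fraction_markov:
  assumes "a > 0"
  shows "\<exists>E\<in>events. emeasure M E \<le> ennreal (enn2real (rough_prob T m \<eta>) / a) \<and>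
    (\<forall>\<omega>\<in>space M - E. rough_fraction \<omega> \<le> a)"
proof -
  let ?R = "\<lambda>i j. {\<omega> \<in> space M. rough T m \<eta> (\<lambda>t. B t \<omega> (min i j) (max i j))}"
  let ?\<rho> = "enn2real (rough_prob T m \<eta>)"
  have nn: "real n > 0" using n by simp
  have R: "?R i j \<in> events" "prob (?R i j) = ?\<rho>" if "i < n" "j < n" for i j
  proof -
    have up: "(min i j, max i j) \<in> upper n" using that by auto
    show "?R i j \<in> events" using rough_event[OF T m up, of \<eta>] by simp
    show "prob (?R i j) = ?\<rho>" using emeasure_rough[OF T m up, of \<eta>] by (simp add: measure_def)
  qed
  define f where "f = (\<lambda>\<omega>. (\<Sum>i<n. \<Sum>j<n. indicator (?R i j) \<omega>) / (real n)\<^sup>2 :: real)"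
  have f_eq: "f \<omega> = rough_fraction \<omega>" if "\<omega> \<in> space M" for \<omega>
    unfolding f_def rough_fraction_def using that by (intro arg_cong2[where f = "(/)"] sum.cong refl) (auto simp: indicator_def)
  have f_nonneg: "f \<omega> \<ge> 0" for \<omega> unfolding f_def by (intro divide_nonneg_nonneg sum_nonneg) auto
  have int_R: "integrable M (indicator (?R i j) :: 'a \<Rightarrow> real)" if "i < n" "j < n" for i j
    using R(1)[OF that] by (intro integrable_real_indicator) (auto simp: emeasure_eq_measure)
  have int: "integrable M f" unfolding f_def
    by (rule integrable_divide_zero, intro Bochner_Integration.integrable_sum, rule int_R) auto
  have "expectation f = (\<Sum>i<n. \<Sum>j<n. prob (?R i j)) / (real n)\<^sup>2"
  proof -
    have "expectation f = expectation (\<lambda>\<omega>. \<Sum>i<n. \<Sum>j<n. indicator (?R i j) \<omega>) / (real n)\<^sup>2"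
      unfolding f_def by (rule integral_divide_zero)
    also have "expectation (\<lambda>\<omega>. \<Sum>i<n. \<Sum>j<n. indicator (?R i j) \<omega> :: real) = (\<Sum>i<n. expectation (\<lambda>\<omega>. \<Sum>j<n. indicator (?R i j) \<omega>))"
      by (intro Bochner_Integration.integral_sum Bochner_Integration.integrable_sum int_R) auto
    also have "\<dots> = (\<Sum>i<n. \<Sum>j<n. expectation (indicator (?R i j)))"
      by (intro sum.cong refl Bochner_Integration.integral_sum int_R) auto
    also have "\<dots> = (\<Sum>i<n. \<Sum>j<n. prob (?R i j))"
      using R(1) by (intro sum.cong refl) simp
    finally show ?thesis .
  qed
  also have "\<dots> = ?\<rho>" using nn R(2) by (simp add: power2_eq_square)
  finally have Ef: "expectation f = ?\<rho>" .
  let ?E = "{\<omega> \<in> space M. a < f \<omega>}"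
  have E: "?E \<in> events" using borel_measurable_integrable[OF int] by measurable
  have "a * prob ?E = expectation (\<lambda>\<omega>. a * indicator ?E \<omega>)" using E by simp
  also have "\<dots> \<le> expectation f"
  proof (rule integral_mono)
    show "integrable M (\<lambda>\<omega>. a * indicator ?E \<omega>)"
      using E by (intro integrable_mult_right integrable_real_indicator) (auto simp: emeasure_eq_measure)
    show "a * indicator ?E \<omega> \<le> f \<omega>" for \<omega> using f_nonneg[of \<omega>] by (auto simp: indicator_def)
  qed (rule int)
  finally have "prob ?E \<le> ?\<rho> / a" using assms by (simp add: Ef field_simps)
  then have "emeasure M ?E \<le> ennreal (?\<rho> / a)" unfolding emeasure_eq_measure by (rule ennreal_leI)
  moreover have "rough_fraction \<omega> \<le> a" if "\<omega> \<in> space M - ?E" for \<omega>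
    using that f_eq[of \<omega>] by auto
  ultimately show ?thesis using E by (intro bexI[of _ ?E] conjI ballI)
qed

lemma outer_measure_estimate:
  assumes mean: "\<And>k. k < m \<Longrightarrow> cut_norm (K n (Y_mean k) - \<Gamma> (real k * \<delta>)) \<le> 2 * \<epsilon>"
    and rough: "rough_prob T m \<eta> \<le> ennreal (\<epsilon>\<^sup>2)"
  shows "outer_measure_of M {\<omega> \<in> space M. \<bar>SUP s\<in>{0..T}. cut_norm (K n (X s \<omega>) - \<Gamma> s)\<bar> > 2 * ((\<kappa> * T + 13) * \<epsilon>) * exp (2 * \<kappa> * T)}
    \<le> ennreal (\<epsilon> + real m * (64 / \<epsilon> ^ 4) / real n)" (is "outer_measure_of M ?S \<le> _")
proof -
  from rough_fraction_markov[OF \<epsilon>_pos] obtain E0 where E0_props: "E0 \<in> events"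
    "emeasure M E0 \<le> ennreal (enn2real (rough_prob T m \<eta>) / \<epsilon>) \<and> (\<forall>\<omega>\<in>space M - E0. rough_fraction \<omega> \<le> \<epsilon>)" ..
  then have E0: "E0 \<in> events" "emeasure M E0 \<le> ennreal (enn2real (rough_prob T m \<eta>) / \<epsilon>)"
    "\<And>\<omega>. \<omega> \<in> space M - E0 \<Longrightarrow> rough_fraction \<omega> \<le> \<epsilon>"
    by simp_all
  have "\<forall>k\<in>{..<m}. \<exists>E. E \<in> events \<and> emeasure M E \<le> ennreal (64 / \<epsilon> ^ 4 / real n) \<and>
    (\<forall>\<omega>\<in>space M - E. cut_norm (K n (Y_matrix k \<omega>) - K n (Y_mean k)) \<le> 2 * \<epsilon>)"
    using concentration[OF less_imp_le \<epsilon>_pos] unfolding Bex_def by simp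
  from bchoice[OF this] obtain E where E': "\<forall>k\<in>{..<m}. E k \<in> events \<and> emeasure M (E k) \<le> ennreal (64 / \<epsilon> ^ 4 / real n) \<and>
    (\<forall>\<omega>\<in>space M - E k. cut_norm (K n (Y_matrix k \<omega>) - K n (Y_mean k)) \<le> 2 * \<epsilon>)" ..
  have E: "\<And>k. k < m \<Longrightarrow> E k \<in> events" "\<And>k. k < m \<Longrightarrow> emeasure M (E k) \<le> ennreal (64 / \<epsilon> ^ 4 / real n)"
    "\<And>k \<omega>. k < m \<Longrightarrow> \<omega> \<in> space M - E k \<Longrightarrow> cut_norm (K n (Y_matrix k \<omega>) - K n (Y_mean k)) \<le> 2 * \<epsilon>"
    using E' by (simp, simp, blast)
  from AE_regular obtain N where N0: "{\<omega> \<in> space M. \<not> regular \<omega>} \<subseteq> N" "emeasure M N = 0" "N \<in> events"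
    by (rule AE_E)
  have N: "N \<in> null_sets M" "{\<omega> \<in> space M. \<not> regular \<omega>} \<subseteq> N" using N0 by auto
  let ?Bad = "N \<union> (E0 \<union> (\<Union>k\<in>{..<m}. E k))"
  have Bad: "?Bad \<in> events" using N E0 E by auto
  let ?bound = "2 * ((\<kappa> * T + 13) * \<epsilon>) * exp (2 * \<kappa> * T)"
  have "?S \<subseteq> ?Bad"
  proof
    fix \<omega> assume \<omega>: "\<omega> \<in> ?S"
    let ?D = "\<lambda>s. cut_norm (K n (X s \<omega>) - \<Gamma> s)"
    show "\<omega> \<in> ?Bad"
    proof (rule ccontr)
      assume nb: "\<omega> \<notin> ?Bad"
      have sp: "\<omega> \<in> space M" using \<omega> by simp
      have reg: "regular \<omega>" using N(2) nb sp by blast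
      have D: "?D s \<le> ?bound" if "0 \<le> s" "s \<le> T" for s
      proof -
        have "?D s \<le> 2 * ((\<kappa> * T + 7) * \<epsilon> + 6 * \<epsilon>) * exp (2 * \<kappa> * T)"
        proof (rule gronwall[OF reg that])
          fix k assume k: "k < m"
          have "rough_fraction \<omega> \<le> \<epsilon>" using E0(3) nb sp by blast
          moreover have "cut_norm (K n (Y_matrix k \<omega>) - K n (Y_mean k)) \<le> 2 * \<epsilon>" using E(3)[OF k] nb sp k by blast
          ultimately show "2 * rough_fraction \<omega> + cut_norm (K n (Y_matrix k \<omega>) - K n (Y_mean k))
              + cut_norm (K n (Y_mean k) - \<Gamma> (real k * \<delta>)) \<le> 6 * \<epsilon>"
            using mean[OF k] by linarith
        qed
        also have "(\<kappa> * T + 7) * \<epsilon> + 6 * \<epsilon> = (\<kappa> * T + 13) * \<epsilon>" by (simp add: algebra_simps)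
        finally show ?thesis .
      qed
      have "(SUP s\<in>{0..T}. ?D s) \<le> ?bound" using T D by (intro cSUP_least) auto
      moreover have "0 \<le> (SUP s\<in>{0..T}. ?D s)"
      proof (rule cSUP_upper2)
        show "bdd_above (?D ` {0..T})" using D by (intro bdd_aboveI2[where M = ?bound]) auto
        show "0 \<le> ?D 0"
          using \<Gamma>_kernel[of 0] by (intro cut_norm_nonneg) (simp add: fun_diff_def)
      qed (use T in simp)
      ultimately show False using \<omega> by simp
    qed
  qed
  then have "outer_measure_of M ?S \<le> emeasure M ?Bad"
    unfolding outer_measure_of_def using Bad by (intro INF_lower) auto
  also have "\<dots> = emeasure M (E0 \<union> (\<Union>k\<in>{..<m}. E k))"
    using E0 E by (subst Un_commute) (intro emeasure_Un_null_set[OF _ N(1)] sets.Un sets.finite_UN, auto)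
  also have "\<dots> \<le> emeasure M E0 + emeasure M (\<Union>k\<in>{..<m}. E k)"
    using E0 E by (intro emeasure_subadditive) auto
  also have "\<dots> \<le> ennreal \<epsilon> + ennreal (real m * (64 / \<epsilon> ^ 4) / real n)"
  proof (rule add_mono)
    have "enn2real (rough_prob T m \<eta>) \<le> \<epsilon>\<^sup>2" using rough by (intro enn2real_leI) auto
    then have "enn2real (rough_prob T m \<eta>) / \<epsilon> \<le> \<epsilon>" using \<epsilon>_pos by (simp add: field_simps power2_eq_square)
    then show "emeasure M E0 \<le> ennreal \<epsilon>" by (rule order_trans[OF E0(2) ennreal_leI])
    have "emeasure M (\<Union>k\<in>{..<m}. E k) \<le> (\<Sum>k<m. emeasure M (E k))"
      using E by (intro emeasure_subadditive_finite) auto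
    also have "\<dots> \<le> (\<Sum>k<m. ennreal (64 / \<epsilon> ^ 4 / real n))" using E(2) by (intro sum_mono) auto
    also have "\<dots> = ennreal (real m * (64 / \<epsilon> ^ 4) / real n)"
      using \<epsilon>_pos by (simp add: sum_ennreal ennreal_mult'[symmetric] ennreal_of_nat_eq_real_of_nat)
    finally show "emeasure M (\<Union>k\<in>{..<m}. E k) \<le> ennreal (real m * (64 / \<epsilon> ^ 4) / real n)" .
  qed
  also have "\<dots> = ennreal (\<epsilon> + real m * (64 / \<epsilon> ^ 4) / real n)"
    using \<epsilon>_pos by (intro ennreal_plus[symmetric]) auto
  finally show ?thesis .
qed

lemma Y_mean_close:
  assumes W0: "W0 \<in> kernels" and k: "k < m"
    and H: "integrable unit_square (\<lambda>p. scheme_mean m \<delta> \<beta> k (W0 p) (\<lambda>l. - \<phi> (\<Gamma> (real l * \<delta>)) p))"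
  shows "cut_norm (K n (Y_mean k) - (\<lambda>p. scheme_mean m \<delta> \<beta> k (W0 p) (\<lambda>l. - \<phi> (\<Gamma> (real l * \<delta>)) p))) \<le>
    (\<integral>p. \<bar>K n A p - W0 p\<bar> \<partial>unit_square) +
    \<delta> * (\<Sum>l<m. \<integral>p. \<bar>K n (block_average n (\<phi> (\<Gamma> (real l * \<delta>)))) p - \<phi> (\<Gamma> (real l * \<delta>)) p\<bar> \<partial>unit_square)"
proof -
  let ?H = "\<lambda>p. scheme_mean m \<delta> \<beta> k (W0 p) (\<lambda>l. - \<phi> (\<Gamma> (real l * \<delta>)) p)"
  let ?g = "\<lambda>l p. \<bar>K n (block_average n (\<phi> (\<Gamma> (real l * \<delta>)))) p - \<phi> (\<Gamma> (real l * \<delta>)) p\<bar>"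
  have int_g: "integrable unit_square (?g l)" for l
    using Linfty_sym_integrable[OF Linfty[OF \<Gamma>_kernel[OF grid_nonneg]]] by (intro integrable_abs Bochner_Integration.integrable_diff) auto
  have int_W: "integrable unit_square (\<lambda>p. \<bar>K n A p - W0 p\<bar>)" using W0 by (intro integrable_abs Bochner_Integration.integrable_diff) auto
  have int: "integrable unit_square (K n (Y_mean k) - ?H)"
    unfolding fun_diff_def by (intro Bochner_Integration.integrable_diff H) simp
  have "cut_norm (K n (Y_mean k) - ?H) \<le> (\<integral>p. \<bar>(K n (Y_mean k) - ?H) p\<bar> \<partial>unit_square)"
    by (rule cut_norm_le_L1[OF int])
  also have "\<dots> \<le> (\<integral>p. \<bar>K n A p - W0 p\<bar> + \<delta> * (\<Sum>l<m. ?g l p) \<partial>unit_square)"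
  proof (rule integral_mono)
    show "integrable unit_square (\<lambda>p. \<bar>(K n (Y_mean k) - ?H) p\<bar>)" by (rule integrable_abs[OF int])
    show "integrable unit_square (\<lambda>p. \<bar>K n A p - W0 p\<bar> + \<delta> * (\<Sum>l<m. ?g l p))"
      by (intro Bochner_Integration.integrable_add int_W integrable_mult_right Bochner_Integration.integrable_sum int_g)
    fix p assume "p \<in> space unit_square"
    then have p: "p \<in> {0..1} \<times> {0..1}" by simp
    obtain i j where ij: "i < n" "j < n" "p \<in> block n i j" using block_cover[OF p n] .
    have "K n (Y_mean k) p = scheme_mean m \<delta> \<beta> k (K n A p) (\<lambda>l. - K n (block_average n (\<phi> (\<Gamma> (real l * \<delta>)))) p)"
      using ij(1,2) by (simp add: K_eq[OF ij] Y_mean_def c_def[abs_def])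
    moreover have "\<bar>K n A p\<bar> \<le> 1" "\<bar>W0 p\<bar> \<le> 1"
      using cube_mats_bound[OF A] kernels_bound[OF W0 p] by (simp_all add: K_eq[OF ij])
    ultimately have "\<bar>K n (Y_mean k) p - ?H p\<bar> \<le> \<bar>K n A p - W0 p\<bar> +
        \<delta> * (\<Sum>l<k. \<bar>- K n (block_average n (\<phi> (\<Gamma> (real l * \<delta>)))) p - - \<phi> (\<Gamma> (real l * \<delta>)) p\<bar>)"
      using scheme_mean_lipschitz[OF \<delta>_pos less_imp_le[OF k], of "K n A p" "W0 p" \<beta>
        "\<lambda>l. - K n (block_average n (\<phi> (\<Gamma> (real l * \<delta>)))) p" "\<lambda>l. - \<phi> (\<Gamma> (real l * \<delta>)) p"] by simp
    also have "(\<Sum>l<k. \<bar>- K n (block_average n (\<phi> (\<Gamma> (real l * \<delta>)))) p - - \<phi> (\<Gamma> (real l * \<delta>)) p\<bar>) = (\<Sum>l<k. ?g l p)"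
      by (intro sum.cong refl) linarith
    also have "\<dots> \<le> (\<Sum>l<m. ?g l p)" using k by (intro sum_mono2) auto
    finally show "\<bar>(K n (Y_mean k) - ?H) p\<bar> \<le> \<bar>K n A p - W0 p\<bar> + \<delta> * (\<Sum>l<m. ?g l p)"
      using \<delta>_pos by (simp add: fun_diff_def)
  qed
  also have "\<dots> = (\<integral>p. \<bar>K n A p - W0 p\<bar> \<partial>unit_square) + \<delta> * (\<Sum>l<m. \<integral>p. ?g l p \<partial>unit_square)"
  proof -
    have "integrable unit_square (\<lambda>p. \<delta> * (\<Sum>l<m. ?g l p))"
      by (intro integrable_mult_right Bochner_Integration.integrable_sum int_g)
    then show ?thesis
      by (simp only: Bochner_Integration.integral_add[OF int_W] Bochner_Integration.integral_mult_right_zero Bochner_Integration.integral_sum[OF int_g])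
  qed
  finally show ?thesis .
qed

end

lemma L1_le_L2_norm:
  assumes "V \<in> kernels" "W \<in> kernels"
  shows "(\<integral>p. \<bar>V p - W p\<bar> \<partial>unit_square) \<le> L2_norm (V - W)"
proof -
  let ?f = "\<lambda>p. \<bar>V p - W p\<bar>"
  have f [measurable]: "?f \<in> borel_measurable unit_square" using assms by (intro borel_measurable_abs borel_measurable_diff kernels_measurable)
  have f2: "?f p \<le> 2" if "p \<in> space unit_square" for p
    using kernels_bound[OF assms(1), of p] kernels_bound[OF assms(2), of p] that by simp
  have int: "integrable unit_square ?f" using f f2 by (intro unit_square.P.integrable_const_bound[of _ 2] AE_I2) auto
  have int2: "integrable unit_square (\<lambda>p. (?f p)\<^sup>2)"
  proof (rule unit_square.P.integrable_const_bound[of _ 4])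
    show "AE p in unit_square. norm ((?f p)\<^sup>2) \<le> 4"
    proof (rule AE_I2)
      fix p assume "p \<in> space unit_square"
      from power_mono[OF f2[OF this], of 2] show "norm ((?f p)\<^sup>2) \<le> 4" by simp
    qed
  qed (use f in \<open>intro borel_measurable_power\<close>)
  have "0 \<le> unit_square.P.variance ?f" by (rule unit_square.P.variance_positive)
  then have "(\<integral>p. ?f p \<partial>unit_square)\<^sup>2 \<le> (\<integral>p. (?f p)\<^sup>2 \<partial>unit_square)"
    unfolding unit_square.P.variance_eq[OF int int2] by simp
  then have "(\<integral>p. ?f p \<partial>unit_square)\<^sup>2 \<le> (\<integral>p. ((V - W) p)\<^sup>2 \<partial>unit_square)" by (simp add: fun_diff_def)
  then show ?thesis unfolding L2_norm_def by (rule real_le_rsqrt)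
qed

theorem theorem1p4:
  fixes \<beta> :: real
    and R :: "(real \<times> real \<Rightarrow> real) \<Rightarrow> real"
    and \<phi> :: "(real \<times> real \<Rightarrow> real) \<Rightarrow> real \<times> real \<Rightarrow> real"
    and W0 :: "real \<times> real \<Rightarrow> real" and W0n :: "nat \<Rightarrow> real \<times> real \<Rightarrow> real"
    and M :: "nat \<Rightarrow> 'a measure" and F :: "nat \<Rightarrow> real \<Rightarrow> 'a measure"
    and Bn Xn Lpn Lmn :: "nat \<Rightarrow> real \<Rightarrow> 'a \<Rightarrow> nat \<Rightarrow> nat \<Rightarrow> real"
    and N :: "'b measure" and G :: "real \<Rightarrow> 'b measure"
    and U1 U2 :: "'b \<Rightarrow> real" and B X Lp Lm :: "real \<Rightarrow> 'b \<Rightarrow> real"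
    and \<Gamma> :: "real \<Rightarrow> real \<times> real \<Rightarrow> real"
  assumes "\<beta> > 0"
    and "invariant_functional R"
    and "frechet_like_derivative R \<phi>"
    and "\<forall>n\<ge>1. C1_up_to_boundary n (R \<circ> K n)"
    and "\<exists>\<kappa>2\<ge>0. \<forall>W1\<in>kernels. \<forall>W2\<in>kernels. L2_norm (\<phi> W1 - \<phi> W2) \<le> \<kappa>2 * L2_norm (W1 - W2)"
    and "\<exists>\<kappa>cut\<ge>0. AE p in unit_square. \<forall>U\<in>kernels. \<forall>V\<in>kernels.
           \<bar>\<phi> U p - \<phi> V p\<bar> \<le> \<kappa>cut * cut_norm (U - V)"
    and "W0 \<in> kernels"
    and "\<forall>n\<ge>1. W0n n \<in> step_kernels n"
    and "(\<lambda>n. L2_norm (W0n n - W0)) \<longlonglongrightarrow> 0"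
    and "\<forall>n\<ge>1. matrix_sde n (M n) (F n) (R \<circ> K n) \<beta> (Mat n (W0n n)) (Bn n) (Xn n) (Lpn n) (Lmn n)"
    and "coupled_system N G \<phi> \<beta> W0 U1 U2 B X Lp Lm \<Gamma>"
  shows "\<forall>T>0. tendsto_0_in_probability M
           (\<lambda>n \<omega>. SUP s\<in>{0..T}. cut_norm (K n (Xn n s \<omega>) - \<Gamma> s))"
proof (intro allI impI)
  fix T :: real assume T: "T > 0"
  obtain \<kappa> where \<kappa>: "\<kappa> \<ge> 0"
    "AE p in unit_square. \<forall>U\<in>kernels. \<forall>V\<in>kernels. \<bar>\<phi> U p - \<phi> V p\<bar> \<le> \<kappa> * cut_norm (U - V)"
    using assms(6) by blast
  interpret lim: limit_system \<phi> \<kappa> N G \<beta> W0 U1 U2 B X Lp Lm \<Gamma>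
    using assms(1,3,7,11) \<kappa> by unfold_locales (auto simp: frechet_like_derivative_def)
  let ?Y = "\<lambda>n \<omega>. SUP s\<in>{0..T}. cut_norm (K n (Xn n s \<omega>) - \<Gamma> s)"
  have main: "\<forall>\<^sub>F n in sequentially. outer_measure_of (M n) {\<omega> \<in> space (M n). \<bar>?Y n \<omega>\<bar> > e} < ennreal \<xi>"
    if "e > 0" "\<xi> > 0" for e \<xi> :: real
  proof -
    define C where "C = 2 * (\<kappa> * T + 13) * exp (2 * \<kappa> * T)"
    have C: "C > 0" unfolding C_def using \<kappa>(1) T by (intro mult_pos_pos add_nonneg_pos) auto
    define \<epsilon> where "\<epsilon> = min 1 (min (\<xi> / 3) (e / C))"
    have \<epsilon>: "\<epsilon> > 0" "\<epsilon> \<le> 1" "\<epsilon> \<le> \<xi> / 3" "\<epsilon> \<le> e / C" unfolding \<epsilon>_def using that C by (simp, linarith+)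
    have C\<epsilon>: "2 * ((\<kappa> * T + 13) * \<epsilon>) * exp (2 * \<kappa> * T) \<le> e"
      using \<epsilon>(4) C by (simp add: C_def field_simps)
    have \<epsilon>2: "\<epsilon>\<^sup>2 > 0" "\<epsilon>\<^sup>2 \<le> \<epsilon>" using \<epsilon>(1,2) by (simp_all add: power2_eq_square mult_left_le)
    obtain m \<eta> where m: "m \<ge> 1" and \<eta>: "\<eta> > 0" "\<beta> * \<eta> \<le> \<epsilon>\<^sup>2" and mesh: "lim.\<phi>_bound * (T / real m) \<le> \<epsilon>\<^sup>2"
      and rough: "rough_prob T m \<eta> \<le> ennreal (\<epsilon>\<^sup>2)"
      and modulus: "\<And>k s. k < m \<Longrightarrow> real k * (T / real m) \<le> s \<Longrightarrow> s \<le> real (Suc k) * (T / real m) \<Longrightarrow>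
        cut_norm (\<Gamma> s - \<Gamma> (real k * (T / real m))) \<le> \<epsilon>\<^sup>2"
      and scheme: "\<And>k. k < m \<Longrightarrow> cut_norm (\<Gamma> (real k * (T / real m)) - lim.\<Gamma>_scheme m (T / real m) k) \<le> \<epsilon>\<^sup>2"
      using lim.discretisation_exists[OF T \<epsilon>2(1)] by metis
    let ?\<delta> = "T / real m"
    define b where "b = (\<lambda>n. L2_norm (W0n n - W0) + ?\<delta> * (\<Sum>l<m. \<integral>p. \<bar>K n (block_average n (\<phi> (\<Gamma> (real l * ?\<delta>)))) p - \<phi> (\<Gamma> (real l * ?\<delta>)) p\<bar> \<partial>unit_square))"
    have "b \<longlonglongrightarrow> 0 + ?\<delta> * (\<Sum>l<m. 0)"
      unfolding b_def
    proof (intro tendsto_add tendsto_mult tendsto_sum tendsto_const assms(9) block_average_tendsto_L1 Linfty_sym_integrable lim.Linfty lim.\<Gamma>_kernel)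
      show "0 \<le> real l * ?\<delta>" for l using T by simp
    qed
    then have "eventually (\<lambda>n. b n < \<epsilon>) sequentially" using \<epsilon>(1) by (intro order_tendstoD) auto
    moreover have "eventually (\<lambda>n. real m * (64 / \<epsilon> ^ 4) / real n < \<xi> / 3) sequentially"
      using lim_const_over_n[of "real m * (64 / \<epsilon> ^ 4)"] that by (intro order_tendstoD) auto
    ultimately show ?thesis using eventually_ge_at_top[of 1]
    proof eventually_elim
      case (elim n)
      obtain A where A: "A \<in> cube_mats n" "W0n n = K n A" using assms(8) elim(3) by (auto simp: step_kernels_def)
      have "Mat n (W0n n) = A" unfolding A(2) using A(1) by (intro Mat_K) (simp add: cube_mats_def)
      with assms(10) elim(3) have sde: "matrix_sde n (M n) (F n) (R \<circ> K n) \<beta> A (Bn n) (Xn n) (Lpn n) (Lmn n)" by metis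
      interpret grid: matrix_grid \<phi> \<kappa> n "M n" "F n" R \<beta> A "Bn n" "Xn n" "Lpn n" "Lmn n" \<Gamma> T \<eta> \<epsilon> m
      proof
        show "cut_norm (\<Gamma> s - \<Gamma> (real k * (T / real m))) \<le> \<epsilon>"
          if "k < m" "real k * (T / real m) \<le> s" "s \<le> real (Suc k) * (T / real m)" for k s
          using modulus[OF that] \<epsilon>2(2) by linarith
      qed (use elim A sde assms(1,3) T m \<eta> mesh \<epsilon>2 lim.\<Gamma>_kernel in auto)
      have mean: "cut_norm (K n (grid.Y_mean k) - \<Gamma> (real k * grid.\<delta>)) \<le> 2 * \<epsilon>" if k: "k < m" for k
      proof -
        let ?H = "lim.\<Gamma>_scheme m grid.\<delta> k"
        have H: "?H = (\<lambda>p. scheme_mean m grid.\<delta> \<beta> k (W0 p) (\<lambda>l. - \<phi> (\<Gamma> (real l * grid.\<delta>)) p))"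
          by (simp add: lim.\<Gamma>_scheme_def fun_eq_iff)
        have int: "integrable unit_square ?H"
          using k by (intro lim.\<Gamma>_scheme_integrable grid.\<delta>_pos) simp
        have "cut_norm (K n (grid.Y_mean k) - ?H) \<le> b n"
        proof -
          have "(\<integral>p. \<bar>K n A p - W0 p\<bar> \<partial>unit_square) \<le> L2_norm (W0n n - W0)"
            unfolding A(2) by (rule L1_le_L2_norm[OF K_in_kernels[OF A(1) elim(3)] assms(7)])
          then show ?thesis using grid.Y_mean_close[OF assms(7) k int[unfolded H], folded H] unfolding b_def grid.\<delta>_def by linarith
        qed
        moreover have "cut_norm (?H - \<Gamma> (real k * grid.\<delta>)) \<le> \<epsilon>\<^sup>2"
          unfolding cut_norm_commute[of ?H] unfolding grid.\<delta>_def by (rule scheme[OF k])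
        moreover have "cut_norm (K n (grid.Y_mean k) - \<Gamma> (real k * grid.\<delta>)) \<le> cut_norm (K n (grid.Y_mean k) - ?H) + cut_norm (?H - \<Gamma> (real k * grid.\<delta>))"
          by (rule cut_norm_triangle[OF integrable_K int kernels_integrable[OF lim.\<Gamma>_kernel[OF grid.grid_nonneg]]])
        ultimately show ?thesis using elim(1) \<epsilon>2(2) by linarith
      qed
      have "outer_measure_of (M n) {\<omega> \<in> space (M n). \<bar>?Y n \<omega>\<bar> > e} \<le>
        outer_measure_of (M n) {\<omega> \<in> space (M n). \<bar>?Y n \<omega>\<bar> > 2 * ((\<kappa> * T + 13) * \<epsilon>) * exp (2 * \<kappa> * T)}"
        using C\<epsilon> by (intro outer_measure_of_mono) auto
      also have "\<dots> \<le> ennreal (\<epsilon> + real m * (64 / \<epsilon> ^ 4) / real n)"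
        by (rule grid.outer_measure_estimate[OF mean rough])
      also have "\<dots> < ennreal \<xi>" using elim(2) \<epsilon>(1,3) that by (intro ennreal_lessI) auto
      finally show ?case .
    qed
  qed
  show "tendsto_0_in_probability M ?Y"
    unfolding tendsto_0_in_probability_def
  proof (intro allI impI)
    fix e :: real assume e: "e > 0"
    show "(\<lambda>n. outer_measure_of (M n) {\<omega> \<in> space (M n). \<bar>?Y n \<omega>\<bar> > e}) \<longlonglongrightarrow> 0"
    proof (rule order_tendstoI)
      fix a :: ennreal assume "0 < a"
      then obtain \<xi> where "0 < \<xi>" "\<xi> < a" using dense by blast
      then have "\<xi> < top" by (meson less_le_trans top_greatest)
      then have \<xi>: "ennreal (enn2real \<xi>) = \<xi>" "0 < enn2real \<xi>"
        using \<open>0 < \<xi>\<close> by (simp_all add: enn2real_positive_iff)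
      have "\<forall>\<^sub>F n in sequentially. outer_measure_of (M n) {\<omega> \<in> space (M n). \<bar>?Y n \<omega>\<bar> > e} < \<xi>"
        using main[OF e \<xi>(2)] unfolding \<xi>(1) .
      then show "\<forall>\<^sub>F n in sequentially. outer_measure_of (M n) {\<omega> \<in> space (M n). \<bar>?Y n \<omega>\<bar> > e} < a"
        by eventually_elim (use \<open>\<xi> < a\<close> in order)
    qed auto
  qed
qed

end
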